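(* For complete graphs $K_n$: $$h\ell(K_n)=\begin{cases}0,& n=3,\\ \lceil \frac n2\rceil,& n\ge4,\end{cases}\qquad \ell(K_n)=\begin{cases}\infty,& n<3,\\ 0,& n=3,\\ 1,& n=4,\\ \lceil\frac n2\rceil,& n\ge5.\end{cases}$$
   Context: All graphs are connected, undirected, simple and finite. A graph is Hamiltonian if it contains a cycle that visits every vertex exactly once. A graph embedding is an embedding $G\to S^3$, up to ambient isotopy; the spatial graph $\mathcal{G}$ is its image up to ambient isotopy. Everything is tame (piecewise linear). A cycle is unknotted if it can be embedded as the equator of a sphere $S^2$. The fragments of a graph $G$ with respect to a cycle $C$ are the closures of the connected components of $G-C$ (topologically; so an edge not in $C$ with both endpoints on $C$ is a fragment). A diagram of $\mathcal{G}$ is the image of a projection of $\mathcal{G}$ to $\mathbb{R}^2$ such that all intersections are transversal, no vertices and at most two points are mapped to a crossing, and at each double point over/under information is assigned. It is reduced if no Reidemeister moves of type 1 and 2 can be applied to reduce its number of crossings. $\mathcal{G}$ is semi-leveled if there is an unknotted cycle $C$ (the spine) and a diagram $D$ of $\mathcal{G}$ (a semi-leveled diagram) in which no fragment with respect to $C$ has self-crossings, crossings with $C$, or both over- and under-crossings with another fragment. A reduced semi-leveled diagram in which every fragment lies in the bounded connected component of $\mathbb{R}^2\setminus C$ is divided in levels if there is a partition $\{L_1,\dots,L_n\}$ of all the fragments such that $L_1$ is the set of fragments that do not cross over any other fragment, and for $i>1$ the set $L_i$ consists of the fragments that cross over at least one fragment in $L_{i-1}$ and only cross over fragments in sets $L_k$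 with $k<i$; then $n$ is the number of levels ($n=0$ if there are no fragments). A connected spatial graph is leveled (with spine $C$) if it has a semi-leveled diagram (with spine $C$) that is divided in levels; it is Hamiltonian leveled if the spine is a Hamiltonian cycle of the underlying graph. The level number $\ell(\mathcal{G})$ of a spatial graph is the minimum number of levels ranging over all possible spines, with $\ell(\mathcal{G})=\infty$ if $\mathcal{G}$ admits no leveled embedding; $\ell(G)$ of an abstract graph is the minimum of $\ell(\mathcal{G})$ over all embeddings of $G$. The Hamiltonian level number $h\ell(\mathcal{G})$ is the minimum number of levels ranging over all choices of Hamiltonian spines for a Hamiltonian leveled embedding of $\mathcal{G}$; $h\ell(G)$ of an abstract Hamiltonian graph is the minimum over all its embeddings. *)

theory Defs
  imports "HOL-Analysis.Analysis" "HOL-Library.Extended_Nat"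
begin

section \<open>Graphs and cycles\<close>

record 'v graph =
  verts :: "'v set"
  edges :: "'v set set"

definition complete_graph :: "nat \<Rightarrow> nat graph" where
  "complete_graph n =
     \<lparr>verts = {..<n}, edges = {{u, v} | u v. u < n \<and> v < n \<and> u \<noteq> v}\<rparr>"

definition cycle_edges :: "'v list \<Rightarrow> 'v set set" where
  "cycle_edges c = {{c ! i, c ! (Suc i mod length c)} | i. i < length c}"

definition is_cycle :: "'v graph \<Rightarrow> 'v list \<Rightarrow> bool" where
  "is_cycle G c \<longleftrightarrow>
     3 \<le> length c \<and> distinct c \<and> set c \<subseteq> verts G \<and> cycle_edges c \<subseteq> edges G"

definition hamiltonian_cycle :: "'v graph \<Rightarrow> 'v list \<Rightarrow> bool" where
  "hamiltonian_cycle G c \<longleftrightarrow> is_cycle G c \<and> set c = verts G"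


section \<open>Spatial graphs\<close>

text \<open>Space is \<open>complex \<times> real\<close>, so that \<open>fst\<close> is the projection of diagrams to the plane and
  \<open>snd\<close> is the height that decides between over and under. The norm of a product type is the
  Euclidean one, so \<open>S3\<close> below is the round unit sphere of a four-dimensional space.\<close>

type_synonym space3 = "complex \<times> real"
type_synonym space4 = "space3 \<times> real"

definition S3 :: "space4 set" where
  "S3 = sphere 0 1"

text \<open>Inverse stereographic projection; it identifies \<open>space3\<close> with \<open>S3 - {(0, 1)}\<close>.\<close>

definition to_S3 :: "space3 \<Rightarrow> space4" where
  "to_S3 x = ((2 / ((norm x)\<^sup>2 + 1)) *\<^sub>R x, ((norm x)\<^sup>2 - 1) / ((norm x)\<^sup>2 + 1))"

text \<open>A drawing maps vertices to points and edges to point sets, which \<open>embedding\<close> requires to be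
  arcs; parametrisations of the edges are irrelevant.\<close>

record ('v, 'p) drawing =
  vpos :: "'v \<Rightarrow> 'p"
  earc :: "'v set \<Rightarrow> 'p set"

definition map_drawing :: "('p \<Rightarrow> 'q) \<Rightarrow> ('v, 'p) drawing \<Rightarrow> ('v, 'q) drawing" where
  "map_drawing f D = \<lparr>vpos = f \<circ> vpos D, earc = (\<lambda>e. f ` earc D e)\<rparr>"

definition embedding :: "'v graph \<Rightarrow> ('v, 'p::topological_space) drawing \<Rightarrow> 'p set \<Rightarrow> bool" where
  "embedding G D S \<longleftrightarrow>
     inj_on (vpos D) (verts G) \<and> vpos D ` verts G \<subseteq> S \<and>
     (\<forall>e\<in>edges G. earc D e \<subseteq> S \<and>
        (\<exists>\<gamma>. arc \<gamma> \<and> path_image \<gamma> = earc D e \<and> {pathstart \<gamma>, pathfinish \<gamma>} = vpos D ` e)) \<and>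
     (\<forall>v\<in>verts G. \<forall>e\<in>edges G. vpos D v \<in> earc D e \<longrightarrow> v \<in> e) \<and>
     (\<forall>e\<in>edges G. \<forall>f\<in>edges G. e \<noteq> f \<longrightarrow> earc D e \<inter> earc D f \<subseteq> vpos D ` (e \<inter> f))"

definition support :: "'v graph \<Rightarrow> ('v, 'p) drawing \<Rightarrow> 'p set" where
  "support G D = vpos D ` verts G \<union> \<Union> (earc D ` edges G)"

definition cycle_support :: "('v, 'p) drawing \<Rightarrow> 'v list \<Rightarrow> 'p set" where
  "cycle_support D c = \<Union> (earc D ` cycle_edges c)"

text \<open>Only the images are compared: an isotopy may induce a nontrivial automorphism of \<open>G\<close>.\<close>

definition ambient_isotopic ::
  "'v graph \<Rightarrow> ('v, space4) drawing \<Rightarrow> ('v, space4) drawing \<Rightarrow> bool" where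
  "ambient_isotopic G D D' \<longleftrightarrow>
     (\<exists>h. homotopic_with_canon (\<lambda>f. \<exists>g. homeomorphism S3 S3 f g) S3 S3 id h \<and>
          h ` (vpos D ` verts G) = vpos D' ` verts G \<and>
          (\<lambda>e. h ` earc D e) ` edges G = earc D' ` edges G)"

definition polygonal :: "'p::real_vector set \<Rightarrow> bool" where
  "polygonal A \<longleftrightarrow> (\<exists>F. finite F \<and> A = (\<Union>(x, y)\<in>F. closed_segment x y))"

definition polygonal_embedding :: "'v graph \<Rightarrow> ('v, space3) drawing \<Rightarrow> bool" where
  "polygonal_embedding G D \<longleftrightarrow> embedding G D UNIV \<and> (\<forall>e\<in>edges G. polygonal (earc D e))"

definition tame_embedding :: "'v graph \<Rightarrow> ('v, space4) drawing \<Rightarrow> bool" where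
  "tame_embedding G \<G> \<longleftrightarrow> embedding G \<G> S3 \<and>
     (\<exists>D. polygonal_embedding G D \<and> ambient_isotopic G (map_drawing to_S3 D) \<G>)"

text \<open>The sphere in question is \<open>f ` {x \<in> S3. snd x = 0}\<close>; letting \<open>f\<close> be a homeomorphism of all
  of \<open>S3\<close> is what makes it tame.\<close>

definition unknotted :: "space4 set \<Rightarrow> bool" where
  "unknotted K \<longleftrightarrow>
     (\<exists>f g. homeomorphism S3 S3 f g \<and> K = f ` {((z, 0), 0) | z :: complex. norm z = 1})"


section \<open>Diagrams\<close>

text \<open>A diagram is represented by a polygonal drawing in space whose projection is regular: its
  picture is the image under \<open>fst\<close>, and the over/under information is given by \<open>snd\<close>. At a
  crossing both strands are locally straight, with linearly independent projected directions.\<close>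

definition transversal_at :: "space3 set \<Rightarrow> space3 \<Rightarrow> space3 \<Rightarrow> bool" where
  "transversal_at X a b \<longleftrightarrow>
     (\<exists>u v r. 0 < r \<and> \<not> collinear {0, fst u, fst v} \<and>
        X \<inter> ball a r = range (\<lambda>t. a + t *\<^sub>R u) \<inter> ball a r \<and>
        X \<inter> ball b r = range (\<lambda>t. b + t *\<^sub>R v) \<inter> ball b r)"

definition regular_projection :: "'v graph \<Rightarrow> ('v, space3) drawing \<Rightarrow> bool" where
  "regular_projection G D \<longleftrightarrow>
     (\<forall>a\<in>support G D. \<forall>b\<in>support G D. a \<noteq> b \<and> fst a = fst b \<longrightarrow>
        a \<notin> vpos D ` verts G \<and> b \<notin> vpos D ` verts G \<and>
        (\<forall>c\<in>support G D. fst c = fst a \<longrightarrow> c = a \<or> c = b) \<and>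
        transversal_at (support G D) a b)"

definition is_diagram :: "'v graph \<Rightarrow> ('v, space4) drawing \<Rightarrow> ('v, space3) drawing \<Rightarrow> bool" where
  "is_diagram G \<G> D \<longleftrightarrow> polygonal_embedding G D \<and> regular_projection G D \<and>
     ambient_isotopic G (map_drawing to_S3 D) \<G>"

text \<open>A Reidemeister move of type 1 removes a crossing exactly where a piece of an edge projects to a
  simple closed curve that bounds an empty disc; a move of type 2 removes two crossings exactly where
  two pieces of edges, one of them over the other at both ends, project to the two sides of an empty
  bigon. The ends of the pieces are double points, so in a regular projection no vertex lies on them.\<close>

definition reducible_R1 :: "'v graph \<Rightarrow> ('v, space3) drawing \<Rightarrow> bool" where
  "reducible_R1 G D \<longleftrightarrow>
     (\<exists>e\<in>edges G. \<exists>\<gamma>. arc \<gamma> \<and> path_image \<gamma> \<subseteq> earc D e \<and>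
        simple_path (fst \<circ> \<gamma>) \<and> fst (pathstart \<gamma>) = fst (pathfinish \<gamma>) \<and>
        inside (fst ` path_image \<gamma>) \<inter> fst ` support G D = {})"

definition reducible_R2 :: "'v graph \<Rightarrow> ('v, space3) drawing \<Rightarrow> bool" where
  "reducible_R2 G D \<longleftrightarrow>
     (\<exists>e\<in>edges G. \<exists>f\<in>edges G. \<exists>\<gamma> \<delta>.
        arc (fst \<circ> \<gamma>) \<and> path \<gamma> \<and> path_image \<gamma> \<subseteq> earc D e \<and>
        arc (fst \<circ> \<delta>) \<and> path \<delta> \<and> path_image \<delta> \<subseteq> earc D f \<and>
        fst (pathstart \<gamma>) = fst (pathstart \<delta>) \<and> snd (pathstart \<gamma>) > snd (pathstart \<delta>) \<and>
        fst (pathfinish \<gamma>) = fst (pathfinish \<delta>) \<and> snd (pathfinish \<gamma>) > snd (pathfinish \<delta>) \<and>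
        fst ` path_image \<gamma> \<inter> fst ` path_image \<delta> = {fst (pathstart \<gamma>), fst (pathfinish \<gamma>)} \<and>
        inside (fst ` path_image \<gamma> \<union> fst ` path_image \<delta>) \<inter> fst ` support G D = {})"

definition reduced :: "'v graph \<Rightarrow> ('v, space3) drawing \<Rightarrow> bool" where
  "reduced G D \<longleftrightarrow> \<not> reducible_R1 G D \<and> \<not> reducible_R2 G D"


section \<open>Leveled diagrams\<close>

definition fragments :: "'v graph \<Rightarrow> ('v, space3) drawing \<Rightarrow> 'v list \<Rightarrow> space3 set set" where
  "fragments G D c = closure ` components (support G D - cycle_support D c)"

definition crosses_over :: "space3 set \<Rightarrow> space3 set \<Rightarrow> bool" where
  "crosses_over A B \<longleftrightarrow> (\<exists>a\<in>A. \<exists>b\<in>B. fst a = fst b \<and> snd a > snd b)"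

definition semi_leveled_diagram :: "'v graph \<Rightarrow> ('v, space3) drawing \<Rightarrow> 'v list \<Rightarrow> bool" where
  "semi_leveled_diagram G D c \<longleftrightarrow>
     is_cycle G c \<and> unknotted (to_S3 ` cycle_support D c) \<and>
     (\<forall>A\<in>fragments G D c.
        \<not> crosses_over A A \<and>
        \<not> crosses_over A (cycle_support D c) \<and> \<not> crosses_over (cycle_support D c) A \<and>
        (\<forall>B\<in>fragments G D c. B \<noteq> A \<longrightarrow> \<not> (crosses_over A B \<and> crosses_over B A)))"

definition level_partition :: "space3 set set \<Rightarrow> nat \<Rightarrow> (nat \<Rightarrow> space3 set set) \<Rightarrow> bool" where
  "level_partition \<F> n L \<longleftrightarrow>
     (\<Union>i\<in>{1..n}. L i) = \<F> \<and> disjoint_family_on L {1..n} \<and> (\<forall>i\<in>{1..n}. L i \<noteq> {}) \<and>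
     (1 \<le> n \<longrightarrow> L 1 = {A \<in> \<F>. \<forall>B\<in>\<F>. B \<noteq> A \<longrightarrow> \<not> crosses_over A B}) \<and>
     (\<forall>i\<in>{2..n}. L i = {A \<in> \<F>. (\<exists>B\<in>L (i - 1). crosses_over A B) \<and>
        (\<forall>B\<in>\<F>. B \<noteq> A \<and> crosses_over A B \<longrightarrow> (\<exists>k\<in>{1..<i}. B \<in> L k))})"

text \<open>Speaking of the bounded component of the complement of the spine presupposes that the spine
  projects to a simple closed curve; \<open>inside\<close> is then that component. The ends of a fragment lie on
  the spine and have to be exempted.\<close>

definition divided_in_levels ::
  "'v graph \<Rightarrow> ('v, space3) drawing \<Rightarrow> 'v list \<Rightarrow> nat \<Rightarrow> bool" where
  "divided_in_levels G D c n \<longleftrightarrow>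
     semi_leveled_diagram G D c \<and> reduced G D \<and> inj_on fst (cycle_support D c) \<and>
     (\<forall>A\<in>fragments G D c. fst ` (A - cycle_support D c) \<subseteq> inside (fst ` cycle_support D c)) \<and>
     (\<exists>L. level_partition (fragments G D c) n L)"

definition leveled_with ::
  "'v graph \<Rightarrow> ('v, space4) drawing \<Rightarrow> 'v list \<Rightarrow> nat \<Rightarrow> bool" where
  "leveled_with G \<G> c n \<longleftrightarrow>
     connected (support G \<G>) \<and> (\<exists>D. is_diagram G \<G> D \<and> divided_in_levels G D c n)"

text \<open>The infimum of the empty set of extended naturals is \<open>\<infinity>\<close>; nonempty infima are minima.\<close>

definition spatial_level_number :: "'v graph \<Rightarrow> ('v, space4) drawing \<Rightarrow> enat" where
  "spatial_level_number G \<G> = Inf {enat n | n c. leveled_with G \<G> c n}"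

definition level_number :: "'v graph \<Rightarrow> enat" where
  "level_number G = (INF \<G>\<in>{\<G>. tame_embedding G \<G>}. spatial_level_number G \<G>)"

definition spatial_hamiltonian_level_number :: "'v graph \<Rightarrow> ('v, space4) drawing \<Rightarrow> enat" where
  "spatial_hamiltonian_level_number G \<G> =
     Inf {enat n | n c. hamiltonian_cycle G c \<and> leveled_with G \<G> c n}"

definition hamiltonian_level_number :: "'v graph \<Rightarrow> enat" where
  "hamiltonian_level_number G =
     (INF \<G>\<in>{\<G>. tame_embedding G \<G>}. spatial_hamiltonian_level_number G \<G>)"

end

theory Submission
  imports Defs
begin

text \<open>A spine $c$ of length $k$ projects to a simple closed curve, and all fragments are drawn inside the disc
that it bounds. Fragments in one level do not cross, so the lower bounds are statements about
noncrossing families in a disc.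

If the spine is Hamiltonian, the fragments are the $n (n - 3) / 2$ chords of an $n$-gon. Two chords whose
ends alternate along the spine must cross, by \<open>chord_separates\<close>; hence the chords in one level
are pairwise noncrossing diagonals, of which there are at most $n - 3$
(\<open>noncrossing_diagonals_bound\<close>). So at least $n / 2$ levels are needed.
If the spine is not Hamiltonian, the vertices off the spine and their edges form a single further
fragment, because they are pairwise adjacent. There is only one such vertex: two of them would give, together
with three spine vertices and the outside of the disc, a planar drawing of $K_{3,3}$
(\<open>no_second_star\<close>). The fragment of that vertex is a star that reaches every spine vertex, so it crosses
all chords of the spine and shares its level with none. The $k (k - 3) / 2$ chords,
where $k = n - 1$, need $k / 2$ further levels when $n \<ge> 5$, and the total is no smaller than in the
Hamiltonian case. Only for $n = 4$, where the triangle has no chords, does the star win.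

For the upper bound the vertices lie on a parabola, the spine is the convex polygon through them, and the
chord $uv$ runs at a height determined by $u + v$ modulo $n$. The chords with a fixed value of $u + v$ modulo $n$
are pairwise disjoint, and those of two consecutive values form a zigzag without crossings, so pairs of values give
$\<lceil>n / 2\<rceil>$ levels. Turning the chord $uv$ to $(u - 1)(v - 1)$ lowers the sum by $2$ and
produces a crossing chord of the next lower level, which is what a division into levels requires. The abscissas are
chosen such that no three disjoint chords are concurrent (\<open>exists_no_three_concurrent\<close>), so the projection is
regular; straight chords cross at most once, so the diagram is reduced. The spine is unknotted since
a radial homeomorphism of the plane takes the polygon to the unit circle and extends to the
three-sphere (\<open>unknotted_polygon\<close>).\<close>

section \<open>Cutting a disc along arcs\<close>

text \<open>The ends are limits of interior points of the parameter interval; this recovers a fragment from a component of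
the complement of the spine.\<close>

lemma closure_arc_endless:
  fixes g :: "real \<Rightarrow> 'a::real_normed_vector"
  assumes "arc g"
  shows "closure (path_image g - {pathstart g, pathfinish g}) = path_image g"
proof
  show "closure (path_image g - {pathstart g, pathfinish g}) \<subseteq> path_image g"
    using closed_arc_image[OF assms] by (intro closure_minimal) auto
  have "continuous_on (closure {0<..<1}) g"
    using assms by (auto simp: arc_def path_def)
  then have "g ` closure {0<..<1} \<subseteq> closure (g ` {0<..<1})"
    by (rule image_closure_subset) (auto simp: closure_subset)
  then show "path_image g \<subseteq> closure (path_image g - {pathstart g, pathfinish g})"
    using simple_path_endless[OF arc_imp_simple_path[OF assms]] by (simp add: path_image_def)
qed

lemma arc_minus_ends:
  fixes g :: "real \<Rightarrow> 'a::real_normed_vector"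
  assumes "arc g" "T \<inter> path_image g \<subseteq> {pathstart g, pathfinish g}"
  shows "connected (path_image g - T)" "closure (path_image g - T) = path_image g"
    "path_image g - T \<noteq> {}"
proof -
  let ?E = "path_image g - {pathstart g, pathfinish g}"
  have sub: "?E \<subseteq> path_image g - T" "path_image g - T \<subseteq> closure ?E" 
    using assms closure_arc_endless by auto
  show "connected (path_image g - T)"
    using connected_intermediate_closure sub
      connected_simple_path_endless[OF arc_imp_simple_path[OF assms(1)]] by blast
  show "closure (path_image g - T) = path_image g"
    using sub closure_mono closure_arc_endless[OF assms(1)] closed_arc_image[OF assms(1)]
    by (metis Diff_subset closure_minimal subset_antisym)
  show "path_image g - T \<noteq> {}"
    using sub(1) nonempty_simple_path_endless[OF arc_imp_simple_path[OF assms(1)]] by blast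
qed

text \<open>The chord \<open>c\<close> cuts the disc bounded by \<open>c1\<close> and \<open>c2\<close> into two open parts. A connected set that avoids the
chord lies in one part, and if it accumulates at \<open>v\<close> on \<open>c2\<close>, that part is the one bounded by \<open>c2\<close> and \<open>c\<close>,
whose closure meets \<open>c1\<close> only in the ends of the chord. All planarity arguments below rest on this.\<close>

lemma chord_separates:
  fixes c1 c2 c :: "real \<Rightarrow> complex"
  assumes arcs: "arc c1" "arc c2" "arc c"
    and ends: "pathstart c1 = a" "pathfinish c1 = b" "pathstart c2 = a" "pathfinish c2 = b"
      "pathstart c = a" "pathfinish c = b"
    and int12: "path_image c1 \<inter> path_image c2 = {a, b}"
    and cin: "path_image c - {a, b} \<subseteq> inside (path_image c1 \<union> path_image c2)"
    and B: "connected B" "B \<subseteq> inside (path_image c1 \<union> path_image c2)" "B \<inter> path_image c = {}"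
    and v: "v \<in> closure B" "v \<in> path_image c2 - {a, b}"
  shows "B \<subseteq> inside (path_image c2 \<union> path_image c)" 
    and "closure B \<inter> path_image c1 \<subseteq> {a, b}"
proof -
  let ?J = "path_image c1 \<union> path_image c2"
  have ab: "a \<noteq> b"
    using arc_distinct_ends[OF arcs(1)] ends by simp
  have ab_in: "a \<in> path_image c1" "b \<in> path_image c1" "a \<in> path_image c2" "b \<in> path_image c2"
    "a \<in> path_image c" "b \<in> path_image c"
    using ends by (metis pathstart_in_path_image pathfinish_in_path_image)+
  have disj: "inside ?J \<inter> ?J = {}"
    by simp
  have c1c: "path_image c1 \<inter> path_image c = {a, b}" and c2c: "path_image c2 \<inter> path_image c = {a, b}"
    using cin disj ab_in by blast+
  have "c (1/2) \<in> path_image c - {a, b}"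
  proof -
    have "inj_on c {0..1}" using arcs(3) arc_def by blast
    then have "c (1/2) \<noteq> c 0" "c (1/2) \<noteq> c 1"
      by (auto dest: inj_onD)
    then show ?thesis using ends by (auto simp: pathstart_def pathfinish_def path_image_def)
  qed
  then have ne: "path_image c \<inter> inside ?J \<noteq> {}" using cin by blast
  obtain dj: "inside (path_image c1 \<union> path_image c) \<inter> inside (path_image c2 \<union> path_image c) = {}"
    and un: "inside (path_image c1 \<union> path_image c) \<union> inside (path_image c2 \<union> path_image c) \<union>
           (path_image c - {a, b}) = inside ?J"
    using split_inside_simple_closed_curve[OF arcs(1)[THEN arc_imp_simple_path] ends(1,2)
        arcs(2)[THEN arc_imp_simple_path] ends(3,4) arcs(3)[THEN arc_imp_simple_path] ends(5,6)
        ab int12 c1c c2c ne] by blast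
  have cl: "closed (path_image c1 \<union> path_image c)" "closed (path_image c2 \<union> path_image c)"
    using arcs by (auto intro!: closed_Un simp: closed_arc_image)
  have "B \<subseteq> inside (path_image c1 \<union> path_image c) \<union> inside (path_image c2 \<union> path_image c)"
    using B(2,3) un by blast
  moreover have "open (inside (path_image c1 \<union> path_image c))" "open (inside (path_image c2 \<union> path_image c))"
    using cl by (auto intro: open_inside)
  ultimately have cases: "B \<subseteq> inside (path_image c1 \<union> path_image c) \<or> B \<subseteq> inside (path_image c2 \<union> path_image c)"
    using connectedD[OF B(1)] dj by blast
  have not1: "\<not> B \<subseteq> inside (path_image c1 \<union> path_image c)"
  proof
    assume "B \<subseteq> inside (path_image c1 \<union> path_image c)"
    then have "v \<in> path_image c1 \<union> path_image c \<union> inside (path_image c1 \<union> path_image c)"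
      using closure_mono closure_inside_subset[OF cl(1)] v(1) by blast
    then show False using v(2) c2c int12 un disj by blast
  qed
  with cases show B2: "B \<subseteq> inside (path_image c2 \<union> path_image c)" by blast
  show "closure B \<inter> path_image c1 \<subseteq> {a, b}"
  proof
    fix w assume w: "w \<in> closure B \<inter> path_image c1"
    then have "w \<in> path_image c2 \<union> path_image c \<union> inside (path_image c2 \<union> path_image c)"
      using closure_mono[OF B2] closure_inside_subset[OF cl(2)] by blast
    then show "w \<in> {a, b}" using w c1c int12 un disj by blast
  qed
qed

text \<open>This is the part of the nonplanarity of $K_{3,3}$ that is needed: the third vertex on the side of \<open>x\<close> and \<open>Y\<close> is the
outside of the disc. Two legs of \<open>x\<close> form a chord, and \<open>Y\<close> stays on its side that contains \<open>r\<close>; the third leg cuts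
that side once more and separates \<open>Y\<close> from \<open>p\<close> or from \<open>q\<close>.\<close>

lemma no_second_star:
  fixes cpq cqr crp :: "real \<Rightarrow> complex"
  assumes arcs: "arc cpq" "arc cqr" "arc crp" "arc lp" "arc lq" "arc lr"
    and ends: "pathstart cpq = p" "pathfinish cpq = q" "pathstart cqr = q" "pathfinish cqr = r"
      "pathstart crp = r" "pathfinish crp = p"
      "pathstart lp = x" "pathfinish lp = p" "pathstart lq = x" "pathfinish lq = q"
      "pathstart lr = x" "pathfinish lr = r"
    and J: "J = path_image cpq \<union> path_image cqr \<union> path_image crp"
    and ints: "path_image cpq \<inter> path_image cqr = {q}" "path_image cqr \<inter> path_image crp = {r}"
      "path_image crp \<inter> path_image cpq = {p}"
    and legs: "path_image lp \<inter> path_image lq = {x}" "path_image lq \<inter> path_image lr = {x}"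
      "path_image lr \<inter> path_image lp = {x}"
    and ins: "path_image lp - {p} \<subseteq> inside J" "path_image lq - {q} \<subseteq> inside J"
      "path_image lr - {r} \<subseteq> inside J"
    and Y: "connected Y" "Y \<subseteq> inside J" 
      "Y \<inter> (path_image lp \<union> path_image lq \<union> path_image lr) = {}"
      "p \<in> closure Y" "q \<in> closure Y" "r \<in> closure Y"
  shows False
proof -
  note end_in = pathstart_in_path_image pathfinish_in_path_image
  have mem: "p \<in> path_image cpq" "q \<in> path_image cpq" "q \<in> path_image cqr" "r \<in> path_image cqr"
    "r \<in> path_image crp" "p \<in> path_image crp" "x \<in> path_image lp" "p \<in> path_image lp"
    "x \<in> path_image lq" "q \<in> path_image lq" "x \<in> path_image lr" "r \<in> path_image lr"
    using ends end_in by metis+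
  have ne: "p \<noteq> q" "q \<noteq> r" "r \<noteq> p" "x \<noteq> p" "x \<noteq> q" "x \<noteq> r"
    using arc_distinct_ends[OF arcs(1)] arc_distinct_ends[OF arcs(2)] arc_distinct_ends[OF arcs(3)]
     arc_distinct_ends[OF arcs(4)] arc_distinct_ends[OF arcs(5)] arc_distinct_ends[OF arcs(6)] ends 
    by auto
  have disj: "inside J \<inter> J = {}" by simp
  \<comment> \<open>The legs to \<open>p\<close> and \<open>q\<close> form a chord; both \<open>Y\<close> and the leg to \<open>r\<close> are on its far side from \<open>cpq\<close>.\<close>
  define A where "A = reversepath lp +++ lq"
  have A: "arc A" "pathstart A = p" "pathfinish A = q" "path_image A = path_image lp \<union> path_image lq"
    using arcs ends legs unfolding A_def
    by (auto intro!: arc_join arc_reversepath simp: path_image_join)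
  define c2 where "c2 = reversepath (cqr +++ crp)"
  have c2: "arc c2" "pathstart c2 = p" "pathfinish c2 = q" "path_image c2 = path_image cqr \<union> path_image crp"
    using arcs ends ints unfolding c2_def
    by (auto intro!: arc_join arc_reversepath simp: path_image_join)
  have J': "J = path_image cpq \<union> path_image c2" using J c2 by auto
  have r2: "r \<in> path_image c2 - {p, q}" using mem ne c2 by auto
  have i12: "path_image cpq \<inter> path_image c2 = {p, q}" using c2 ints by blast
  have Ain: "path_image A - {p, q} \<subseteq> inside (path_image cpq \<union> path_image c2)"
    using A(4) ins J' by blast
  note cs1 = chord_separates(1)[OF arcs(1) c2(1) A(1) ends(1,2) c2(2,3) A(2,3) i12 Ain]
  have Y2: "Y \<subseteq> inside (path_image c2 \<union> path_image A)"
    using cs1[OF Y(1) _ _ Y(6) r2] Y(2,3) A(4) J' by blast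
  have k1: "connected (path_image lr - {x, r})"
    using connected_simple_path_endless[OF arc_imp_simple_path[OF arcs(6)]] ends by simp
  have k2: "r \<in> closure (path_image lr - {x, r})"
  proof -
    have "closure (path_image lr - {x,r}) = path_image lr"
      using closure_arc_endless[OF arcs(6)] ends by simp
    then show ?thesis using mem by simp
  qed
  have k3: "path_image lr - {x, r} \<subseteq> inside (path_image cpq \<union> path_image c2)"
    using ins(3) J' by auto
  have k4: "(path_image lr - {x, r}) \<inter> path_image A = {}"
    using legs A(4) by auto
  have lr2: "path_image lr - {x, r} \<subseteq> inside (path_image c2 \<union> path_image A)"
    by (rule cs1[OF k1 k3 k4 k2 r2])
  \<comment> \<open>The boundary of that part is cut at \<open>x\<close> and \<open>r\<close>, the ends of the third leg.\<close>
  define d1 where "d1 = lp +++ reversepath crp"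
  define d2 where "d2 = lq +++ cqr"
  have lJ: "path_image lp \<inter> J \<subseteq> {p}" "path_image lq \<inter> J \<subseteq> {q}"
    using ins(1,2) inside_no_overlap[of J] by (blast dest: subsetD)+
  have nJ: "p \<notin> path_image cqr" "q \<notin> path_image crp"
    using ints mem ne by auto
  have lc: "path_image lp \<inter> path_image crp = {p}" "path_image lq \<inter> path_image cqr = {q}" 
    "path_image lp \<inter> path_image cqr = {}" "path_image lq \<inter> path_image crp = {}" 
    using lJ J nJ mem by auto
  have d1: "arc d1" "pathstart d1 = x" "pathfinish d1 = r" "path_image d1 = path_image lp \<union> path_image crp"
    using arcs ends lc unfolding d1_def
    by (auto intro!: arc_join arc_reversepath simp: path_image_join)
  have d2: "arc d2" "pathstart d2 = x" "pathfinish d2 = r" "path_image d2 = path_image lq \<union> path_image cqr"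
    using arcs ends lc unfolding d2_def
    by (auto intro!: arc_join arc_reversepath simp: path_image_join)
  have D: "path_image d1 \<union> path_image d2 = path_image c2 \<union> path_image A"
    using d1 d2 c2 A by blast
  have i: "path_image d1 \<inter> path_image d2 = {x, r}"
    unfolding d1(4) d2(4) Int_Un_distrib Int_Un_distrib2 using lc legs ints by auto
  have "closure Y \<inter> path_image d1 \<subseteq> {x, r}"
  proof (rule chord_separates(2)[OF d1(1) d2(1) arcs(6) d1(2,3) d2(2,3) ends(11,12) i])
    show "path_image lr - {x, r} \<subseteq> inside (path_image d1 \<union> path_image d2)" using lr2 D by simp
    show "Y \<subseteq> inside (path_image d1 \<union> path_image d2)" using Y2 D by simp
    show "q \<in> path_image d2 - {x, r}" using mem ne d2 by auto
  qed (use Y in auto)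
  then show False using Y(4) mem d1 ne by blast
qed

text \<open>In a finite disjoint family the complement of a member is again a finite union of closed sets, so every
member is clopen.\<close>

lemma components_of_separated_family:
  fixes \<F> :: "'a::topological_space set set"
  assumes fin: "finite \<F>" and un: "\<Union>\<F> = X"
    and conn: "\<And>A. A \<in> \<F> \<Longrightarrow> connected A" and ne: "\<And>A. A \<in> \<F> \<Longrightarrow> A \<noteq> {}"
    and dj: "\<And>A B. A \<in> \<F> \<Longrightarrow> B \<in> \<F> \<Longrightarrow> A \<noteq> B \<Longrightarrow> A \<inter> B = {}"
    and cl: "\<And>A. A \<in> \<F> \<Longrightarrow> closedin (top_of_set X) A"
  shows "components X = \<F>"
proof -
  have sub: "\<F> \<subseteq> components X"
  proof
    fix A assume A: "A \<in> \<F>"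
    have "closedin (top_of_set X) (\<Union>(\<F> - {A}))"
      using fin cl by (intro closedin_Union) auto
    moreover have "X - \<Union>(\<F> - {A}) = A" using A un dj by blast
    ultimately have op: "openin (top_of_set X) A" 
      by (metis closedin_def topspace_euclidean_subtopology)
    show "A \<in> components X" unfolding in_components_maximal
    proof (intro conjI allI impI)
      fix D assume D: "D \<noteq> {} \<and> A \<subseteq> D \<and> D \<subseteq> X \<and> connected D"
      have "openin (top_of_set D) A" "closedin (top_of_set D) A"
        using op cl[OF A] D openin_subset_trans closedin_subset_trans by blast+
      then show "D = A" using D ne[OF A] connected_clopen[of D] by blast
    qed (use A un conn ne in auto)
  qed
  moreover have "components X \<subseteq> \<F>"
  proof
    fix C assume C: "C \<in> components X"
    then obtain z where "z \<in> C" "z \<in> X" using in_components_nonempty in_components_subset by blast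
    then obtain A where A: "A \<in> \<F>" "z \<in> A" using un by blast
    then have "A = C" using components_eq[OF C, of A] sub \<open>z \<in> C\<close> by blast
    then show "C \<in> \<F>" using A by simp
  qed
  ultimately show ?thesis by blast
qed

section \<open>Noncrossing families of diagonals\<close>

text \<open>The bound includes the pair \<open>(a, b)\<close> itself, which makes the induction work. If \<open>(a, j)\<close> is the longest other pair
that starts at \<open>a\<close>, then by maximality and noncrossing every pair lies in the interval from \<open>a\<close> to \<open>j\<close> or in the one from \<open>j\<close> to \<open>b\<close>.\<close>

lemma noncrossing_pairs_bound:
  fixes a b :: nat
  assumes "F \<subseteq> {(i, j). a \<le> i \<and> i + 2 \<le> j \<and> j \<le> b}" "a < b"
    and "\<And>i j i' j'. (i, j) \<in> F \<Longrightarrow> (i', j') \<in> F \<Longrightarrow> \<not> (i < i' \<and> i' < j \<and> j < j')"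
  shows "card F \<le> b - a - 1"
  using assms
proof (induction "b - a" arbitrary: a b F rule: less_induct)
  case less
  note sub = less.prems(1) and nc = less.prems(3)
  have fin: "finite F"
    by (rule finite_subset[of _ "{..b} \<times> {..b}"]) (use sub in auto)
  let ?F = "F - {(a, b)}"
  have nc': "\<And>i j i' j'. (i, j) \<in> G \<Longrightarrow> (i', j') \<in> G \<Longrightarrow> \<not> (i < i' \<and> i' < j \<and> j < j')"
    if "G \<subseteq> F" for G using nc that by blast
  show ?case
  proof (cases "b = a + 1")
    case True
    then have "F = {}" using sub by fastforce
    then show ?thesis by simp
  next
    case False
    then have ab: "a + 2 \<le> b" using less.prems(2) by simp
    have "card ?F \<le> b - a - 2"
    proof (cases "\<exists>j. (a, j) \<in> ?F")
      case False
      have "?F \<subseteq> {(i, j). a + 1 \<le> i \<and> i + 2 \<le> j \<and> j \<le> b}"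
      proof (rule subrelI)
        fix i j assume ij: "(i, j) \<in> ?F"
        then have "i \<noteq> a" using False by blast
        then show "(i, j) \<in> {(i, j). a + 1 \<le> i \<and> i + 2 \<le> j \<and> j \<le> b}" using sub ij by fastforce
      qed
      then have "card ?F \<le> b - (a + 1) - 1"
        using ab nc'[of ?F] by (intro less.hyps) auto
      then show ?thesis by simp
    next
      case True
      define S where "S = {j. (a, j) \<in> ?F}"
      have "finite S" "S \<noteq> {}"
        using True sub by (auto simp: S_def intro!: finite_subset[of _ "{..b}"])
      define j0 where "j0 = Max S"
      have j0: "(a, j0) \<in> F" "j0 \<noteq> b" "\<And>j. (a, j) \<in> ?F \<Longrightarrow> j \<le> j0"
        using Max_in[of S] Max_ge[of S] \<open>finite S\<close> \<open>S \<noteq> {}\<close> by (auto simp: S_def j0_def)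
      have j0b: "a + 2 \<le> j0" "j0 < b" using j0 sub by fastforce+
      let ?A = "{p \<in> ?F. snd p \<le> j0}" and ?B = "{p \<in> ?F. j0 \<le> fst p}"
      have "?F \<subseteq> ?A \<union> ?B"
      proof (rule subrelI)
        fix i j assume ij: "(i, j) \<in> ?F"
        then have "a \<le> i" using sub by auto
        show "(i, j) \<in> ?A \<union> ?B"
        proof (rule ccontr)
          assume "(i, j) \<notin> ?A \<union> ?B"
          then have j: "\<not> j \<le> j0" "\<not> j0 \<le> i" using ij by auto
          show False
          proof (cases "i = a")
            case True then show False using j0(3)[of j] ij j by auto
          next
            case False
            then have "a < i \<and> i < j0 \<and> j0 < j" using \<open>a \<le> i\<close> ij j by auto
            then show False using nc[OF j0(1)] ij by blast
          qed
        qed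
      qed
      then have "card ?F \<le> card ?A + card ?B"
        using fin by (intro order_trans[OF card_mono card_Un_le]) auto
      moreover have "card ?A \<le> j0 - a - 1"
        proof (rule less.hyps)
        show "?A \<subseteq> {(i, j). a \<le> i \<and> i + 2 \<le> j \<and> j \<le> j0}" using sub by auto
        show "j0 - a < b - a" "a < j0" using j0b by auto
      qed (rule nc'[of ?A], auto)
      moreover have "card ?B \<le> b - j0 - 1"
        proof (rule less.hyps)
        show "?B \<subseteq> {(i, j). j0 \<le> i \<and> i + 2 \<le> j \<and> j \<le> b}" using sub by auto
        show "b - j0 < b - a" "j0 < b" using j0b by auto
      qed (rule nc'[of ?B], auto)
      ultimately show ?thesis using j0b by linarith
    qed
    moreover have "card F \<le> Suc (card ?F)"
      using fin by (metis card_Suc_Diff1 card_Diff_singleton_if le_Suc_eq le_refl)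
    ultimately show ?thesis using ab by linarith
  qed
qed

text \<open>The diagonals of a polygon with cyclically ordered vertices $0, \<dots>, k - 1$. The side that joins the last vertex to
the first is the pair that has to be excluded separately.\<close>

definition diagonals :: "nat \<Rightarrow> (nat \<times> nat) set" where
  "diagonals k = {(i, j). i + 2 \<le> j \<and> j < k \<and> (i, j) \<noteq> (0, k - 1)}"

lemma finite_diagonals [simp]: "finite (diagonals k)"
  by (rule finite_subset[of _ "{..k} \<times> {..k}"]) (auto simp: diagonals_def)

lemma card_diagonals:
  assumes "3 \<le> k"
  shows "2 * card (diagonals k) = k * (k - 3)"
proof -
  let ?Q = "\<lambda>k. {(i, j). i + 2 \<le> j \<and> j < (k::nat)}"
  have fin: "finite (?Q k)" for k
    by (rule finite_subset[of _ "{..k} \<times> {..k}"]) auto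
  have Q: "2 * card (?Q (k + 2)) = k * (k + 1)" for k
  proof (induction k)
    case 0
    have "?Q (0 + 2) = {}" by auto
    then show ?case by (simp only: card.empty)
  next
    case (Suc k)
    have "?Q (Suc k + 2) = ?Q (k + 2) \<union> {..k} \<times> {k + 2}" by auto
    moreover have "card (?Q (k + 2) \<union> {..k} \<times> {k + 2}) = card (?Q (k + 2)) + (k + 1)"
      using fin[of "k + 2"] by (subst card_Un_disjoint) auto
    ultimately show ?case using Suc by (simp add: algebra_simps)
  qed
  have "diagonals k = ?Q k - {(0, k - 1)}" by (auto simp: diagonals_def)
  moreover have "(0, k - 1) \<in> ?Q k" using assms by auto
  ultimately have "card (diagonals k) = card (?Q k) - 1" using fin by simp
  moreover obtain l where "k = l + 3" using assms by (metis add.commute le_Suc_ex)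
  ultimately show ?thesis using Q[of "l + 1"] by (simp add: algebra_simps numeral_eq_Suc)
qed

text \<open>The side \<open>(0, k - 1)\<close> can be added to any noncrossing family, which improves the bound for intervals by one.\<close>

lemma noncrossing_diagonals_bound:
  assumes "F \<subseteq> diagonals k" "3 \<le> k"
    and nc: "\<And>i j i' j'. (i, j) \<in> F \<Longrightarrow> (i', j') \<in> F \<Longrightarrow> \<not> (i < i' \<and> i' < j \<and> j < j')"
  shows "card F \<le> k - 3"
proof -
  have "card (insert (0, k - 1) F) \<le> k - 1 - 0 - 1"
    using assms by (intro noncrossing_pairs_bound) (fastforce simp: diagonals_def)+
  moreover have "(0, k - 1) \<notin> F" "finite F"
    using assms(1) finite_subset[OF _ finite_diagonals] by (auto simp: diagonals_def)
  ultimately show ?thesis by simp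
qed

section \<open>Drawings of complete graphs with a distinguished cycle\<close>

lemma complete_graph_simps [simp]:
  "verts (complete_graph n) = {..<n}"
  "{u, v} \<in> edges (complete_graph n) \<longleftrightarrow> u < n \<and> v < n \<and> u \<noteq> v"
  by (auto simp: complete_graph_def doubleton_eq_iff)

lemma complete_graph_edgeE:
  assumes "e \<in> edges (complete_graph n)"
  obtains u v where "e = {u, v}" "u < n" "v < n" "u \<noteq> v"
  using assms by (auto simp: complete_graph_def)

lemma edge_vertex_less: "e \<in> edges (complete_graph n) \<Longrightarrow> v \<in> e \<Longrightarrow> v < n"
  by (auto elim!: complete_graph_edgeE)

lemma finite_edges_complete_graph [simp]: "finite (edges (complete_graph n))"
  by (rule finite_subset[of _ "Pow {..<n}"]) (auto simp: complete_graph_def)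

locale complete_drawing =
  fixes n :: nat and D :: "(nat, space3) drawing"
  assumes emb: "embedding (complete_graph n) D UNIV"
begin

abbreviation "K \<equiv> complete_graph n"
abbreviation "P \<equiv> vpos D"

lemma P_inj: "inj_on P {..<n}"
  using emb by (simp add: embedding_def)

lemma P_eq_iff: "u < n \<Longrightarrow> v < n \<Longrightarrow> P u = P v \<longleftrightarrow> u = v"
  using P_inj by (auto dest: inj_onD)

lemma edge_arc:
  assumes "u < n" "v < n" "u \<noteq> v"
  obtains \<gamma> where "arc \<gamma>" "path_image \<gamma> = earc D {u, v}" "pathstart \<gamma> = P u" "pathfinish \<gamma> = P v"
proof -
  obtain \<gamma> where \<gamma>: "arc \<gamma>" "path_image \<gamma> = earc D {u, v}" "{pathstart \<gamma>, pathfinish \<gamma>} = {P u, P v}"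
  proof -
    have uv: "{u, v} \<in> edges K" using assms by simp
    have "\<exists>\<gamma>. arc \<gamma> \<and> path_image \<gamma> = earc D {u, v} \<and> {pathstart \<gamma>, pathfinish \<gamma>} = P ` {u, v}"
      using emb[unfolded embedding_def, THEN conjunct2, THEN conjunct2, THEN conjunct1, rule_format, OF uv] by simp
    then show thesis using that by auto
  qed
  then consider "pathstart \<gamma> = P u" "pathfinish \<gamma> = P v" | "pathstart \<gamma> = P v" "pathfinish \<gamma> = P u"
    by (auto simp: doubleton_eq_iff)
  then show thesis
    using that[of \<gamma>] that[of "reversepath \<gamma>"] \<gamma> by cases (auto simp: arc_reversepath)
qed

lemma edges_Int: "e \<in> edges K \<Longrightarrow> f \<in> edges K \<Longrightarrow> e \<noteq> f \<Longrightarrow> earc D e \<inter> earc D f \<subseteq> P ` (e \<inter> f)"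
  using emb by (simp add: embedding_def)

lemma vertex_in_edge: "v < n \<Longrightarrow> e \<in> edges K \<Longrightarrow> P v \<in> earc D e \<Longrightarrow> v \<in> e"
  using emb by (auto simp: embedding_def)

lemma end_in_edge: "e \<in> edges K \<Longrightarrow> v \<in> e \<Longrightarrow> P v \<in> earc D e"
  using edge_arc by (elim complete_graph_edgeE) (metis insert_iff pathfinish_in_path_image pathstart_in_path_image singletonD)

lemma edge_compact: "e \<in> edges K \<Longrightarrow> compact (earc D e)"
  using edge_arc by (elim complete_graph_edgeE) (metis compact_arc_image)

lemma edge_minus:
  assumes "e \<in> edges K" "T \<inter> earc D e \<subseteq> P ` e"
  shows "connected (earc D e - T)" "closure (earc D e - T) = earc D e" "earc D e - T \<noteq> {}"
proof -
  obtain u v where e: "e = {u, v}" "u < n" "v < n" "u \<noteq> v" 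
    using assms(1) complete_graph_edgeE by blast
  obtain \<gamma> where \<gamma>: "arc \<gamma>" "path_image \<gamma> = earc D {u, v}" "pathstart \<gamma> = P u" "pathfinish \<gamma> = P v"
    using edge_arc e by blast
  show "connected (earc D e - T)" "closure (earc D e - T) = earc D e" "earc D e - T \<noteq> {}"
    using arc_minus_ends[OF \<gamma>(1), of T] assms(2) \<gamma> e by auto
qed

lemma edge_connected: "e \<in> edges K \<Longrightarrow> connected (earc D e)"
  using edge_minus[of e "{}"] by auto

lemma connected_support: "connected (support K D)"
proof (cases "2 \<le> n")
  case True
  have e0: "{0, u} \<in> edges K" if "e \<in> edges K" "u \<in> e" "u \<noteq> 0" for e u
    using edge_vertex_less[OF that(1,2)] that(3) by simp
  define \<F> where "\<F> = {earc D e \<union> earc D {0, u} | e u. e \<in> edges K \<and> u \<in> e \<and> u \<noteq> 0}"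
  have "support K D = \<Union>\<F>"
  proof
    show "support K D \<subseteq> \<Union>\<F>"
    proof
      fix x assume "x \<in> support K D"
      moreover have "x \<in> \<Union>\<F>" if e: "e \<in> edges K" "x \<in> earc D e" for e
      proof -
        obtain u where "u \<in> e" "u \<noteq> 0" using e(1) by (elim complete_graph_edgeE) auto
        then show ?thesis using e by (auto simp: \<F>_def)
      qed
      moreover have "\<exists>e. e \<in> edges K \<and> P v \<in> earc D e" if "v < n" for v
      proof -
        define w :: nat where "w = (if v = 0 then 1 else 0)"
        have "{v, w} \<in> edges K" using that True by (auto simp: w_def)
        then show ?thesis using end_in_edge by blast
      qed
      ultimately show "x \<in> \<Union>\<F>" unfolding support_def complete_graph_simps by blast
    qed
    show "\<Union>\<F> \<subseteq> support K D"
      using e0 by (auto simp: \<F>_def support_def)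
  qed
  moreover have "connected (\<Union>\<F>)"
  proof (rule connected_Union)
    show "connected S" if "S \<in> \<F>" for S
    proof -
      obtain e u where S: "S = earc D e \<union> earc D {0, u}" "e \<in> edges K" "u \<in> e" "u \<noteq> 0"
        using \<open>S \<in> \<F>\<close> by (auto simp: \<F>_def)
      then have 0: "{0, u} \<in> edges K" using e0 by blast
      show ?thesis unfolding S(1)
        using end_in_edge S 0 edge_connected by (intro connected_Un) blast+
    qed
    have "P 0 \<in> S" if "S \<in> \<F>" for S
    proof -
      obtain e u where S: "S = earc D e \<union> earc D {0, u}" "e \<in> edges K" "u \<in> e" "u \<noteq> 0"
        using \<open>S \<in> \<F>\<close> by (auto simp: \<F>_def)
      then have 0: "{0, u} \<in> edges K" using e0 by blast
      then show ?thesis using end_in_edge[OF 0, of 0] S(1) by simp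
    qed
    then show "\<Inter>\<F> \<noteq> {}" by blast
  qed
  ultimately show ?thesis by simp
next
  case False
  then have "n = 0 \<or> n = 1" by auto
  then have "edges K = {} \<and> verts K \<subseteq> {0}" by (auto simp: complete_graph_def)
  then have "support K D \<subseteq> {P 0}" by (auto simp: support_def)
  then show ?thesis by (metis connected_empty connected_sing subset_singletonD)
qed

end

text \<open>The vertices of the cycle are indexed by all natural numbers modulo its length, so that arcs of the spine
through its first vertex need no special treatment. A window of \<open>k\<close> consecutive indices covers the cycle once.\<close>

locale spined_drawing = complete_drawing +
  fixes c :: "nat list"
  assumes cyc: "is_cycle (complete_graph n) c"
begin

definition "k = length c"
definition "V i = c ! (i mod k)"
definition "E i = {V i, V (Suc i)}"
definition "C = cycle_support D c"

lemma k3: "3 \<le> k" using cyc by (simp add: is_cycle_def k_def)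

lemma V_in: "V i \<in> set c" using k3 by (auto simp: V_def k_def intro!: nth_mem mod_less_divisor)

lemma set_c: "set c = V ` {..<k}"
  by (auto simp: V_def k_def set_conv_nth image_iff)

lemma set_c_less: "set c \<subseteq> {..<n}" using cyc by (simp add: is_cycle_def)

lemma V_less: "V i < n" using V_in set_c_less by blast

lemma V_eq: "V i = V j \<longleftrightarrow> i mod k = j mod k"
  using k3 cyc unfolding V_def by (subst nth_eq_iff_index_eq) (auto simp: is_cycle_def k_def intro!: mod_less_divisor)

lemma V_mod [simp]: "V (i mod k) = V i" "V (i + k) = V i"
  by (simp_all add: V_def)

lemma window_inj:
  assumes "i \<le> s" "i \<le> t" "s < i + k" "t < i + k" "V s = V t"
  shows "s = t"
proof -
  have "s = t" if "s \<le> t" "i \<le> s" "t < i + k" "s mod k = t mod k" for s t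
  proof -
    have "k dvd t - s" using that by (metis mod_eq_dvd_iff_nat)
    then show ?thesis using that by (auto dest!: dvd_imp_le)
  qed
  then show ?thesis using assms V_eq by (metis nle_le)
qed

lemma V_Suc_neq: "V i \<noteq> V (Suc i)"
  using window_inj[of i i "Suc i"] k3 by auto

lemma E_edge: "E i \<in> edges K"
  using V_less V_Suc_neq by (simp add: E_def)

lemma E_mod: "E (i mod k) = E i"
  by (simp add: E_def V_def mod_Suc_eq)

lemma cycle_edges_eq: "cycle_edges c = range E"
proof -
  have 1: "{c ! i, c ! (Suc i mod length c)} = E i" if "i < k" for i
    using that by (simp add: E_def V_def k_def)
  then have "cycle_edges c = E ` {..<k}" unfolding cycle_edges_def using k_def by auto
  also have "\<dots> = range E"
  proof -
    have "E i \<in> E ` {..<k}" for i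
    proof (rule image_eqI)
      show "E i = E (i mod k)" by (simp add: E_mod)
      show "i mod k \<in> {..<k}" using k3 by (auto intro!: mod_less_divisor)
    qed
    then show ?thesis by blast
  qed
  finally show ?thesis .
qed

lemma C_eq: "C = (\<Union>i. earc D (E i))"
  by (simp add: C_def cycle_support_def cycle_edges_eq)

lemma window_cover: "(\<Union>t\<in>{i..<i + k}. earc D (E t)) = C"
proof -
  have "\<exists>t\<in>{i..<i + k}. E t = E s" for s
  proof
    \<comment> \<open>The multiple of \<open>k - 1\<close> stands for the subtraction of \<open>i\<close> modulo \<open>k\<close>.\<close>
    let ?t = "i + (s + i * (k - 1)) mod k"
    have "?t mod k = (i + (s + i * (k - 1))) mod k" by presburger
    also have "i + (s + i * (k - 1)) = s + i * k" using k3 by (cases k) auto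
    finally have "?t mod k = s mod k" by simp
    then show "E ?t = E s" using E_mod by metis
    show "?t \<in> {i..<i + k}" using k3 by simp
  qed
  then show ?thesis unfolding C_eq by (metis (no_types, lifting) SUP_eq UNIV_I order_refl)
qed

text \<open>Within one window, two edges of the spine can share a vertex only if they are consecutive, or if they are the first and the
last one.\<close>

lemma E_Int:
  assumes "i \<le> t" "t < u" "u < i + k"
  shows "earc D (E t) \<inter> earc D (E u) \<subseteq>
    (if Suc t = u then {P (V u)} else {}) \<union> (if t = i \<and> Suc u = i + k then {P (V i)} else {})"
proof -
  have a: "V t \<noteq> V u" using window_inj[of i t u] assms by auto
  have b: "V (Suc t) \<noteq> V (Suc u)" using window_inj[of "Suc i" "Suc t" "Suc u"] assms by auto
  have d: "Suc t = u" if "V (Suc t) = V u" using window_inj[of i "Suc t" u] assms that by auto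
  have f: "t = i \<and> Suc u = i + k" if "V t = V (Suc u)"
  proof (rule ccontr)
    assume neg: "\<not> (t = i \<and> Suc u = i + k)"
    have "t = Suc u"
    proof (cases "Suc u < i + k")
      case True then show ?thesis using window_inj[of i t "Suc u"] assms that by auto
    next
      case False then show ?thesis using window_inj[of "Suc i" t "Suc u"] assms that neg by auto
    qed
    then show False using assms by simp
  qed
  have ne: "E t \<noteq> E u"
    using a d f k3 assms by (auto simp: E_def doubleton_eq_iff)
  have "E t \<inter> E u \<subseteq> (if Suc t = u then {V u} else {}) \<union> (if t = i \<and> Suc u = i + k then {V i} else {})"
  proof
    fix x assume "x \<in> E t \<inter> E u"
    then consider "x = V (Suc t)" "x = V u" | "x = V t" "x = V (Suc u)"
      using a b unfolding E_def by blast
    then show "x \<in> (if Suc t = u then {V u} else {}) \<union> (if t = i \<and> Suc u = i + k then {V i} else {})"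
      by cases (use d f in simp_all)
  qed
  then have "P ` (E t \<inter> E u) \<subseteq>
      P ` ((if Suc t = u then {V u} else {}) \<union> (if t = i \<and> Suc u = i + k then {V i} else {}))"
    by (rule image_mono)
  also have "\<dots> = (if Suc t = u then {P (V u)} else {}) \<union> (if t = i \<and> Suc u = i + k then {P (V i)} else {})"
    by simp
  finally show ?thesis using edges_Int[OF E_edge E_edge ne] by (rule order_trans[rotated])
qed

lemma spine_arc:
  assumes "i < j" "j < i + k"
  obtains \<gamma> where "arc \<gamma>" "path_image \<gamma> = (\<Union>t\<in>{i..<j}. earc D (E t))"
    "pathstart \<gamma> = P (V i)" "pathfinish \<gamma> = P (V j)"
proof -
  have step: "\<exists>\<gamma>. arc \<gamma> \<and> path_image \<gamma> = earc D (E i) \<and> pathstart \<gamma> = P (V i) \<and> pathfinish \<gamma> = P (V (Suc i))" for i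
    using edge_arc[OF V_less V_less V_Suc_neq] unfolding E_def by metis
  have "Suc i \<le> j" using assms by simp
  then have "j < i + k \<longrightarrow> (\<exists>\<gamma>. arc \<gamma> \<and> path_image \<gamma> = (\<Union>t\<in>{i..<j}. earc D (E t)) \<and>
    pathstart \<gamma> = P (V i) \<and> pathfinish \<gamma> = P (V j))"
  proof (induction j rule: nat_induct_at_least)
    case base
    show ?case using step[of i] by simp
  next
    case (Suc j)
    show ?case
    proof
      assume less: "Suc j < i + k"
      then obtain \<gamma> where \<gamma>: "arc \<gamma>" "path_image \<gamma> = (\<Union>t\<in>{i..<j}. earc D (E t))"
        "pathstart \<gamma> = P (V i)" "pathfinish \<gamma> = P (V j)" using Suc by auto
      obtain \<delta> where \<delta>: "arc \<delta>" "path_image \<delta> = earc D (E j)"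
        "pathstart \<delta> = P (V j)" "pathfinish \<delta> = P (V (Suc j))" using step by blast
      have "earc D (E t) \<inter> earc D (E j) \<subseteq> {P (V j)}" if "t \<in> {i..<j}" for t
        using E_Int[of i t j] that less by (auto split: if_splits)
      then have "path_image \<gamma> \<inter> path_image \<delta> \<subseteq> {pathstart \<delta>}"
        unfolding \<gamma>(2) \<delta>(2,3) by blast
      then have "arc (\<gamma> +++ \<delta>)" using arc_join \<gamma> \<delta> by metis
      moreover have "{i..<Suc j} = insert j {i..<j}" using Suc.hyps by auto
      ultimately show "\<exists>\<gamma>. arc \<gamma> \<and> path_image \<gamma> = (\<Union>t\<in>{i..<Suc j}. earc D (E t)) \<and>
        pathstart \<gamma> = P (V i) \<and> pathfinish \<gamma> = P (V (Suc j))"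
        using \<gamma> \<delta> by (intro exI[of _ "\<gamma> +++ \<delta>"]) (auto simp: path_image_join)
    qed
  qed
  then show thesis using that assms by blast
qed

lemma spine_arcs_Int:
  assumes "i < j" "j < i + k"
  shows "(\<Union>t\<in>{i..<j}. earc D (E t)) \<inter> (\<Union>t\<in>{j..<i + k}. earc D (E t)) = {P (V i), P (V j)}"
proof
  have "earc D (E t) \<inter> earc D (E u) \<subseteq> {P (V i), P (V j)}" if "t \<in> {i..<j}" "u \<in> {j..<i+k}" for t u
  proof -
    have "t < u" "i \<le> t" "u < i + k" "Suc t = u \<Longrightarrow> u = j" using that by auto
    then show ?thesis using E_Int[of i t u] by (force split: if_splits)
  qed
  then show "(\<Union>t\<in>{i..<j}. earc D (E t)) \<inter> (\<Union>t\<in>{j..<i + k}. earc D (E t)) \<subseteq> {P (V i), P (V j)}"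
    by blast
  have "P (V t) \<in> earc D (E t)" "P (V (Suc t)) \<in> earc D (E t)" for t
    using end_in_edge[OF E_edge] by (auto simp: E_def)
  moreover have "P (V i) \<in> earc D (E (i + k - 1))"
    using calculation(2)[of "i + k - 1"] k3 by simp
  moreover have "P (V j) \<in> earc D (E (j - 1))"
    using calculation(2)[of "j - 1"] assms by simp
  moreover have "i \<in> {i..<j}" "j - 1 \<in> {i..<j}" "j \<in> {j..<i + k}" "i + k - 1 \<in> {j..<i + k}"
    using assms by auto
  ultimately show "{P (V i), P (V j)} \<subseteq> 
      (\<Union>t\<in>{i..<j}. earc D (E t)) \<inter> (\<Union>t\<in>{j..<i + k}. earc D (E t))" by blast
qed

text \<open>\<open>R\<close> collects everything off the spine that is not the inside of a chord: the edges with an end off the spine. Its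
closure is a single fragment if it is nonempty.\<close>

definition "chords = {e \<in> edges K. e \<subseteq> set c \<and> e \<notin> cycle_edges c}"
definition "R = (\<Union>e\<in>{e \<in> edges K. \<not> e \<subseteq> set c}. earc D e - C)"

lemma edge_in_R: "e \<in> edges K \<Longrightarrow> \<not> e \<subseteq> set c \<Longrightarrow> earc D e - C \<subseteq> R"
  unfolding R_def by blast

lemma cycle_edges_subset: "e \<in> cycle_edges c \<Longrightarrow> e \<subseteq> set c"
  unfolding cycle_edges_eq E_def using V_in by auto

lemma vertex_in_C: "v \<in> set c \<Longrightarrow> P v \<in> C"
  unfolding set_c C_eq using end_in_edge[OF E_edge] by (auto simp: E_def)

lemma edge_Int_C:
  assumes "e \<in> edges K" "e \<notin> cycle_edges c"
  shows "earc D e \<inter> C = P ` (e \<inter> set c)"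
proof
  show "earc D e \<inter> C \<subseteq> P ` (e \<inter> set c)"
  proof
    fix x assume x: "x \<in> earc D e \<inter> C"
    then obtain i where "x \<in> earc D (E i)" by (auto simp: C_eq)
    moreover have "e \<noteq> E i" using assms(2) cycle_edges_eq by auto
    ultimately have "x \<in> P ` (e \<inter> E i)" using edges_Int[OF assms(1) E_edge] x by blast
    moreover have "E i \<subseteq> set c" using V_in by (auto simp: E_def)
    ultimately show "x \<in> P ` (e \<inter> set c)" by blast
  qed
  show "P ` (e \<inter> set c) \<subseteq> earc D e \<inter> C" using vertex_in_C end_in_edge assms(1) by auto
qed

lemma edge_minus_C:
  assumes "e \<in> edges K" "e \<notin> cycle_edges c"
  shows "connected (earc D e - C)" "closure (earc D e - C) = earc D e" "earc D e - C \<noteq> {}"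
proof -
  have "C \<inter> earc D e \<subseteq> P ` e" using edge_Int_C[OF assms] by blast
  then show "connected (earc D e - C)" "closure (earc D e - C) = earc D e" "earc D e - C \<noteq> {}"
    using edge_minus[OF assms(1)] by blast+
qed

lemma off_vertex_notin_C:
  assumes "v < n" "v \<notin> set c" shows "P v \<notin> C"
proof
  assume "P v \<in> C"
  then obtain i where "P v \<in> earc D (E i)" by (auto simp: C_eq)
  then have "v \<in> E i" using vertex_in_edge E_edge assms by blast
  then show False using assms V_in by (auto simp: E_def)
qed

text \<open>Each of the pieces contains an off-spine vertex \<open>v\<close>. As the graph is complete, \<open>v\<close> is joined
to a fixed off-spine vertex \<open>x\<close> by an edge, which meets the spine in no point.\<close>

lemma R_connected: "connected R"
proof (cases "{..<n} \<subseteq> set c")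
  case True
  then have "R = {}" unfolding R_def by (auto simp: complete_graph_def)
  then show ?thesis by simp
next
  case False
  then obtain x where x: "x < n" "x \<notin> set c" by auto
  define \<F> where "\<F> = {(earc D e - C) \<union> (if v = x then {} else earc D {x, v} - C) | e v. e \<in> edges K \<and> v \<in> e \<and> v \<notin> set c}"
  have xv: "{x, v} \<in> edges K" if "e \<in> edges K" "v \<in> e" "v \<noteq> x" for e v
    using edge_vertex_less[OF that(1,2)] that x complete_graph_simps(2) by metis
  have xin: "P x \<in> earc D e - C" if "e \<in> edges K" "x \<in> e" for e
    using that end_in_edge off_vertex_notin_C x by auto
  have nc: "e \<notin> cycle_edges c" if "v \<in> e" "v \<notin> set c" for e v
    using that cycle_edges_subset by blast
  have *: "connected S \<and> P x \<in> S \<and> S \<subseteq> R" if "S \<in> \<F>" for S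
  proof -
    obtain e v where S: "S = (earc D e - C) \<union> (if v = x then {} else earc D {x, v} - C)"
      "e \<in> edges K" "v \<in> e" "v \<notin> set c"
      using \<open>S \<in> \<F>\<close> by (auto simp: \<F>_def)
    have e: "connected (earc D e - C)" using edge_minus_C[OF S(2) nc[OF S(3,4)]] by simp
    have eR: "earc D e - C \<subseteq> R" using S by (intro edge_in_R) auto
    show ?thesis
    proof (cases "v = x")
      case True
      then show ?thesis using S e xin eR by auto
    next
      case False
      then have xv': "{x, v} \<in> edges K" using xv S by blast
      have "connected (earc D {x, v} - C)" using edge_minus_C[OF xv' nc[OF _ x(2)]] by simp
      moreover have "P v \<in> earc D e \<inter> earc D {x, v} - C" 
        using end_in_edge xv' S off_vertex_notin_C[of v] edge_vertex_less[OF S(2)] by blast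
      ultimately have "connected S" using e S(1) False connected_Un[of "earc D e - C" "earc D {x, v} - C"] by auto
      moreover have "earc D {x, v} - C \<subseteq> R" using xv' x by (intro edge_in_R) auto
      ultimately show ?thesis using xin[OF xv'] S(1) eR False by auto
    qed
  qed
  have "R = \<Union>\<F>"
  proof
    show "R \<subseteq> \<Union>\<F>"
    proof
      fix z assume "z \<in> R"
      then obtain e where e: "e \<in> edges K" "\<not> e \<subseteq> set c" "z \<in> earc D e - C"
        unfolding R_def by blast
      then obtain v where "v \<in> e" "v \<notin> set c" by blast
      then have "(earc D e - C) \<union> (if v = x then {} else earc D {x, v} - C) \<in> \<F>"
        unfolding \<F>_def using e(1) by blast
      then show "z \<in> \<Union>\<F>" using e(3) by blast
    qed
  qed (use * in blast)
  moreover have "connected (\<Union>\<F>)" by (rule connected_Union) (use * in blast)+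
  ultimately show ?thesis by simp
qed

lemma support_minus_C:
  "support K D - C = \<Union>((\<lambda>e. earc D e - C) ` chords \<union> (if {..<n} \<subseteq> set c then {} else {R}))"
proof -
  have cov: "P v \<in> C \<or> P v \<in> R" if "v < n" for v
  proof (cases "v \<in> set c")
    case True then show ?thesis using vertex_in_C by simp
  next
    case False
    then have "{v, V 0} \<in> edges K" using that V_less V_in by (metis complete_graph_simps(2))
    then have "earc D {v, V 0} - C \<subseteq> R" using False by (intro edge_in_R) auto
    then show ?thesis using end_in_edge[OF \<open>{v, V 0} \<in> edges K\<close>, of v] by auto
  qed
  have Rsub: "R \<subseteq> support K D - C" by (auto simp: R_def support_def)
  have Re: "R = {}" if "{..<n} \<subseteq> set c" using that unfolding R_def by (auto simp: complete_graph_def)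
  have ce: "earc D e - C = {}" if "e \<in> cycle_edges c" for e
    using that by (auto simp: C_def cycle_support_def)
  have "support K D - C = (\<Union>e\<in>edges K. earc D e - C) \<union> R"
    using cov Rsub unfolding support_def complete_graph_simps(1) by blast
  also have "\<dots> = (\<Union>e\<in>chords. earc D e - C) \<union> R"
    using ce by (auto simp: chords_def R_def)
  finally show ?thesis using Re by auto
qed

lemma chord_vertices: "e \<in> chords \<Longrightarrow> earc D e \<inter> C = P ` e"
  using edge_Int_C[of e] by (auto simp: chords_def Int_absorb2)

lemma chord_disjoint:
  assumes "e \<in> chords" "f \<in> edges K" "e \<noteq> f"
  shows "(earc D e - C) \<inter> (earc D f - C) = {}"
proof -
  have "e \<in> edges K" "e \<subseteq> set c" using assms(1) by (auto simp: chords_def)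
  then have "earc D e \<inter> earc D f \<subseteq> P ` (e \<inter> f)" "P ` (e \<inter> f) \<subseteq> C"
    using edges_Int assms vertex_in_C by blast+
  then show ?thesis by blast
qed

lemma R_nonempty:
  assumes "\<not> {..<n} \<subseteq> set c" shows "R \<noteq> {}"
proof -
  obtain x where x: "x < n" "x \<notin> set c" using assms by auto
  then have e: "{x, V 0} \<in> edges K" using V_less V_in by (metis complete_graph_simps(2))
  then have "P x \<in> earc D {x, V 0} - C" using end_in_edge off_vertex_notin_C x by auto
  then show ?thesis using edge_in_R[OF e] x by auto
qed

lemma chord_disjoint_R:
  assumes "e \<in> chords" shows "(earc D e - C) \<inter> R = {}"
proof -
  have "(earc D e - C) \<inter> (earc D f - C) = {}" if "f \<in> edges K" "\<not> f \<subseteq> set c" for f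
    using chord_disjoint[OF assms that(1)] assms that by (auto simp: chords_def)
  then show ?thesis by (auto simp: R_def)
qed

lemma components_eq_family:
  "components (support K D - C) = (\<lambda>e. earc D e - C) ` chords \<union> (if {..<n} \<subseteq> set c then {} else {R})"
proof (rule components_of_separated_family)
  let ?F = "(\<lambda>e. earc D e - C) ` chords \<union> (if {..<n} \<subseteq> set c then {} else {R})"
  have chE: "e \<in> edges K" "e \<notin> cycle_edges c" if "e \<in> chords" for e using that by (auto simp: chords_def)
  show "finite ?F" by (simp add: chords_def)
  show "\<Union>?F = support K D - C" using support_minus_C by simp
  show "connected A" if "A \<in> ?F" for A
    using that edge_minus_C R_connected chE by (auto split: if_splits)
  show "A \<noteq> {}" if "A \<in> ?F" for A
    using that edge_minus_C(3) R_nonempty chE by (auto split: if_splits)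
  show "A \<inter> B = {}" if AB: "A \<in> ?F" "B \<in> ?F" "A \<noteq> B" for A B
  proof -
    consider (cc) e f where "e \<in> chords" "f \<in> chords" "A = earc D e - C" "B = earc D f - C"
      | (cr) e where "e \<in> chords" "A = earc D e - C" "B = R"
      | (rc) e where "e \<in> chords" "B = earc D e - C" "A = R"
      using AB by (auto split: if_splits)
    then show ?thesis
    proof cases
      case cc then show ?thesis using chord_disjoint[OF cc(1) chE(1)[OF cc(2)]] AB(3) by auto
    next
      case cr then show ?thesis using chord_disjoint_R by simp
    next
      case rc then show ?thesis using chord_disjoint_R by (metis Int_commute)
    qed
  qed
  have cl: "closedin (top_of_set (support K D - C)) (S - C)" if "compact S" "S - C \<subseteq> support K D" for S
  proof -
    have "S - C = (support K D - C) \<inter> S" using that by auto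
    then show ?thesis using compact_imp_closed[OF that(1)] closedin_closed by metis
  qed
  have "R = (\<Union>e\<in>{e \<in> edges K. \<not> e \<subseteq> set c}. earc D e) - C" by (auto simp: R_def)
  moreover have "compact (\<Union>e\<in>{e \<in> edges K. \<not> e \<subseteq> set c}. earc D e)"
    by (rule compact_UN) (auto simp: edge_compact)
  moreover have "R \<subseteq> support K D" by (auto simp: R_def support_def)
  ultimately have "closedin (top_of_set (support K D - C)) R" using cl by metis
  moreover have "closedin (top_of_set (support K D - C)) (earc D e - C)" if "e \<in> chords" for e
    using that chE edge_compact by (intro cl) (auto simp: support_def)
  ultimately show "closedin (top_of_set (support K D - C)) A" if "A \<in> ?F" for A
    using that by (auto split: if_splits)
qed

lemma fragments_eq:
  "fragments K D c = earc D ` chords \<union> (if {..<n} \<subseteq> set c then {} else {closure R})"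
proof -
  have "closure (earc D e - C) = earc D e" if "e \<in> chords" for e
    using that edge_minus_C by (auto simp: chords_def)
  then have "closure ` (\<lambda>e. earc D e - C) ` chords = earc D ` chords"
    by (simp add: image_image)
  then show ?thesis
    unfolding fragments_def C_def[symmetric] components_eq_family by (simp add: image_Un)
qed

end

section \<open>Lower bounds for the number of levels\<close>

lemma arc_continuous_image:
  assumes "arc g" "continuous_on (path_image g) f" "inj_on f (path_image g)"
  shows "arc (f \<circ> g)"
  using assms by (auto simp: arc_def path_image_def intro: path_continuous_image comp_inj_on)

lemma arc_fst_image:
  fixes g :: "real \<Rightarrow> space3"
  assumes "arc g" "inj_on fst (path_image g)"
  shows "arc (fst \<circ> g)"
  using assms by (intro arc_continuous_image) (auto intro: continuous_intros)

lemma fst_closure: "x \<in> closure S \<Longrightarrow> fst x \<in> closure (fst ` S)" for S :: "space3 set"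
  using image_closure_subset[of S fst "closure (fst ` S)"] 
  by (force simp: closure_subset intro: continuous_on_fst continuous_on_id)

text \<open>A fragment of level \<open>i\<close> crosses only over fragments of lower levels, and the levels are disjoint.\<close>

lemma level_no_crossing:
  assumes lp: "level_partition \<F> m L" and i: "i \<in> {1..m}" and A: "A \<in> L i" and B: "B \<in> L i"
    and ne: "A \<noteq> B"
  shows "\<not> crosses_over A B"
proof
  assume cr: "crosses_over A B"
  have un: "(\<Union>i\<in>{1..m}. L i) = \<F>" and dj: "disjoint_family_on L {1..m}"
    and L1: "1 \<le> m \<longrightarrow> L 1 = {A \<in> \<F>. \<forall>B\<in>\<F>. B \<noteq> A \<longrightarrow> \<not> crosses_over A B}"
    and Li: "\<forall>i\<in>{2..m}. L i = {A \<in> \<F>. (\<exists>B\<in>L (i - 1). crosses_over A B) \<and>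
        (\<forall>B\<in>\<F>. B \<noteq> A \<and> crosses_over A B \<longrightarrow> (\<exists>k\<in>{1..<i}. B \<in> L k))}"
    using lp by (simp_all add: level_partition_def)
  have BF: "B \<in> \<F>" using un B i by blast
  show False
  proof (cases "i = 1")
    case True
    then have "A \<in> {A \<in> \<F>. \<forall>B\<in>\<F>. B \<noteq> A \<longrightarrow> \<not> crosses_over A B}"
      using L1 A i by simp
    then show False using BF cr ne by blast
  next
    case False
    then have "i \<in> {2..m}" using i by auto
    then have "\<exists>k\<in>{1..<i}. B \<in> L k" using Li A BF cr ne by blast
    then obtain k where "k \<in> {1..<i}" "B \<in> L k" by blast
    then have "k \<in> {1..m}" "k \<noteq> i" using i by auto
    then show False using dj i B \<open>B \<in> L k\<close> unfolding disjoint_family_on_def by blast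
  qed
qed

locale leveled_drawing = spined_drawing +
  fixes m :: nat
  assumes lev: "divided_in_levels (complete_graph n) D c m"
begin

abbreviation "Frag \<equiv> fragments K D c"
abbreviation "Jc \<equiv> fst ` C"

lemma inj_C: "inj_on fst C"
  using lev by (simp add: divided_in_levels_def C_def)

lemma fragment_inside: "A \<in> Frag \<Longrightarrow> fst ` (A - C) \<subseteq> inside Jc"
  using lev by (simp add: divided_in_levels_def C_def)

text \<open>Absence of self-crossings makes the projection injective on each fragment, so fragments may be studied in
the plane.\<close>

lemma fragment_inj:
  assumes "A \<in> Frag" shows "inj_on fst A"
proof (rule inj_onI)
  fix x y assume xy: "x \<in> A" "y \<in> A" "fst x = fst y"
  have "\<not> crosses_over A A"
    using lev assms by (auto simp: divided_in_levels_def semi_leveled_diagram_def)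
  then have "\<not> snd x > snd y" "\<not> snd y > snd x"
    using xy unfolding crosses_over_def by metis+
  then show "x = y" using xy by (simp add: prod_eq_iff)
qed

definition diag_edge :: "nat \<times> nat \<Rightarrow> nat set" where
  "diag_edge p = {V (fst p), V (snd p)}"

lemma diag_edge_chord:
  assumes "p \<in> diagonals k" shows "diag_edge p \<in> chords"
proof -
  obtain a b where p: "p = (a, b)" "a + 2 \<le> b" "b < k" "\<not> (a = 0 \<and> b = k - 1)"
    using assms by (auto simp: diagonals_def)
  have VE: "V s = V t \<longleftrightarrow> s = t" if "s < k" "t < k" for s t
    using window_inj[of 0 s t] that by auto
  have ne: "V a \<noteq> V b" using VE p by simp
  have "diag_edge p \<noteq> E i" for i
  proof
    assume "diag_edge p = E i"
    then have "diag_edge p = E (i mod k)" using E_mod by simp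
    moreover define j where "j = i mod k"
    moreover have jk: "j < k" using k3 unfolding j_def by (intro mod_less_divisor) simp
    moreover define j' where "j' = Suc j mod k"
    have "V (Suc j) = V j'" by (simp add: j'_def)
    moreover have j'k: "j' < k" using k3 unfolding j'_def by (intro mod_less_divisor) simp
    ultimately have "{V a, V b} = {V j, V j'}" by (simp add: diag_edge_def E_def p)
    then have "a = j \<and> b = j' \<or> a = j' \<and> b = j"
      using VE jk j'k p by (auto simp: doubleton_eq_iff)
    moreover have "j' = Suc j \<or> j' = 0 \<and> j = k - 1"
      using jk by (cases "Suc j = k") (auto simp: j'_def)
    ultimately show False using p by auto
  qed
  then show ?thesis
    using ne V_less V_in by (auto simp: chords_def diag_edge_def p cycle_edges_eq)
qed

lemma diag_edge_inj: "inj_on diag_edge (diagonals k)"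
proof (rule inj_onI)
  fix p q assume pq: "p \<in> diagonals k" "q \<in> diagonals k" "diag_edge p = diag_edge q"
  obtain a b a' b' where p: "p = (a, b)" "q = (a', b')" by (metis surj_pair)
  have VE: "V s = V t \<longleftrightarrow> s = t" if "s < k" "t < k" for s t
    using window_inj[of 0 s t] that by auto
  show "p = q" using pq VE unfolding p by (auto simp: diag_edge_def diagonals_def doubleton_eq_iff)
qed

lemma chord_fragment: "e \<in> chords \<Longrightarrow> earc D e \<in> Frag"
  by (simp add: fragments_eq)

lemma earc_chord_inj: "inj_on (earc D) chords"
proof (rule inj_onI)
  fix e f assume ef: "e \<in> chords" "f \<in> chords" "earc D e = earc D f"
  show "e = f"
  proof (rule ccontr)
    assume "e \<noteq> f"
    then have "earc D e - C = {}" using chord_disjoint[OF ef(1) _ \<open>e \<noteq> f\<close>] ef by (auto simp: chords_def)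
    then show False using edge_minus_C(3)[of e] ef by (auto simp: chords_def)
  qed
qed

text \<open>The spine vertices \<open>s\<close> and \<open>t\<close> lie on different sides of the diagonal from \<open>a\<close> to \<open>b\<close>, so \<open>chord_separates\<close>
applies. The set \<open>B\<close> is the projection of another chord without its ends or of the part of the graph off the spine.\<close>

lemma diagonal_crossed:
  assumes ab: "(a, b) \<in> diagonals k" and B: "connected B" "B \<subseteq> inside Jc"
    and s: "a < s" "s < b" "fst (P (V s)) \<in> closure B"
    and t: "b < t" "t < a + k" "fst (P (V t)) \<in> closure B"
  shows "B \<inter> fst ` (earc D {V a, V b} - C) \<noteq> {}"
proof
  assume dj: "B \<inter> fst ` (earc D {V a, V b} - C) = {}"
  have ab': "a + 2 \<le> b" "b < k" using ab by (auto simp: diagonals_def)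
  have ch: "{V a, V b} \<in> chords" using diag_edge_chord[OF ab] by (simp add: diag_edge_def)
  have ne: "V a \<noteq> V b" using window_inj[of a a b] ab' by auto
  obtain \<gamma> where \<gamma>: "arc \<gamma>" "path_image \<gamma> = earc D {V a, V b}" "pathstart \<gamma> = P (V a)" "pathfinish \<gamma> = P (V b)"
    using edge_arc[OF V_less V_less ne] by metis
  obtain \<alpha> where \<alpha>: "arc \<alpha>" "path_image \<alpha> = (\<Union>t\<in>{a..<b}. earc D (E t))"
    "pathstart \<alpha> = P (V a)" "pathfinish \<alpha> = P (V b)"
    using spine_arc[of a b] ab' by auto
  obtain \<beta> where \<beta>: "arc \<beta>" "path_image \<beta> = (\<Union>t\<in>{b..<a + k}. earc D (E t))"
    "pathstart \<beta> = P (V b)" "pathfinish \<beta> = P (V (a + k))"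
    using spine_arc[of b "a + k"] ab' by auto
  have "{a..<b} \<union> {b..<a + k} = {a..<a + k}" using ab' by auto
  then have un: "path_image \<alpha> \<union> path_image \<beta> = C"
    unfolding \<alpha>(2) \<beta>(2) by (metis UN_Un window_cover)
  have int: "path_image \<alpha> \<inter> path_image \<beta> = {P (V a), P (V b)}"
    unfolding \<alpha>(2) \<beta>(2) using spine_arcs_Int[of a b] ab' by simp
  have inj: "inj_on fst (path_image \<alpha>)" "inj_on fst (path_image \<beta>)" "inj_on fst (path_image \<gamma>)"
    using un fragment_inj[OF chord_fragment[OF ch]] \<gamma>(2) by (auto intro: inj_on_subset[OF inj_C])
  define c1 c2 c3 where "c1 = fst \<circ> \<alpha>" and "c2 = reversepath (fst \<circ> \<beta>)" and "c3 = fst \<circ> \<gamma>"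
  have arcs: "arc c1" "arc c2" "arc c3"
    using inj \<alpha> \<beta> \<gamma> by (auto simp: c1_def c2_def c3_def intro!: arc_fst_image arc_reversepath)
  have images: "path_image c1 = fst ` path_image \<alpha>" "path_image c2 = fst ` path_image \<beta>"
    "path_image c3 = fst ` earc D {V a, V b}"
    using \<gamma>(2) by (auto simp: c1_def c2_def c3_def path_image_compose)
  have ends: "pathstart c1 = fst (P (V a))" "pathfinish c1 = fst (P (V b))"
    "pathstart c2 = fst (P (V a))" "pathfinish c2 = fst (P (V b))"
    "pathstart c3 = fst (P (V a))" "pathfinish c3 = fst (P (V b))"
    using \<alpha> \<beta> \<gamma> by (auto simp: c1_def c2_def c3_def pathstart_compose pathfinish_compose)
  have Jc: "path_image c1 \<union> path_image c2 = Jc"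
    unfolding images using un by blast
  have int': "path_image c1 \<inter> path_image c2 = {fst (P (V a)), fst (P (V b))}"
    unfolding images using inj_on_image_Int[OF inj_C, of "path_image \<alpha>" "path_image \<beta>"] un int by auto
  have cC: "earc D {V a, V b} \<inter> C = {P (V a), P (V b)}"
    using chord_vertices[OF ch] by simp
  have cin: "path_image c3 - {fst (P (V a)), fst (P (V b))} \<subseteq> inside (path_image c1 \<union> path_image c2)"
  proof
    fix z assume "z \<in> path_image c3 - {fst (P (V a)), fst (P (V b))}"
    then have z: "z \<in> fst ` earc D {V a, V b}" "z \<noteq> fst (P (V a))" "z \<noteq> fst (P (V b))"
      unfolding images by auto
    then obtain w where w: "z = fst w" "w \<in> earc D {V a, V b}" by blast
    then have "w \<notin> {P (V a), P (V b)}" using z by blast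
    with w have "w \<in> earc D {V a, V b} - C" using cC by blast
    then have "z \<in> inside Jc" using fragment_inside[OF chord_fragment[OF ch]] w(1) by blast
    then show "z \<in> inside (path_image c1 \<union> path_image c2)" using Jc by simp
  qed
  have "fst (P (V a)) \<in> Jc" "fst (P (V b)) \<in> Jc" using V_in vertex_in_C by auto
  then have Bc: "B \<inter> path_image c3 = {}"
  proof -
    have "w \<notin> B" if w: "w = fst z" "z \<in> earc D {V a, V b}" for w z
    proof (cases "z \<in> C")
      case True
      then have "w \<in> Jc" using w by simp
      then show ?thesis using B(2) inside_no_overlap[of Jc] by blast
    next
      case False
      then show ?thesis using w dj by blast
    qed
    then show ?thesis unfolding images by blast
  qed
  have FP: "fst (P (V x)) = fst (P (V y)) \<longleftrightarrow> V x = V y" for x y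
    using inj_C vertex_in_C V_in P_eq_iff V_less by (metis inj_onD)
  have t': "fst (P (V t)) \<in> path_image c2 - {fst (P (V a)), fst (P (V b))}"
  proof -
    have "V t \<noteq> V a" "V t \<noteq> V b" using window_inj[of a t a] window_inj[of a t b] ab' t by auto
    moreover have "P (V t) \<in> earc D (E t)" using end_in_edge[OF E_edge] by (auto simp: E_def)
    ultimately show ?thesis unfolding images \<beta> using t(1,2) FP
      by (intro DiffI imageI UN_I[of t]) auto
  qed
  have "closure B \<inter> path_image c1 \<subseteq> {fst (P (V a)), fst (P (V b))}"
    using chord_separates(2)[OF arcs ends int' cin B(1) _ Bc t(3) t'] B(2) Jc by simp
  moreover have "P (V s) \<in> earc D (E s)" using end_in_edge[OF E_edge] by (auto simp: E_def)
  then have "fst (P (V s)) \<in> path_image c1" unfolding images \<alpha> using s(1,2)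
    by (intro imageI UN_I[of s]) auto
  moreover have "V s \<noteq> V a" "V s \<noteq> V b" using window_inj[of a s a] window_inj[of a s b] ab' s by auto
  ultimately show False using s(3) FP by auto
qed

text \<open>Disjoint sets whose projections meet have different heights over a common point.\<close>

lemma fragments_cross:
  assumes "A \<in> Frag" "B \<in> Frag" "A' \<subseteq> A" "B' \<subseteq> B" "A' \<inter> B' = {}" "fst ` A' \<inter> fst ` B' \<noteq> {}"
  shows "crosses_over A B \<or> crosses_over B A"
proof -
  obtain x y where xy: "x \<in> A'" "y \<in> B'" "fst x = fst y" using assms(6) by auto
  then have "snd x \<noteq> snd y" using assms(5) by (metis disjoint_iff prod_eq_iff)
  then show ?thesis using xy assms(3,4) unfolding crosses_over_def
    by (metis in_mono linorder_neqE_linordered_idom)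
qed

lemma edge_end_closure:
  assumes "e \<in> edges K" "e \<notin> cycle_edges c" "v \<in> e"
  shows "fst (P v) \<in> closure (fst ` (earc D e - C))"
  using edge_minus_C(2)[OF assms(1,2)] end_in_edge[OF assms(1,3)] by (intro fst_closure) simp

lemma interleaved_chords_cross:
  assumes p: "(a, b) \<in> diagonals k" "(a', b') \<in> diagonals k" and il: "a < a'" "a' < b" "b < b'"
  shows "crosses_over (earc D {V a, V b}) (earc D {V a', V b'}) \<or>
    crosses_over (earc D {V a', V b'}) (earc D {V a, V b})"
proof -
  let ?e = "{V a, V b}" and ?f = "{V a', V b'}"
  have e: "?e \<in> chords" and f: "?f \<in> chords"
    using diag_edge_chord p by (force simp: diag_edge_def)+
  have f': "?f \<in> edges K" "?f \<notin> cycle_edges c" using f by (auto simp: chords_def)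
  have ne: "?e \<noteq> ?f" 
    using inj_onD[OF diag_edge_inj _ p] il by (auto simp: diag_edge_def)
  have "fst ` (earc D ?f - C) \<inter> fst ` (earc D ?e - C) \<noteq> {}"
  proof (rule diagonal_crossed[OF p(1) _ _ il(1,2) _ il(3)])
    show "connected (fst ` (earc D ?f - C))"
      using edge_minus_C(1)[OF f'] by (intro connected_continuous_image continuous_intros)
    show "fst ` (earc D ?f - C) \<subseteq> inside Jc"
      using fragment_inside[OF chord_fragment[OF f]] .
    show "b' < a + k" using p(2) by (auto simp: diagonals_def)
  qed (use edge_end_closure[OF f'] in auto)
  moreover have "(earc D ?f - C) \<inter> (earc D ?e - C) = {}"
    using chord_disjoint[OF f _ ne[symmetric]] e by (auto simp: chords_def)
  ultimately show ?thesis
    using fragments_cross[OF chord_fragment[OF f] chord_fragment[OF e], of "earc D ?f - C" "earc D ?e - C"]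
    by blast
qed

lemma R_Int_C: "R \<inter> C = {}"
  by (auto simp: R_def)

lemma R_inside: "fst ` R \<subseteq> inside Jc"
proof (cases "{..<n} \<subseteq> set c")
  case True
  then have "R = {}" unfolding R_def by (auto simp: complete_graph_def)
  then show ?thesis by simp
next
  case False
  then have "closure R \<in> Frag" by (simp add: fragments_eq)
  moreover have "R \<subseteq> closure R - C" using closure_subset[of R] R_Int_C by blast
  ultimately show ?thesis using fragment_inside by blast
qed

lemma spine_vertex_closure_R:
  assumes "\<not> {..<n} \<subseteq> set c" shows "fst (P (V i)) \<in> closure (fst ` R)"
proof -
  obtain x where x: "x < n" "x \<notin> set c" using assms by auto
  then have e: "{x, V i} \<in> edges K" using V_less V_in by (metis complete_graph_simps(2))
  have "{x, V i} \<notin> cycle_edges c" using cycle_edges_subset x by blast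
  then have "fst (P (V i)) \<in> closure (fst ` (earc D {x, V i} - C))"
    using edge_end_closure[OF e] by simp
  moreover have "earc D {x, V i} - C \<subseteq> R" using edge_in_R[OF e] x by simp
  ultimately show ?thesis by (meson closure_mono image_mono subsetD)
qed

lemma chord_crosses_R:
  assumes "\<not> {..<n} \<subseteq> set c" "(a, b) \<in> diagonals k"
  shows "crosses_over (earc D {V a, V b}) (closure R) \<or> crosses_over (closure R) (earc D {V a, V b})"
proof -
  let ?e = "{V a, V b}"
  have e: "?e \<in> chords" using diag_edge_chord assms(2) by (force simp: diag_edge_def)
  have ab: "a + 2 \<le> b" "b < k" "\<not> (a = 0 \<and> b = k - 1)" using assms(2) by (auto simp: diagonals_def)
  \<comment> \<open>A spine vertex beyond \<open>b\<close>; the index \<open>k\<close> denotes the vertex \<open>0\<close>.\<close>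
  define t where "t = (if a = 0 then b + 1 else k)"
  have t: "b < t" "t < a + k" using ab by (auto simp: t_def)
  have "fst ` R \<inter> fst ` (earc D ?e - C) \<noteq> {}"
    using spine_vertex_closure_R[OF assms(1)] R_inside ab t
    by (intro diagonal_crossed[OF assms(2), of _ "a + 1" t])
      (auto intro!: connected_continuous_image continuous_intros R_connected)
  moreover have "R \<inter> (earc D ?e - C) = {}" using chord_disjoint_R[OF e] by blast
  moreover have "closure R \<in> Frag" using assms(1) by (simp add: fragments_eq)
  ultimately show ?thesis
    using fragments_cross[OF _ chord_fragment[OF e], of "closure R" R "earc D ?e - C"] closure_subset
    by blast
qed

text \<open>The stars of two off-spine vertices lie in the same fragment, which projects injectively, so they would be two disjoint
stars in the disc that reach the same three spine vertices.\<close>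

lemma at_most_one_off_vertex:
  assumes x: "x < n" "x \<notin> set c" and y: "y < n" "y \<notin> set c"
  shows "x = y"
proof (rule ccontr)
  assume "x \<noteq> y"
  have off: "\<not> {..<n} \<subseteq> set c" using x by auto
  have FR: "closure R \<in> Frag" using off by (simp add: fragments_eq)
  have leg: "{z, V i} \<in> edges K" "{z, V i} \<notin> cycle_edges c" "earc D {z, V i} - C \<subseteq> R"
    "earc D {z, V i} \<subseteq> closure R" "earc D {z, V i} \<inter> C = {P (V i)}"
    if "z < n" "z \<notin> set c" for z i
  proof -
    show e: "{z, V i} \<in> edges K" using V_less V_in that by (metis complete_graph_simps(2))
    show nc: "{z, V i} \<notin> cycle_edges c" using cycle_edges_subset that by blast
    show R: "earc D {z, V i} - C \<subseteq> R" using edge_in_R[OF e] that by simp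
    show "earc D {z, V i} \<subseteq> closure R" using closure_mono[OF R] edge_minus_C(2)[OF e nc] by simp
    have "{z, V i} \<inter> set c = {V i}" using that V_in by auto
    then show "earc D {z, V i} \<inter> C = {P (V i)}" using edge_Int_C[OF e nc] by simp
  qed
  have "\<exists>l. arc l \<and> path_image l = fst ` earc D {x, V i} \<and> pathstart l = fst (P x) \<and> pathfinish l = fst (P (V i))" for i
  proof -
    have "x \<noteq> V i" using x V_in by auto
    then obtain \<gamma> where \<gamma>: "arc \<gamma>" "path_image \<gamma> = earc D {x, V i}" "pathstart \<gamma> = P x" "pathfinish \<gamma> = P (V i)"
      using edge_arc[OF x(1) V_less] by metis
    have "inj_on fst (path_image \<gamma>)" using fragment_inj[OF FR] leg(4)[OF x] \<gamma>(2) inj_on_subset by metis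
    then show ?thesis using \<gamma> arc_fst_image
      by (intro exI[of _ "fst \<circ> \<gamma>"]) (auto simp: path_image_compose pathstart_compose pathfinish_compose)
  qed
  then obtain l where l: "\<And>i. arc (l i)" "\<And>i. path_image (l i) = fst ` earc D {x, V i}"
    "\<And>i. pathstart (l i) = fst (P x)" "\<And>i. pathfinish (l i) = fst (P (V i))" by metis
  have chain: "\<exists>g. arc g \<and> path_image g = fst ` (\<Union>t\<in>{i..<j}. earc D (E t)) \<and>
      pathstart g = fst (P (V i)) \<and> pathfinish g = fst (P (V j))" if ij: "i < j" "j < i + k" for i j
  proof -
    obtain \<gamma> where \<gamma>: "arc \<gamma>" "path_image \<gamma> = (\<Union>t\<in>{i..<j}. earc D (E t))"
      "pathstart \<gamma> = P (V i)" "pathfinish \<gamma> = P (V j)" using spine_arc[OF ij] by metis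
    have "inj_on fst (path_image \<gamma>)" 
      by (rule inj_on_subset[OF inj_C]) (auto simp: \<gamma> C_eq)
    then show ?thesis using \<gamma> arc_fst_image
      by (intro exI[of _ "fst \<circ> \<gamma>"]) (auto simp: path_image_compose pathstart_compose pathfinish_compose)
  qed
  obtain g0 where g0: "arc g0" "path_image g0 = fst ` earc D (E 0)"
    "pathstart g0 = fst (P (V 0))" "pathfinish g0 = fst (P (V 1))"
    using chain[of 0 1] k3 by auto
  obtain g1 where g1: "arc g1" "path_image g1 = fst ` earc D (E 1)"
    "pathstart g1 = fst (P (V 1))" "pathfinish g1 = fst (P (V 2))"
    using chain[of 1 2] k3 by (auto simp: numeral_2_eq_2)
  have Vk: "V k = V 0" using V_mod(2)[of 0] by simp
  obtain g2 where g2: "arc g2" "path_image g2 = fst ` (\<Union>t\<in>{2..<k}. earc D (E t))"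
    "pathstart g2 = fst (P (V 2))" "pathfinish g2 = fst (P (V 0))"
    using chain[of 2 k] k3 Vk by auto
  have sub: "earc D (E t) \<subseteq> C" for t by (auto simp: C_eq)
  have FI: "fst ` S \<inter> fst ` T = fst ` (S \<inter> T)" if "S \<subseteq> C" "T \<subseteq> C" for S T
    using inj_on_image_Int[OF inj_C that] by simp
  have sub2: "(\<Union>t\<in>{2..<k}. earc D (E t)) \<subseteq> C" using sub by blast
  have PE: "P (V t) \<in> earc D (E t)" "P (V (Suc t)) \<in> earc D (E t)" for t
    using end_in_edge[OF E_edge] by (auto simp: E_def)
  have i01: "earc D (E 0) \<inter> earc D (E 1) = {P (V 1)}"
    using E_Int[of 0 0 1] k3 PE(2)[of 0] PE(1)[of 1] by (auto split: if_splits)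
  have i12: "earc D (E 1) \<inter> (\<Union>t\<in>{2..<k}. earc D (E t)) = {P (V 2)}"
  proof
    have "earc D (E 1) \<inter> earc D (E t) \<subseteq> {P (V 2)}" if "t \<in> {2..<k}" for t
      using E_Int[of 0 1 t] that by (auto split: if_splits simp: numeral_2_eq_2)
    then show "earc D (E 1) \<inter> (\<Union>t\<in>{2..<k}. earc D (E t)) \<subseteq> {P (V 2)}" by blast
    show "{P (V 2)} \<subseteq> earc D (E 1) \<inter> (\<Union>t\<in>{2..<k}. earc D (E t))"
      using PE(2)[of 1] PE(1)[of 2] k3 by (auto simp: numeral_2_eq_2 intro!: bexI[of _ 2])
  qed
  have i20: "(\<Union>t\<in>{2..<k}. earc D (E t)) \<inter> earc D (E 0) = {P (V 0)}"
  proof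
    have "earc D (E 0) \<inter> earc D (E t) \<subseteq> {P (V 0)}" if "t \<in> {2..<k}" for t
      using E_Int[of 0 0 t] that by (auto split: if_splits)
    then show "(\<Union>t\<in>{2..<k}. earc D (E t)) \<inter> earc D (E 0) \<subseteq> {P (V 0)}" by blast
    have "k - 1 \<in> {2..<k}" "Suc (k - 1) = k" using k3 by auto
    then show "{P (V 0)} \<subseteq> (\<Union>t\<in>{2..<k}. earc D (E t)) \<inter> earc D (E 0)"
      using PE(2)[of "k - 1"] PE(1)[of 0] Vk by auto
  qed
  have Jc: "Jc = path_image g0 \<union> path_image g1 \<union> path_image g2"
  proof -
    have "{0..<0 + k} = insert 0 (insert 1 {2..<k})" using k3 by auto
    then have "C = earc D (E 0) \<union> earc D (E 1) \<union> (\<Union>t\<in>{2..<k}. earc D (E t))"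
      unfolding window_cover[of 0, symmetric] by (simp add: Un_assoc)
    then show ?thesis unfolding g0(2) g1(2) g2(2) by (simp only: image_Un)
  qed
  have V_ne: "V 0 \<noteq> V 1" "V 1 \<noteq> V 2" "V 2 \<noteq> V 0"
    using window_inj[of 0 0 1] window_inj[of 0 1 2] window_inj[of 0 2 0] k3 by auto
  have FR_Int: "fst ` S \<inter> fst ` T = fst ` (S \<inter> T)" if "S \<subseteq> closure R" "T \<subseteq> closure R" for S T
    using inj_on_image_Int[OF fragment_inj[OF FR] that] by simp
  have legs: "path_image (l i) \<inter> path_image (l j) = {fst (P x)}" if "V i \<noteq> V j" for i j
  proof -
    have "earc D {x, V i} \<inter> earc D {x, V j} = {P x}"
    proof
      have ne: "{x, V i} \<noteq> {x, V j}" and "{x, V i} \<inter> {x, V j} = {x}"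
        using that x V_in by (auto simp: doubleton_eq_iff)
      then have "P ` ({x, V i} \<inter> {x, V j}) = {P x}" by (simp only: image_insert image_empty)
      with ne show "earc D {x, V i} \<inter> earc D {x, V j} \<subseteq> {P x}"
        using edges_Int[OF leg(1)[OF x] leg(1)[OF x], of i j] by (simp only:) simp
      show "{P x} \<subseteq> earc D {x, V i} \<inter> earc D {x, V j}" using end_in_edge leg(1)[OF x] by auto
    qed
    then show ?thesis unfolding l using FR_Int[OF leg(4)[OF x] leg(4)[OF x]] by simp
  qed
  have legin: "path_image (l i) - {fst (P (V i))} \<subseteq> inside Jc" for i
  proof -
    have "path_image (l i) - {fst (P (V i))} \<subseteq> fst ` (earc D {x, V i} - C)"
    proof
      fix z assume "z \<in> path_image (l i) - {fst (P (V i))}"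
      then have z: "z \<in> fst ` earc D {x, V i}" "z \<noteq> fst (P (V i))" unfolding l by auto
      then obtain w where w: "z = fst w" "w \<in> earc D {x, V i}" by blast
      then have "w \<noteq> P (V i)" using z by blast
      then have "w \<notin> C" using leg(5)[OF x, of i] w by blast
      then show "z \<in> fst ` (earc D {x, V i} - C)" using w by blast
    qed
    then show ?thesis using leg(3)[OF x, of i] R_inside by blast
  qed
  define Y where "Y = (\<Union>i. earc D {y, V i} - C)"
  have YR: "Y \<subseteq> R" using leg(3)[OF y] by (auto simp: Y_def)
  have "connected Y" unfolding Y_def
  proof (rule connected_Union)
    show "connected S" if "S \<in> range (\<lambda>i. earc D {y, V i} - C)" for S
      using that edge_minus_C(1) leg[OF y] by auto
    have "P y \<in> earc D {y, V i} - C" for i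
      using end_in_edge leg(1)[OF y] off_vertex_notin_C y by auto
    then show "\<Inter> (range (\<lambda>i. earc D {y, V i} - C)) \<noteq> {}" by blast
  qed
  then have Yc: "connected (fst ` Y)" by (intro connected_continuous_image continuous_intros)
  have Yin: "fst ` Y \<subseteq> inside Jc" using YR R_inside by blast
  have Yl: "fst ` Y \<inter> path_image (l i) = {}" for i
  proof -
    have "earc D {y, V j} \<inter> earc D {x, V i} \<subseteq> C" for j
    proof -
      have "{y, V j} \<noteq> {x, V i}" "{y, V j} \<inter> {x, V i} \<subseteq> set c"
        using x y V_in \<open>x \<noteq> y\<close> by (auto simp: doubleton_eq_iff)
      then show ?thesis using edges_Int[OF leg(1)[OF y] leg(1)[OF x], of j i] vertex_in_C by blast
    qed
    then have "Y \<inter> earc D {x, V i} = {}" by (auto simp: Y_def)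
    moreover have "Y \<subseteq> closure R" using YR closure_subset by blast
    ultimately show ?thesis unfolding l using FR_Int[OF _ leg(4)[OF x]] by simp
  qed
  have Ycl: "fst (P (V i)) \<in> closure (fst ` Y)" for i
  proof -
    have "fst (P (V i)) \<in> closure (fst ` (earc D {y, V i} - C))"
      using edge_end_closure leg[OF y] by blast
    moreover have "earc D {y, V i} - C \<subseteq> Y" by (auto simp: Y_def)
    ultimately show ?thesis by (meson closure_mono image_mono subsetD)
  qed
  show False
  proof (rule no_second_star[where J = Jc and Y = "fst ` Y"])
    show "arc g0" "arc g1" "arc g2" "arc (l 0)" "arc (l 1)" "arc (l 2)" using g0 g1 g2 l by auto
    show "pathstart g0 = fst (P (V 0))" "pathfinish g0 = fst (P (V 1))"
      "pathstart g1 = fst (P (V 1))" "pathfinish g1 = fst (P (V 2))"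
      "pathstart g2 = fst (P (V 2))" "pathfinish g2 = fst (P (V 0))"
      "pathstart (l 0) = fst (P x)" "pathfinish (l 0) = fst (P (V 0))"
      "pathstart (l 1) = fst (P x)" "pathfinish (l 1) = fst (P (V 1))"
      "pathstart (l 2) = fst (P x)" "pathfinish (l 2) = fst (P (V 2))" using g0 g1 g2 l by auto
    show "Jc = path_image g0 \<union> path_image g1 \<union> path_image g2" by (rule Jc)
    show "path_image g0 \<inter> path_image g1 = {fst (P (V 1))}"
      "path_image g1 \<inter> path_image g2 = {fst (P (V 2))}"
      "path_image g2 \<inter> path_image g0 = {fst (P (V 0))}"
      unfolding g0(2) g1(2) g2(2) by (simp_all only: FI sub sub2 i01 i12 i20 image_insert image_empty)
    show "path_image (l 0) \<inter> path_image (l 1) = {fst (P x)}"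
      "path_image (l 1) \<inter> path_image (l 2) = {fst (P x)}"
      "path_image (l 2) \<inter> path_image (l 0) = {fst (P x)}"
      using legs V_ne by auto
    show "path_image (l 0) - {fst (P (V 0))} \<subseteq> inside Jc"
      "path_image (l 1) - {fst (P (V 1))} \<subseteq> inside Jc"
      "path_image (l 2) - {fst (P (V 2))} \<subseteq> inside Jc" using legin by auto
    show "connected (fst ` Y)" "fst ` Y \<subseteq> inside Jc" by (rule Yc, rule Yin)
    show "fst ` Y \<inter> (path_image (l 0) \<union> path_image (l 1) \<union> path_image (l 2)) = {}" using Yl by blast
    show "fst (P (V 0)) \<in> closure (fst ` Y)" "fst (P (V 1)) \<in> closure (fst ` Y)"
      "fst (P (V 2)) \<in> closure (fst ` Y)" using Ycl by auto
  qed
qed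

lemma card_set_c: "card (set c) = k"
  using cyc by (simp add: is_cycle_def k_def distinct_card)

lemma level_diagonals_bound:
  assumes lp: "level_partition Frag m L" and "i \<in> {1..m}"
  shows "card {p \<in> diagonals k. earc D (diag_edge p) \<in> L i} \<le> k - 3"
proof (rule noncrossing_diagonals_bound)
  fix a b a' b'
  assume p: "(a, b) \<in> {p \<in> diagonals k. earc D (diag_edge p) \<in> L i}"
    "(a', b') \<in> {p \<in> diagonals k. earc D (diag_edge p) \<in> L i}"
  show "\<not> (a < a' \<and> a' < b \<and> b < b')"
  proof
    assume il: "a < a' \<and> a' < b \<and> b < b'"
    have "diag_edge (a, b) \<noteq> diag_edge (a', b')"
      using inj_onD[OF diag_edge_inj, of "(a, b)" "(a', b')"] p il by auto
    then have ne: "earc D (diag_edge (a, b)) \<noteq> earc D (diag_edge (a', b'))"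
      using inj_onD[OF earc_chord_inj] diag_edge_chord p by blast
    have "\<not> crosses_over (earc D (diag_edge (a, b))) (earc D (diag_edge (a', b')))"
      "\<not> crosses_over (earc D (diag_edge (a', b'))) (earc D (diag_edge (a, b)))"
      using level_no_crossing[OF lp assms(2)] p ne by auto
    then show False using interleaved_chords_cross p il by (auto simp: diag_edge_def)
  qed
qed (use k3 in auto)

lemma diagonals_cover:
  assumes lp: "level_partition Frag m L"
  shows "diagonals k = (\<Union>i\<in>{1..m}. {p \<in> diagonals k. earc D (diag_edge p) \<in> L i})"
proof -
  have "(\<Union>i\<in>{1..m}. L i) = Frag" using lp by (simp add: level_partition_def)
  then show ?thesis using chord_fragment diag_edge_chord by blast
qed

lemma hamiltonian_levels:
  assumes "{..<n} \<subseteq> set c" "4 \<le> n"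
  shows "n \<le> 2 * m"
proof -
  have kn: "k = n" using assms(1) set_c_less card_set_c by (metis card_lessThan subset_antisym)
  obtain L where lp: "level_partition Frag m L" using lev by (auto simp: divided_in_levels_def)
  have "card (diagonals k) \<le> (\<Sum>i\<in>{1..m}. card {p \<in> diagonals k. earc D (diag_edge p) \<in> L i})"
    by (subst diagonals_cover[OF lp]) (rule card_UN_le, simp)
  also have "\<dots> \<le> (\<Sum>i\<in>{1..m}. k - 3)"
    using level_diagonals_bound[OF lp] by (intro sum_mono)
  finally have "card (diagonals k) \<le> m * (k - 3)" by simp
  then have "k * (k - 3) \<le> (2 * m) * (k - 3)" using card_diagonals[OF k3] by linarith
  then show ?thesis using kn assms(2) by (auto simp only: mult_le_cancel2)
qed

text \<open>The level of the fragment \<open>closure R\<close> contains no chord, because this fragment crosses all chords; the chords have to be distributed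
over the remaining levels.\<close>

lemma non_hamiltonian_levels:
  assumes off: "\<not> {..<n} \<subseteq> set c"
  shows "1 \<le> m" and "5 \<le> n \<Longrightarrow> n \<le> 2 * m"
proof -
  obtain L where lp: "level_partition Frag m L" using lev by (auto simp: divided_in_levels_def)
  have un: "(\<Union>i\<in>{1..m}. L i) = Frag" using lp by (simp add: level_partition_def)
  have FR: "closure R \<in> Frag" using off by (simp add: fragments_eq)
  then obtain i0 where i0: "i0 \<in> {1..m}" "closure R \<in> L i0" using un by blast
  then show "1 \<le> m" by simp
  assume n: "5 \<le> n"
  obtain x where x: "x < n" "x \<notin> set c" using off by auto
  have "{..<n} = insert x (set c)" using x set_c_less at_most_one_off_vertex[OF x] by blast
  then have kn: "n = Suc k" using card_set_c x by (metis List.finite_set card_insert_disjoint card_lessThan)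
  let ?T = "\<lambda>i. {p \<in> diagonals k. earc D (diag_edge p) \<in> L i}"
  have T0: "?T i0 = {}"
  proof (rule ccontr)
    assume "?T i0 \<noteq> {}"
    then obtain a b where ab: "(a, b) \<in> diagonals k" "earc D {V a, V b} \<in> L i0"
      by (auto simp: diag_edge_def)
    have e: "{V a, V b} \<in> chords" using diag_edge_chord ab(1) by (force simp: diag_edge_def)
    have "earc D {V a, V b} \<noteq> closure R"
    proof
      assume "earc D {V a, V b} = closure R"
      then have "R \<subseteq> earc D {V a, V b} - C" using closure_subset[of R] R_Int_C by blast
      then show False using chord_disjoint_R[OF e] R_nonempty[OF off] by blast
    qed
    then show False using chord_crosses_R[OF off ab(1)] level_no_crossing[OF lp i0(1)] ab(2) i0(2) by metis
  qed
  have "card (diagonals k) \<le> (\<Sum>i\<in>{1..m}. card (?T i))"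
    by (subst diagonals_cover[OF lp]) (rule card_UN_le, simp)
  also have "\<dots> = (\<Sum>i\<in>{1..m} - {i0}. card (?T i))"
    using sum.remove[OF _ i0(1), of "\<lambda>i. card (?T i)"] T0 by (simp only: card.empty finite_atLeastAtMost)
  also have "\<dots> \<le> (\<Sum>i\<in>{1..m} - {i0}. k - 3)"
    using level_diagonals_bound[OF lp] by (intro sum_mono) auto
  also have "\<dots> = (m - 1) * (k - 3)" using i0 by simp
  finally have "k * (k - 3) \<le> (2 * (m - 1)) * (k - 3)"
    using card_diagonals[OF k3] by (simp only: mult.assoc)
  then have "k \<le> 2 * (m - 1)" using kn n by (auto simp only: mult_le_cancel2)
  then show "n \<le> 2 * m" using kn i0 by auto
qed

end

section \<open>Unknotted curves from gauges\<close>

lemma norm_sq_prod: "(norm (x :: 'a::real_normed_vector \<times> 'b::real_normed_vector))\<^sup>2 = (norm (fst x))\<^sup>2 + (norm (snd x))\<^sup>2"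
  by (simp add: norm_prod_def real_sqrt_pow2)

lemma S3_iff: "y \<in> S3 \<longleftrightarrow> (norm (fst y))\<^sup>2 + (snd y)\<^sup>2 = 1"
proof -
  have "y \<in> S3 \<longleftrightarrow> (norm y)\<^sup>2 = 1"
    by (auto simp: S3_def abs_square_eq_1 power2_eq_1_iff)
  then show ?thesis by (simp add: norm_sq_prod)
qed

lemma to_S3_in_S3: "to_S3 x \<in> S3"
proof -
  let ?N = "(norm x)\<^sup>2"
  have "?N + 1 > 0" by (smt (verit) zero_le_power2)
  then have "(2 / (?N + 1))\<^sup>2 * ?N + ((?N - 1) / (?N + 1))\<^sup>2 = 1"
    by (simp add: power_divide divide_simps) (simp add: power2_eq_square algebra_simps)
  then show ?thesis
    unfolding S3_iff to_S3_def fst_conv snd_conv norm_scaleR power_mult_distrib power2_abs .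
qed

definition from_S3 :: "space4 \<Rightarrow> space3" where
  "from_S3 y = (1 / (1 - snd y)) *\<^sub>R fst y"

lemma from_to_S3 [simp]: "from_S3 (to_S3 x) = x"
proof -
  let ?N = "(norm x)\<^sup>2"
  have "?N + 1 > 0" by (smt (verit) zero_le_power2)
  then have "1 - (?N - 1) / (?N + 1) = 2 / (?N + 1)" by (simp add: divide_simps)
  moreover have "1 / (2 / (?N + 1)) * (2 / (?N + 1)) = 1" using \<open>?N + 1 > 0\<close> by simp
  ultimately show ?thesis
    unfolding from_S3_def to_S3_def fst_conv snd_conv scaleR_scaleR by (simp only: scaleR_one)
qed

lemma to_from_S3:
  assumes "y \<in> S3" "snd y \<noteq> 1"
  shows "to_S3 (from_S3 y) = y"
proof -
  let ?s = "snd y"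
  have 1: "(norm (fst y))\<^sup>2 = (1 - ?s) * (1 + ?s)" using assms(1) 
    by (simp add: S3_iff algebra_simps power2_eq_square)
  have s: "1 - ?s > 0"
  proof -
    have "?s\<^sup>2 \<le> 1" using assms(1) by (simp add: S3_iff) (smt (verit) zero_le_power2)
    then have "?s \<le> 1" by (simp add: power2_le_iff_abs_le abs_square_le_1)
    then show ?thesis using assms(2) by simp
  qed
  have N: "(norm (from_S3 y))\<^sup>2 = (1 + ?s) / (1 - ?s)"
    using s by (simp add: from_S3_def power_mult_distrib 1 power_divide) (simp add: divide_simps power2_eq_square)
  have "(norm (from_S3 y))\<^sup>2 + 1 = 2 / (1 - ?s)" "(norm (from_S3 y))\<^sup>2 - 1 = 2 * ?s / (1 - ?s)"
    using s unfolding N by (simp_all add: divide_simps)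
  moreover have "2 / (2 / (1 - ?s)) * (1 / (1 - ?s)) = 1" "2 * ?s / (1 - ?s) / (2 / (1 - ?s)) = ?s"
    using s by simp_all
  ultimately show ?thesis
    unfolding to_S3_def by (simp only: from_S3_def scaleR_scaleR scaleR_one prod.collapse)
qed

lemma snd_to_S3_neq: "snd (to_S3 x) \<noteq> 1"
proof -
  have "(norm x)\<^sup>2 + 1 > 0" by (smt (verit) zero_le_power2)
  then show ?thesis by (simp add: to_S3_def divide_simps)
qed

lemma S3_pole: "y \<in> S3 \<Longrightarrow> snd y = 1 \<Longrightarrow> y = (0, 1)"
  by (cases y) (simp add: S3_iff)

lemma inj_to_S3: "inj to_S3"
  by (metis from_to_S3 injI)

lemma continuous_to_S3: "continuous_on UNIV to_S3"
proof -
  have "(norm x)\<^sup>2 + 1 \<noteq> 0" for x :: space3 by (smt (verit) zero_le_power2)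
  then show ?thesis unfolding to_S3_def by (intro continuous_intros) auto
qed

lemma dist_to_S3_pole: "(dist (to_S3 x) (0, 1))\<^sup>2 = 4 / ((norm x)\<^sup>2 + 1)"
proof -
  let ?N = "(norm x)\<^sup>2"
  have p: "?N + 1 > 0" by (smt (verit) zero_le_power2)
  have "(dist (to_S3 x) (0, 1))\<^sup>2 = (2 / (?N + 1))\<^sup>2 * ?N + ((?N - 1) / (?N + 1) - 1)\<^sup>2"
  proof -
    have "to_S3 x - (0, 1) = ((2 / (?N + 1)) *\<^sub>R x, (?N - 1) / (?N + 1) - 1)"
      by (simp add: to_S3_def)
    then show ?thesis
      by (simp only: dist_norm norm_sq_prod[of "(_, _)"] fst_conv snd_conv norm_scaleR
          power_mult_distrib power2_abs real_norm_def)
  qed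
  also have "(?N - 1) / (?N + 1) - 1 = - 2 / (?N + 1)" using p by (simp add: divide_simps)
  also have "(2 / (?N + 1))\<^sup>2 * ?N + (- 2 / (?N + 1))\<^sup>2 = 4 / (?N + 1)"
    using p by (simp add: power_divide divide_simps) (simp add: power2_eq_square algebra_simps)
  finally show ?thesis .
qed

text \<open>The pole, where the last coordinate is \<open>1\<close>, corresponds to infinity and is fixed.\<close>

definition extend_S3 :: "(space3 \<Rightarrow> space3) \<Rightarrow> space4 \<Rightarrow> space4" where
  "extend_S3 H y = (if snd y = 1 then y else to_S3 (H (from_S3 y)))"

text \<open>Continuity at the pole expresses that a homeomorphism of space is proper. It is visible in the formula for the distance of
a point to the pole, which is a decreasing function of the norm of its stereographic image.\<close>

lemma continuous_extend_S3:
  assumes H: "homeomorphism UNIV UNIV H H'"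
  shows "continuous_on S3 (extend_S3 H)"
proof -
  have cH: "continuous_on UNIV H" using H by (simp add: homeomorphism_def)
  have "continuous (at y within S3) (extend_S3 H)" if y: "y \<in> S3" for y
  proof (cases "snd y = 1")
    case False
    let ?U = "{y :: space4. snd y \<noteq> 1}"
    have "open ?U" by (intro open_Collect_neq continuous_intros)
    have "continuous_on ?U (\<lambda>y. to_S3 (H (from_S3 y)))"
      unfolding from_S3_def
      by (intro continuous_on_compose2[OF continuous_to_S3] continuous_on_compose2[OF cH] continuous_intros) auto
    then have "continuous_on ?U (extend_S3 H)"
      by (rule continuous_on_eq) (simp add: extend_S3_def)
    then show ?thesis using \<open>open ?U\<close> False
      by (metis (mono_tags, lifting) continuous_on_eq_continuous_at continuous_at_imp_continuous_at_within mem_Collect_eq)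
  next
    case True
    then have y1: "y = (0, 1)" using S3_pole y by simp
    show ?thesis unfolding continuous_within_eps_delta
    proof (intro allI impI)
      fix e :: real assume e: "0 < e"
      define M where "M = 2 / e"
      have "bounded (H' ` cball 0 M)"
        using H by (intro compact_imp_bounded compact_continuous_image)
          (auto simp: homeomorphism_def intro: continuous_on_subset)
      then obtain r where r: "0 < r" "\<And>x. x \<in> H' ` cball 0 M \<Longrightarrow> norm x \<le> r"
        unfolding bounded_pos by blast
      have far: "M < norm (H x)" if "r < norm x" for x
      proof (rule ccontr)
        assume "\<not> M < norm (H x)"
        then have "H' (H x) \<in> H' ` cball 0 M" by auto
        then have "x \<in> H' ` cball 0 M" using homeomorphism_apply1[OF H] by simp
        then show False using r(2) that by fastforce
      qed
      define d where "d = 2 / sqrt (r\<^sup>2 + 1)"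
      have r1: "0 < r\<^sup>2 + 1" using r(1) by (simp add: add_pos_pos)
      have d: "0 < d" "d\<^sup>2 = 4 / (r\<^sup>2 + 1)"
        using r1 by (auto simp: d_def power_divide)
      have "dist (extend_S3 H y') (extend_S3 H y) < e" if y': "y' \<in> S3" "dist y' y < d" for y'
      proof (cases "snd y' = 1")
        case True
        then have "y' = y" using S3_pole y' y1 by simp
        then show ?thesis using e by simp
      next
        case False
        define x where "x = from_S3 y'"
        have x: "y' = to_S3 x" using to_from_S3[OF y'(1) False] by (simp add: x_def)
        have "(dist y' y)\<^sup>2 < d\<^sup>2" using y'(2) d(1) by (intro power_strict_mono) auto
        then have "4 / ((norm x)\<^sup>2 + 1) < 4 / (r\<^sup>2 + 1)"
          using dist_to_S3_pole[of x] d x y1 by simp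
        moreover have "0 < (norm x)\<^sup>2 + 1" by (smt (verit) zero_le_power2)
        ultimately have "r\<^sup>2 < (norm x)\<^sup>2" using r1 by (simp add: divide_simps split: if_splits)
        then have "r < norm x" using norm_ge_zero power_less_imp_less_base by blast
        then have M: "M < norm (H x)" by (rule far)
        have "0 < M" using e by (simp add: M_def)
        have "(dist (extend_S3 H y') y)\<^sup>2 = 4 / ((norm (H x))\<^sup>2 + 1)"
          using False dist_to_S3_pole[of "H x"] y1 by (simp add: extend_S3_def x_def)
        also have "\<dots> < 4 / M\<^sup>2"
        proof -
          have "M\<^sup>2 < (norm (H x))\<^sup>2" using M \<open>0 < M\<close> by (intro power_strict_mono) auto
          then show ?thesis using \<open>0 < M\<close> by (intro divide_strict_left_mono) (auto intro!: mult_pos_pos add_pos_nonneg)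
        qed
        also have "\<dots> = e\<^sup>2" using e by (simp add: M_def power_divide)
        finally have "dist (extend_S3 H y') y < e"
          using e power_less_imp_less_base less_imp_le by blast
        then show ?thesis using True by (simp add: extend_S3_def)
      qed
      then show "\<exists>d>0. \<forall>x'\<in>S3. dist x' y < d \<longrightarrow> dist (extend_S3 H x') (extend_S3 H y) < e"
        using d(1) by blast
    qed
  qed
  then show ?thesis by (simp add: continuous_on_eq_continuous_within)
qed

lemma homeomorphism_extend_S3:
  assumes H: "homeomorphism UNIV UNIV H H'"
  shows "homeomorphism S3 S3 (extend_S3 H) (extend_S3 H')"
proof -
  have H': "homeomorphism UNIV UNIV H' H" using H by (rule homeomorphism_symD)
  have maps: "extend_S3 F y \<in> S3" if "y \<in> S3" for F y
    using that to_S3_in_S3 by (simp add: extend_S3_def)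
  have inv: "extend_S3 G (extend_S3 F y) = y" if "\<And>x. G (F x) = x" "y \<in> S3" for F G y
    using that to_from_S3 by (auto simp: extend_S3_def snd_to_S3_neq)
  have "\<And>x. H' (H x) = x" "\<And>x. H (H' x) = x"
    using homeomorphism_apply1[OF H] homeomorphism_apply2[OF H] by simp_all
  then show ?thesis
    using continuous_extend_S3[OF H] continuous_extend_S3[OF H'] maps inv
    by (intro homeomorphismI) auto
qed

text \<open>On the unit circle of the plane \<open>to_S3\<close> is the standard inclusion.\<close>

lemma unknotted_homeomorphic_image:
  fixes H :: "space3 \<Rightarrow> space3"
  assumes H: "homeomorphism UNIV UNIV H H'"
  shows "unknotted (to_S3 ` H ` {(z, 0) | z :: complex. norm z = 1})"
proof -
  have "to_S3 (z, 0) = ((z, 0), 0)" if "norm z = 1" for z :: complex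
    using that by (simp add: to_S3_def norm_Pair)
  then have ext: "extend_S3 H ((z, 0), 0) = to_S3 (H (z, 0))" if "norm z = 1" for z :: complex
    using that by (metis extend_S3_def from_to_S3 snd_to_S3_neq)
  have "to_S3 ` H ` {(z, 0) | z :: complex. norm z = 1} = (\<lambda>z. to_S3 (H (z, 0))) ` {z. norm z = 1}"
    by auto
  also have "\<dots> = (\<lambda>z. extend_S3 H ((z, 0), 0)) ` {z. norm z = 1}"
    using ext by (intro image_cong) auto
  also have "\<dots> = extend_S3 H ` {((z, 0), 0) | z :: complex. norm z = 1}"
    by auto
  finally have "to_S3 ` H ` {(z, 0) | z :: complex. norm z = 1} =
    extend_S3 H ` {((z, 0), 0) | z :: complex. norm z = 1}" .
  then show ?thesis using homeomorphism_extend_S3[OF H] unfolding unknotted_def by blast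
qed

lemma continuous_on_radial:
  fixes q :: "complex \<Rightarrow> real"
  assumes q: "continuous_on (- {0}) q" and B: "\<And>z. \<bar>q z\<bar> \<le> B"
  shows "continuous_on UNIV (\<lambda>z. q z *\<^sub>R z)"
proof -
  have "isCont (\<lambda>z. q z *\<^sub>R z) z" for z
  proof (cases "z = 0")
    case False
    have "continuous_on (- {0}) (\<lambda>z. q z *\<^sub>R z)" by (intro continuous_intros q)
    then show ?thesis by (rule continuous_on_interior) (use False in \<open>simp add: interior_open open_Compl\<close>)
  next
    case True
    have "((\<lambda>z. q z *\<^sub>R z) \<longlongrightarrow> 0) (at 0)"
    proof (rule Lim_null_comparison)
      show "\<forall>\<^sub>F z in at 0. norm (q z *\<^sub>R z) \<le> B * norm z"
        using B by (auto intro!: always_eventually mult_right_mono)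
      show "((\<lambda>z::complex. B * norm z) \<longlongrightarrow> 0) (at 0)" by (intro tendsto_eq_intros) auto
    qed
    then show ?thesis using True by (simp add: isCont_def)
  qed
  then show ?thesis by (simp add: continuous_on_eq_continuous_at)
qed

text \<open>The function \<open>p\<close> is the gauge of a compact set that is star-shaped with respect to the origin, and \<open>p z = 1\<close>
describes the boundary of that set.\<close>

locale gauge =
  fixes p :: "complex \<Rightarrow> real"
  assumes cont: "continuous_on UNIV p"
    and homog: "\<And>t z. 0 \<le> t \<Longrightarrow> p (t *\<^sub>R z) = t * p z"
    and pos: "\<And>z. z \<noteq> 0 \<Longrightarrow> 0 < p z"
begin

lemma zero: "p 0 = 0"
  using homog[of 0 0] by simp

lemma sphere_bounds: "\<exists>a b. 0 < a \<and> (\<forall>z. a * norm z \<le> p z) \<and> (\<forall>z. p z \<le> b * norm z)"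
proof -
  have S: "compact (sphere 0 1 :: complex set)" "sphere 0 1 \<noteq> ({} :: complex set)"
    "continuous_on (sphere 0 1) p"
    using cont continuous_on_subset by auto
  obtain u where u: "u \<in> sphere 0 1" "\<And>z. z \<in> sphere 0 1 \<Longrightarrow> p u \<le> p z"
    using continuous_attains_inf[OF S] by blast
  obtain w where w: "w \<in> sphere 0 1" "\<And>z. z \<in> sphere 0 1 \<Longrightarrow> p z \<le> p w"
    using continuous_attains_sup[OF S] by blast
  have eq: "p z = norm z * p (z /\<^sub>R norm z)" if "z \<noteq> 0" for z
    using homog[of "norm z" "z /\<^sub>R norm z"] that by simp
  show ?thesis
  proof (intro exI conjI allI)
    show "0 < p u" using u(1) by (intro pos) auto
    show "p u * norm z \<le> p z" for z
    proof (cases "z = 0")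
      case False
      have "p u \<le> p (z /\<^sub>R norm z)" using False by (intro u(2)) simp
      then show ?thesis using eq[OF False] by (simp add: mult.commute mult_left_mono)
    qed (simp add: zero)
    show "p z \<le> p w * norm z" for z
    proof (cases "z = 0")
      case False
      have "p (z /\<^sub>R norm z) \<le> p w" using False by (intro w(2)) simp
      then show ?thesis using eq[OF False] by (simp add: mult.commute mult_left_mono)
    qed (simp add: zero)
  qed
qed

text \<open>Multiplying by $|z| / p(z)$ is a homeomorphism of the plane that takes the unit circle to the curve \<open>p z = 1\<close>. It is
continuous at the origin because the factor is bounded.\<close>

lemma unknotted_unit_level: "unknotted (to_S3 ` {(z, 0) | z. p (z - o') = 1})"
proof -
  obtain a b where ab: "0 < a" "\<And>z. a * norm z \<le> p z" "\<And>z. p z \<le> b * norm z"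
    using sphere_bounds by metis
  define q where "q z = norm z / p z" for z
  define q' where "q' z = p z / norm z" for z
  have p0: "0 \<le> p z" for z using pos zero by (metis less_imp_le order_refl)
  have c1: "continuous_on UNIV (\<lambda>z. q z *\<^sub>R z)"
  proof (rule continuous_on_radial)
    show "continuous_on (- {0}) q" unfolding q_def
      using pos by (intro continuous_intros continuous_on_subset[OF cont]) force+
    show "\<bar>q z\<bar> \<le> 1 / a" for z
      using ab(1) ab(2)[of z] pos[of z] by (cases "z = 0") (auto simp: q_def zero field_simps abs_of_pos)
  qed
  have c2: "continuous_on UNIV (\<lambda>z. q' z *\<^sub>R z)"
  proof (rule continuous_on_radial)
    show "continuous_on (- {0}) q'" unfolding q'_def
      by (intro continuous_intros continuous_on_subset[OF cont]) auto
    show "\<bar>q' z\<bar> \<le> \<bar>b\<bar>" for z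
    proof -
      have "p z \<le> \<bar>b\<bar> * norm z" using ab(3)[of z] by (smt (verit) mult_right_mono norm_ge_zero)
      then show ?thesis using p0[of z] by (cases "z = 0") (auto simp: q'_def field_simps)
    qed
  qed
  have inv1: "q' (q z *\<^sub>R z) *\<^sub>R (q z *\<^sub>R z) = z" for z
  proof (cases "z = 0")
    case False
    have "0 < q z" using False pos by (simp add: q_def)
    then have "q' (q z *\<^sub>R z) = q' z" by (simp add: q'_def homog)
    then show ?thesis using False pos[OF False] by (simp add: q_def q'_def)
  qed simp
  have inv2: "q (q' z *\<^sub>R z) *\<^sub>R (q' z *\<^sub>R z) = z" for z
  proof (cases "z = 0")
    case False
    have "0 < q' z" using False pos by (simp add: q'_def)
    then have "q (q' z *\<^sub>R z) = q z" by (simp add: q_def homog)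
    then show ?thesis using False pos[OF False] by (simp add: q_def q'_def)
  qed simp
  define H :: "space3 \<Rightarrow> space3" where "H = (\<lambda>y. (o' + q (fst y) *\<^sub>R fst y, snd y))"
  define H' :: "space3 \<Rightarrow> space3" where "H' = (\<lambda>y. (q' (fst y - o') *\<^sub>R (fst y - o'), snd y))"
  have "continuous_on UNIV H" unfolding H_def
    by (intro continuous_intros continuous_on_compose2[OF c1]) auto
  moreover have "continuous_on UNIV H'" unfolding H'_def
    by (intro continuous_intros continuous_on_compose2[OF c2]) auto
  moreover have "H' (H y) = y" "H (H' y) = y" for y
    using inv1 inv2 by (simp_all add: H_def H'_def)
  ultimately have hom: "homeomorphism UNIV UNIV H H'"
    by (intro homeomorphismI) auto
  have "H ` {(z, 0) | z :: complex. norm z = 1} = {(z, 0) | z. p (z - o') = 1}"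
  proof
    have "p (q z *\<^sub>R z) = 1" if "norm z = 1" for z
    proof -
      have "z \<noteq> 0" using that by auto
      then show ?thesis using that pos[of z] by (simp add: q_def homog)
    qed
    then show "H ` {(z, 0) | z :: complex. norm z = 1} \<subseteq> {(z, 0) | z. p (z - o') = 1}"
      by (auto simp: H_def)
    show "{(z, 0) | z. p (z - o') = 1} \<subseteq> H ` {(z, 0) | z :: complex. norm z = 1}"
    proof clarify
      fix z assume z: "p (z - o') = 1"
      then have z0: "z - o' \<noteq> 0" using zero by fastforce
      have "H (H' (z, 0)) = (z, 0)" using inv2 by (simp add: H_def H'_def)
      moreover have "H' (z, 0) = (q' (z - o') *\<^sub>R (z - o'), 0)" by (simp add: H'_def)
      moreover have "norm (q' (z - o') *\<^sub>R (z - o')) = 1" using z z0 by (simp add: q'_def)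
      ultimately show "(z, 0) \<in> H ` {(z, 0) | z :: complex. norm z = 1}"
        by (metis (mono_tags, lifting) image_eqI mem_Collect_eq)
    qed
  qed
  then show ?thesis using unknotted_homeomorphic_image[OF hom] by simp
qed

text \<open>The sublevel set is bounded, and the level set separates it from the superlevel set.\<close>

lemma sublevel_subset_inside:
  assumes "p (z - o') < 1"
  shows "z \<in> inside {z. p (z - o') = 1}"
proof -
  obtain a b where ab: "0 < a" "\<And>z. a * norm z \<le> p z" "\<And>z. p z \<le> b * norm z"
    using sphere_bounds by metis
  let ?J = "{z. p (z - o') = 1}" and ?A = "{z. p (z - o') < 1}" and ?B = "{z. p (z - o') > 1}"
  let ?T = "connected_component_set (- ?J) z"
  have c: "continuous_on UNIV (\<lambda>z. p (z - o'))"
    by (intro continuous_on_compose2[OF cont] continuous_intros) auto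
  have op: "open ?A" "open ?B" by (intro open_Collect_less c continuous_on_const)+
  have sub: "?T \<subseteq> ?A \<union> ?B"
    using connected_component_subset[of "- ?J" z] by fastforce
  have "z \<in> ?T" using assms by simp
  moreover have "?A \<inter> ?B \<inter> ?T = {}" by auto
  ultimately have "?B \<inter> ?T = {}"
    using connectedD[OF connected_connected_component op _ sub] assms by blast
  then have "?T \<subseteq> ?A" using sub by blast
  moreover have "bounded ?A"
  proof -
    have "norm w \<le> norm o' + 1 / a" if "p (w - o') < 1" for w
    proof -
      have "a * norm (w - o') < 1" using ab(2)[of "w - o'"] that by linarith
      then have "norm (w - o') < 1 / a" using ab(1) by (simp add: field_simps)
      then show ?thesis using norm_triangle_sub[of w o'] by linarith
    qed
    then show ?thesis unfolding bounded_iff by blast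
  qed
  ultimately have "bounded ?T" using bounded_subset by blast
  then show ?thesis using assms by (simp add: inside_def)
qed

end

lemma continuous_on_Max_image:
  fixes f :: "'i \<Rightarrow> 'a::topological_space \<Rightarrow> real"
  assumes "finite I" "I \<noteq> {}" "\<And>i. i \<in> I \<Longrightarrow> continuous_on S (f i)"
  shows "continuous_on S (\<lambda>x. Max ((\<lambda>i. f i x) ` I))"
  using assms
proof (induction I rule: finite_ne_induct)
  case (insert i I)
  have "(\<lambda>x. Max ((\<lambda>i. f i x) ` insert i I)) = (\<lambda>x. max (f i x) (Max ((\<lambda>i. f i x) ` I)))"
    using insert.hyps by simp
  then show ?case using insert by (auto intro!: continuous_on_max)
qed simp

section \<open>Convex polygons inscribed in a parabola\<close>

text \<open>The ordinate at \<open>t\<close> of the line through the points of the parabola over \<open>a\<close> and \<open>b\<close>.\<close>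

definition line :: "real \<Rightarrow> real \<Rightarrow> real \<Rightarrow> real" where
  "line a b t = (a + b) * t - a * b"

definition pt :: "real \<Rightarrow> complex" where
  "pt t = Complex t (t\<^sup>2)"

lemma line_commute: "line a b t = line b a t"
  by (simp add: line_def algebra_simps)

lemma line_ends [simp]: "line a b a = a\<^sup>2" "line a b b = b\<^sup>2"
  by (simp_all add: line_def algebra_simps power2_eq_square)

lemma line_diff: "line a b t - line a' b' t = (a + b - a' - b') * t - (a * b - a' * b')"
  by (simp add: line_def algebra_simps)

lemma lines_cross:
  assumes "a < a'" "a' < b" "b < b'"
  obtains t where "a' < t" "t < b" "line a b t = line a' b' t"
proof -
  define s where "s = a' + b' - a - b"
  define t where "t = (a' * b' - a * b) / s"
  have s: "0 < s" using assms by (simp add: s_def)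
  have 1: "(a' - a) * (b - a') > 0" "(b - a') * (b' - b) > 0" using assms by simp_all
  have "a' * s < a' * b' - a * b" "a' * b' - a * b < b * s"
    using 1 unfolding s_def by (simp_all add: algebra_simps)
  then have "a' < t" "t < b" using s by (simp_all add: t_def field_simps)
  moreover have "line a b t = line a' b' t"
    using s unfolding t_def line_def by (simp add: field_simps) (simp add: s_def algebra_simps)
  ultimately show thesis using that by blast
qed

lemma same_line:
  assumes "line a b s = line a' b' s" "line a b t = line a' b' t" "s \<noteq> t" "a < b" "a' < b'"
  shows "a = a' \<and> b = b'"
proof -
  have 1: "(a + b - a' - b') * s = a * b - a' * b'" "(a + b - a' - b') * t = a * b - a' * b'"
    using assms(1,2) line_diff[of a b s a' b'] line_diff[of a b t a' b'] by simp_all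
  then have "(a + b - a' - b') * (s - t) = 0" by (simp add: algebra_simps)
  then have e: "a + b = a' + b'" using assms(3) by simp
  then have "a * b = a' * b'" using 1 by simp
  then have "(a - a') * (a - b') = 0" using e by (simp add: algebra_simps) (metis distrib_left)
  then show ?thesis using e assms(4,5) by auto
qed

lemma lines_through_common_point:
  assumes "line w b t = line w b' t" "b \<noteq> b'" shows "t = w"
proof -
  have "(b - b') * (t - w) = 0" using assms(1) by (simp add: line_def algebra_simps)
  then show ?thesis using assms(2) by simp
qed

lemma line_at: "line a b t - t\<^sup>2 = (t - a) * (b - t)"
  by (simp add: line_def algebra_simps power2_eq_square)

lemma line_le_on_chord:
  assumes "a < a'" "b' < b" "a' \<le> t" "t \<le> b'"
  shows "line a' b' t < line a b t"
proof (cases "a' < b'")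
  case True
  \<comment> \<open>The difference is affine in \<open>t\<close>, so it is determined by its values at \<open>a'\<close> and \<open>b'\<close>.\<close>
  have e: "line a b t - line a' b' t = ((b' - t) * ((a' - a) * (b - a')) + (t - a') * ((b' - a) * (b - b'))) / (b' - a')"
    using True by (simp add: line_def field_simps)
  have 1: "0 < (a' - a) * (b - a')" "0 < (b' - a) * (b - b')" using assms by simp_all
  have "0 < (b' - t) * ((a' - a) * (b - a')) + (t - a') * ((b' - a) * (b - b'))"
  proof (cases "t = b'")
    case True then show ?thesis using 1 \<open>a' < b'\<close> by simp
  next
    case False
    then have "0 < (b' - t) * ((a' - a) * (b - a'))" using 1 assms by simp
    moreover have "0 \<le> (t - a') * ((b' - a) * (b - b'))" using 1 assms by simp
    ultimately show ?thesis by linarith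
  qed
  then have "0 < line a b t - line a' b' t" unfolding e using True by (intro divide_pos_pos) auto
  then show ?thesis by simp
next
  case False
  then have "a' = t" "b' = t" using assms by simp_all
  moreover have "0 < (t - a) * (b - t)" using assms calculation by simp
  ultimately show ?thesis using line_at[of a b t] by simp
qed

lemma common_point_interleaved:
  assumes "a < b" "a' < b'" "a \<le> t" "t \<le> b" "a' \<le> t" "t \<le> b'" "line a b t = line a' b' t"
    and "a \<noteq> a'" "a \<noteq> b'" "b \<noteq> a'" "b \<noteq> b'" "a < a'"
  shows "a' < t \<and> t < b \<and> b < b'"
proof -
  have "a' < b" using assms by linarith
  have bb: "b < b'"
  proof (rule ccontr)
    assume "\<not> b < b'"
    then show False using line_le_on_chord[of a a' b' b t] assms by simp
  qed
  have "t \<noteq> a'"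
  proof
    assume t: "t = a'"
    have "0 < (a' - a) * (b - a')" using assms \<open>a' < b\<close> by simp
    then show False using line_at[of a b a'] line_at[of a' b' a'] t assms by simp
  qed
  moreover have "t \<noteq> b"
  proof
    assume t: "t = b"
    have "0 < (b - a') * (b' - b)" using \<open>a' < b\<close> bb by simp
    then show False using line_at[of a b b] line_at[of a' b' b] t assms by simp
  qed
  ultimately show ?thesis using bb assms by simp
qed

text \<open>The determinant with the rows $(a + b, a b, 1)$, $(c + d, c d, 1)$ and $(e + f, e f, 1)$, whose entries are the
coefficients of the three lines.\<close>

definition concurrence :: "real \<Rightarrow> real \<Rightarrow> real \<Rightarrow> real \<Rightarrow> real \<Rightarrow> real \<Rightarrow> real" where
  "concurrence a b c d e f =
     (a + b) * (c * d - e * f) + (c + d) * (e * f - a * b) + (e + f) * (a * b - c * d)"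

lemma concurrent_lines:
  assumes "line a b t = y" "line c d t = y" "line e f t = y"
  shows "concurrence a b c d e f = 0"
proof -
  have "a * b = (a + b) * t - y" "c * d = (c + d) * t - y" "e * f = (e + f) * t - y"
    using assms by (simp_all add: line_def)
  then show ?thesis unfolding concurrence_def by (simp only:) (simp add: algebra_simps)
qed

lemma concurrence_perms:
  "concurrence a b c d e f = concurrence a b c d f e"
  "concurrence a b c d e f = concurrence e f a b c d"
  "concurrence a b c d e f = concurrence e f a b d c"
  "concurrence a b c d e f = concurrence c d e f a b"
  "concurrence a b c d e f = concurrence c d e f b a"
  by (simp_all add: concurrence_def algebra_simps)

text \<open>The determinant is affine in \<open>f\<close>, and it vanishes identically only if the lines through \<open>a, b\<close> and \<open>c, d\<close> meet
at the point of the parabola over \<open>e\<close> or coincide. The hypotheses exclude both cases.\<close>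

lemma finite_concurrence:
  assumes "a \<noteq> c" "a \<noteq> d" "e \<noteq> c" "e \<noteq> d"
  shows "finite {f. concurrence a b c d e f = 0}"
proof -
  define \<alpha> where "\<alpha> = a * b - c * d - e * (a + b - (c + d))"
  define \<beta> where "\<beta> = (a + b) * (c * d) - (c + d) * (a * b) + e * (a * b - c * d)"
  have eq: "concurrence a b c d e f = \<alpha> * f + \<beta>" for f
    by (simp add: concurrence_def \<alpha>_def \<beta>_def algebra_simps)
  show ?thesis
  proof (cases "\<alpha> = 0")
    case False
    then have "concurrence a b c d e f = 0 \<Longrightarrow> f = - \<beta> / \<alpha>" for f
      using eq by (simp add: field_simps eq_neg_iff_add_eq_0)
    then have "{f. concurrence a b c d e f = 0} \<subseteq> {- \<beta> / \<alpha>}" by blast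
    then show ?thesis by (rule finite_subset) simp
  next
    case True
    have ab: "a * b = c * d + e * (a + b - (c + d))" using True by (simp add: \<alpha>_def)
    have "\<beta> = (a + b - (c + d)) * ((e - c) * (e - d))"
      unfolding \<beta>_def ab by (simp add: algebra_simps)
    moreover have "a + b \<noteq> c + d"
    proof
      assume s: "a + b = c + d"
      then have "a * b = c * d" using ab by simp
      then have "(a - c) * (a - d) = 0" using s by (simp add: algebra_simps) (metis distrib_left)
      then show False using assms by simp
    qed
    ultimately have "\<beta> \<noteq> 0" using assms by simp
    then show ?thesis using eq True by simp
  qed
qed

definition no_three_concurrent :: "(nat \<Rightarrow> real) \<Rightarrow> nat \<Rightarrow> bool" where
  "no_three_concurrent x n \<longleftrightarrow> (\<forall>a b c d e f. distinct [a, b, c, d, e, f] \<and> {a, b, c, d, e, f} \<subseteq> {..<n} \<longrightarrow>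
     concurrence (x a) (x b) (x c) (x d) (x e) (x f) \<noteq> 0)"

text \<open>The abscissas are chosen one after another; each new one has to avoid finitely many values.\<close>

lemma exists_no_three_concurrent: "\<exists>x. strict_mono x \<and> no_three_concurrent x n"
proof (induction n)
  case 0
  have "strict_mono real" by (simp add: strict_mono_def)
  then show ?case by (auto simp: no_three_concurrent_def)
next
  case (Suc n)
  then obtain x where x: "strict_mono x" "no_three_concurrent x n" by blast
  define I where "I = {(a, b, c, d, e). distinct [a, b, c, d, e] \<and> {a, b, c, d, e} \<subseteq> {..<n}}"
  define B where "B = (\<Union>(a, b, c, d, e)\<in>I. {f. concurrence (x a) (x b) (x c) (x d) (x e) f = 0})"
  have "I \<subseteq> {..<n} \<times> {..<n} \<times> {..<n} \<times> {..<n} \<times> {..<n}" by (auto simp: I_def)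
  then have "finite I" by (rule finite_subset) simp
  have inj: "x i = x j \<longleftrightarrow> i = j" for i j using x(1) by (simp add: strict_mono_eq)
  have "finite B" unfolding B_def
    using \<open>finite I\<close> by (intro finite_UN_I) (auto simp: I_def inj intro!: finite_concurrence)
  define y where "y = Max (insert (x n) B) + 1"
  have y: "x n < y" "y \<notin> B"
  proof -
    have "z < y" if "z \<in> insert (x n) B" for z
    proof -
      have "z \<le> Max (insert (x n) B)" using \<open>finite B\<close> that by (intro Max_ge) auto
      then show ?thesis unfolding y_def by linarith
    qed
    then show "x n < y" "y \<notin> B" by auto
  qed
  define x' where "x' i = (if i < n then x i else y + real (i - n))" for i
  have "strict_mono x'"
  proof (rule strict_monoI)
    fix i j :: nat assume "i < j"
    moreover have "x i < y" if "i < n" using y(1) x(1) that by (meson less_trans strict_monoD)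
    moreover have "x i < x j" using x(1) \<open>i < j\<close> by (simp add: strict_monoD)
    ultimately show "x' i < x' j" by (auto simp: x'_def)
  qed
  moreover have "no_three_concurrent x' (Suc n)"
    unfolding no_three_concurrent_def
  proof (intro allI impI)
    have key: "concurrence (x' a) (x' b) (x' c) (x' d) (x' e) (x' n) \<noteq> 0"
      if "distinct [a, b, c, d, e]" "{a, b, c, d, e} \<subseteq> {..<n}" for a b c d e
    proof -
      have "(a, b, c, d, e) \<in> I" using that by (simp add: I_def)
      then have "concurrence (x a) (x b) (x c) (x d) (x e) y \<noteq> 0" using y(2) by (auto simp: B_def)
      then show ?thesis using that(2) by (simp add: x'_def)
    qed
    fix a b c d e f assume h: "distinct [a, b, c, d, e, f] \<and> {a, b, c, d, e, f} \<subseteq> {..<Suc n}"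
    consider "f = n" | "e = n" | "d = n" | "c = n" | "b = n" | "a = n" | "{a, b, c, d, e, f} \<subseteq> {..<n}"
      using h by (auto simp: less_Suc_eq)
    then show "concurrence (x' a) (x' b) (x' c) (x' d) (x' e) (x' f) \<noteq> 0"
    proof cases
      case 1 then show ?thesis using key[of a b c d e] h by (auto simp: less_Suc_eq)
    next
      case 2 then show ?thesis using key[of a b c d f] h by (subst concurrence_perms(1)) (auto simp: less_Suc_eq)
    next
      case 3 then show ?thesis using key[of e f a b c] h by (subst concurrence_perms(2)) (auto simp: less_Suc_eq)
    next
      case 4 then show ?thesis using key[of e f a b d] h by (subst concurrence_perms(3)) (auto simp: less_Suc_eq)
    next
      case 5 then show ?thesis using key[of c d e f a] h by (subst concurrence_perms(4)) (auto simp: less_Suc_eq)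
    next
      case 6 then show ?thesis using key[of c d e f b] h by (subst concurrence_perms(5)) (auto simp: less_Suc_eq)
    next
      case 7
      have "distinct [a, b, c, d, e, f] \<and> {a, b, c, d, e, f} \<subseteq> {..<n} \<longrightarrow>
          concurrence (x a) (x b) (x c) (x d) (x e) (x f) \<noteq> 0"
        using x(2)[unfolded no_three_concurrent_def, THEN spec, THEN spec, THEN spec, THEN spec, THEN spec, THEN spec] .
      with h 7 have "concurrence (x a) (x b) (x c) (x d) (x e) (x f) \<noteq> 0" by simp
      then show ?thesis using 7 by (simp add: x'_def)
    qed
  qed
  ultimately show ?case by blast
qed

lemma affine_image_segment:
  fixes f :: "real \<Rightarrow> 'a::real_vector"
  assumes "a \<le> b" "\<And>t. a \<le> t \<Longrightarrow> t \<le> b \<Longrightarrow> f t = u + t *\<^sub>R v"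
  shows "f ` {a..b} = closed_segment (f a) (f b)"
proof -
  have "f ` {a..b} = (\<lambda>t. u + t *\<^sub>R v) ` closed_segment a b"
    using assms by (auto simp: closed_segment_eq_real_ivl intro!: image_cong)
  also have "\<dots> = (\<lambda>x. u + x) ` (\<lambda>t. t *\<^sub>R v) ` closed_segment a b" by (simp add: image_image)
  also have "\<dots> = (\<lambda>x. u + x) ` closed_segment (a *\<^sub>R v) (b *\<^sub>R v)"
    by (subst closed_segment_linear_image[symmetric]) (simp_all add: linear_scaleR_left)
  also have "\<dots> = closed_segment (u + a *\<^sub>R v) (u + b *\<^sub>R v)"
    by (rule closed_segment_translation[symmetric])
  finally show ?thesis using assms by simp
qed

lemma chord_as_graph:
  assumes "a < b"
  shows "closed_segment (pt a) (pt b) = (\<lambda>t. Complex t (line a b t)) ` {a..b}"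
proof -
  have "(\<lambda>t. Complex t (line a b t)) ` {a..b} = 
      closed_segment (Complex a (line a b a)) (Complex b (line a b b))"
    using assms by (intro affine_image_segment[where u = "Complex 0 (- a * b)" and v = "Complex 1 (a + b)"])
      (auto simp: line_def complex_eq_iff algebra_simps)
  then show ?thesis by (simp add: pt_def)
qed

locale parabola_polygon =
  fixes x :: "nat \<Rightarrow> real" and n :: nat
  assumes mono: "strict_mono x" and n3: "3 \<le> n"
begin

text \<open>\<open>side i\<close> is the affine function that vanishes on the side from \<open>Pt i\<close> to \<open>Pt (nxt i)\<close> and is nonnegative on the
polygon. Its sign has to be reversed for the last side, which lies above the parabola. What matters
about \<open>centre\<close> is that all these functions are positive there.\<close>

definition "Pt i = pt (x i)"
definition "nxt i = (if Suc i < n then Suc i else 0)"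
definition "below a b z = Im z - line a b (Re z)"
definition "side i z = (if Suc i < n then below (x i) (x (Suc i)) z else - below (x 0) (x (n - 1)) z)"
definition "centre = (1 / 3) *\<^sub>R (Pt 0 + Pt 1 + Pt 2)"

lemma x_less: "x i < x j \<longleftrightarrow> i < j"
  using mono by (simp add: strict_mono_less)

lemma x_eq: "x i = x j \<longleftrightarrow> i = j"
  using mono by (simp add: strict_mono_eq)

lemma x_le: "x i \<le> x j \<longleftrightarrow> i \<le> j"
  using mono by (simp add: strict_mono_less_eq)

lemma Pt_eq: "Pt i = Pt j \<longleftrightarrow> i = j"
  by (auto simp: Pt_def pt_def x_eq)

lemma below_pt: "below a b (pt t) = (t - a) * (t - b)"
  by (simp add: below_def pt_def line_def algebra_simps power2_eq_square)

lemma side_affine: "side i ((1 - t) *\<^sub>R z + t *\<^sub>R w) = (1 - t) * side i z + t * side i w"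
  by (simp add: side_def below_def line_def algebra_simps)

lemma side_Pt_nonneg:
  assumes "i < n" "j < n" shows "0 \<le> side i (Pt j)"
proof (cases "Suc i < n")
  case True
  have "0 \<le> (x j - x i) * (x j - x (Suc i))"
  proof (cases "j \<le> i")
    case True
    then have "x j \<le> x i" "x j \<le> x (Suc i)" by (simp_all add: x_le)
    then show ?thesis by (simp add: mult_nonpos_nonpos)
  next
    case False
    then have "x i \<le> x j" "x (Suc i) \<le> x j" by (simp_all add: x_le)
    then show ?thesis by simp
  qed
  then show ?thesis using True by (simp add: side_def Pt_def below_pt)
next
  case False
  have "x 0 \<le> x j" "x j \<le> x (n - 1)" using assms by (simp_all add: x_le)
  then have "(x j - x 0) * (x j - x (n - 1)) \<le> 0" by (simp add: mult_nonneg_nonpos)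
  then show ?thesis using False by (simp add: side_def Pt_def below_pt)
qed

lemma side_Pt_zero:
  assumes "i < n" "j < n" shows "side i (Pt j) = 0 \<longleftrightarrow> j = i \<or> j = nxt i"
proof (cases "Suc i < n")
  case True
  then show ?thesis by (simp add: side_def Pt_def below_pt nxt_def x_eq)
next
  case False
  then have "i = n - 1" using assms by simp
  then show ?thesis using False by (auto simp: side_def Pt_def below_pt nxt_def x_eq)
qed

lemma side_Pt_pos: "i < n \<Longrightarrow> j < n \<Longrightarrow> j \<noteq> i \<Longrightarrow> j \<noteq> nxt i \<Longrightarrow> 0 < side i (Pt j)"
  using side_Pt_nonneg side_Pt_zero by (metis less_eq_real_def)

lemma nxt_less: "nxt i < n"
  using n3 by (simp add: nxt_def)

lemma nxt_neq: "i < n \<Longrightarrow> nxt i \<noteq> i" "i < n \<Longrightarrow> nxt (nxt i) \<noteq> i"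
  using n3 by (auto simp: nxt_def)

lemma nxt_surj: assumes "i < n" obtains j where "j < n" "nxt j = i"
proof (cases i)
  case 0
  then have "n - 1 < n" "nxt (n - 1) = i" using n3 by (auto simp: nxt_def)
  then show thesis using that by blast
next
  case (Suc j)
  then have "j < n" "nxt j = i" using assms by (auto simp: nxt_def)
  then show thesis using that by blast
qed

lemma side_centre: assumes "i < n" shows "0 < side i centre"
proof -
  have "side i centre = (side i (Pt 0) + side i (Pt 1) + side i (Pt 2)) / 3"
    unfolding centre_def by (simp add: side_def below_def line_def) (simp add: field_simps)
  moreover have "0 \<le> side i (Pt 0)" "0 \<le> side i (Pt 1)" "0 \<le> side i (Pt 2)"
    using assms n3 by (auto intro!: side_Pt_nonneg)
  moreover have "side i (Pt 0) \<noteq> 0 \<or> side i (Pt 1) \<noteq> 0 \<or> side i (Pt 2) \<noteq> 0"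
    using assms n3 side_Pt_zero[of i 0] side_Pt_zero[of i 1] side_Pt_zero[of i 2] by auto
  moreover have "0 < (a + b + c) / 3" if "0 \<le> a" "0 \<le> b" "0 \<le> c" "a \<noteq> 0 \<or> b \<noteq> 0 \<or> c \<noteq> 0" for a b c :: real
    using that by auto
  ultimately show ?thesis by presburger
qed

text \<open>\<open>slope i\<close> is the linear part of \<open>side i\<close>, and \<open>gauge_fn\<close> is the gauge of the translate of the polygon
by \<open>- centre\<close>.\<close>

definition "slope i z = side i (centre + z) - side i centre"
definition "gauge_fn z = Max ((\<lambda>i. - slope i z / side i centre) ` {..<n})"

lemma slope_eq: "slope i z = (if Suc i < n then Im z - (x i + x (Suc i)) * Re z
    else - (Im z - (x 0 + x (n - 1)) * Re z))"
  by (simp add: slope_def side_def below_def line_def algebra_simps)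

text \<open>Every ray from the centre leaves the polygon: depending on the sign of the real part of the direction, the slope of the last side
conflicts with that of the first or of the last but one. For a vertical direction
the slopes of the first and the last side have opposite signs.\<close>

lemma slope_neg_ex: assumes "z \<noteq> 0" shows "\<exists>i<n. slope i z < 0"
proof (rule ccontr)
  assume "\<not> ?thesis"
  then have nn: "\<And>i. i < n \<Longrightarrow> 0 \<le> slope i z" by force
  have s0: "0 \<le> Im z - (x 0 + x 1) * Re z" using nn[of 0] n3 by (simp add: slope_eq)
  have s1: "0 \<le> Im z - (x (n - 2) + x (n - 1)) * Re z"
  proof -
    have "Suc (n - 2) = n - 1" using n3 by simp
    then show ?thesis using nn[of "n - 2"] n3 by (simp add: slope_eq)
  qed
  have s2: "0 \<le> - (Im z - (x 0 + x (n - 1)) * Re z)" using nn[of "n - 1"] n3 by (simp add: slope_eq)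
  have "x 1 < x (n - 1)" "x 0 < x (n - 2)" using n3 by (simp_all add: x_less)
  moreover have "(x (n - 2) - x 0) * Re z \<le> 0" "0 \<le> (x (n - 1) - x 1) * Re z"
    using s0 s1 s2 by (simp_all add: algebra_simps)
  ultimately have "Re z = 0" by (simp add: mult_le_0_iff zero_le_mult_iff)
  then show False using s0 s2 assms by (simp add: complex_eq_iff)
qed

lemma continuous_slope: "continuous_on UNIV (slope i)"
  unfolding slope_eq by (cases "Suc i < n") (auto intro!: continuous_intros)

sublocale gauge gauge_fn
proof
  have ne: "{..<n} \<noteq> {}" using n3 by (auto simp: lessThan_empty_iff)
  show "continuous_on UNIV gauge_fn" unfolding gauge_fn_def
    by (intro continuous_on_Max_image ne continuous_intros continuous_slope) (auto dest: side_centre)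
  show "gauge_fn (t *\<^sub>R z) = t * gauge_fn z" if "0 \<le> t" for t z
  proof -
    have "mono (\<lambda>y. t * y)" using that by (auto simp: mono_def mult_left_mono)
    then have "t * Max ((\<lambda>i. - slope i z / side i centre) ` {..<n}) =
        Max ((\<lambda>y. t * y) ` (\<lambda>i. - slope i z / side i centre) ` {..<n})"
      using ne by (intro mono_Max_commute) auto
    also have "(\<lambda>y. t * y) ` (\<lambda>i. - slope i z / side i centre) ` {..<n} =
        (\<lambda>i. - slope i (t *\<^sub>R z) / side i centre) ` {..<n}"
      unfolding image_image by (intro image_cong) (auto simp: slope_eq algebra_simps)
    finally show ?thesis by (simp add: gauge_fn_def)
  qed
  show "0 < gauge_fn z" if "z \<noteq> 0" for z
  proof -
    obtain i where i: "i < n" "slope i z < 0" using slope_neg_ex \<open>z \<noteq> 0\<close> by blast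
    then have "0 < - slope i z / side i centre" using side_centre[OF i(1)] by (simp add: divide_neg_pos)
    then show ?thesis using i ne unfolding gauge_fn_def by (subst Max_gr_iff) auto
  qed
qed

lemma gauge_fn_shift: "gauge_fn (z - centre) = Max ((\<lambda>i. 1 - side i z / side i centre) ` {..<n})"
proof -
  have "- slope i (z - centre) / side i centre = 1 - side i z / side i centre" if "i < n" for i
    using side_centre[OF that] by (simp add: slope_def field_simps)
  then show ?thesis unfolding gauge_fn_def by (intro arg_cong[of _ _ Max] image_cong) auto
qed

definition "polygon = {z. gauge_fn (z - centre) = 1}"

lemma gauge_less_one: "gauge_fn (z - centre) < 1 \<longleftrightarrow> (\<forall>i<n. 0 < side i z)"
proof -
  have ne: "{..<n} \<noteq> {}" using n3 by (auto simp: lessThan_empty_iff)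
  have "gauge_fn (z - centre) < 1 \<longleftrightarrow> (\<forall>i<n. 1 - side i z / side i centre < 1)"
    unfolding gauge_fn_shift using ne by (subst Max_less_iff) auto
  also have "\<dots> \<longleftrightarrow> (\<forall>i<n. 0 < side i z)"
  proof -
    have "1 - side i z / side i centre < 1 \<longleftrightarrow> 0 < side i z" if "i < n" for i
      using side_centre[OF that] by (auto simp: zero_less_divide_iff)
    then show ?thesis by simp
  qed
  finally show ?thesis .
qed

lemma polygon_iff: "z \<in> polygon \<longleftrightarrow> (\<forall>i<n. 0 \<le> side i z) \<and> (\<exists>i<n. side i z = 0)"
proof -
  have ne: "{..<n} \<noteq> {}" using n3 by (auto simp: lessThan_empty_iff)
  have divide: "1 - side i z / side i centre \<le> 1 \<longleftrightarrow> 0 \<le> side i z" if "i < n" for i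
    using side_centre[OF that] by (auto simp: zero_le_divide_iff)
  have "gauge_fn (z - centre) \<le> 1 \<longleftrightarrow> (\<forall>i<n. 1 - side i z / side i centre \<le> 1)"
    unfolding gauge_fn_shift using ne by (subst Max_le_iff) auto
  also have "\<dots> \<longleftrightarrow> (\<forall>i<n. 0 \<le> side i z)"
    using divide by simp
  finally have le: "gauge_fn (z - centre) \<le> 1 \<longleftrightarrow> (\<forall>i<n. 0 \<le> side i z)" .
  have "z \<in> polygon \<longleftrightarrow> gauge_fn (z - centre) \<le> 1 \<and> \<not> gauge_fn (z - centre) < 1"
    by (auto simp: polygon_def)
  then show ?thesis unfolding le gauge_less_one by force
qed

lemma sides_pos_inside: "(\<And>i. i < n \<Longrightarrow> 0 < side i z) \<Longrightarrow> z \<in> inside polygon"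
  using sublevel_subset_inside[of z centre] gauge_less_one[of z] by (simp add: polygon_def)

lemma Pt_combination:
  assumes "i \<noteq> j" "Im z = line (x i) (x j) (Re z)"
  shows "z = (1 - (Re z - x i) / (x j - x i)) *\<^sub>R Pt i + ((Re z - x i) / (x j - x i)) *\<^sub>R Pt j"
proof -
  define s where "s = (Re z - x i) / (x j - x i)"
  have "x j - x i \<noteq> 0" using assms(1) by (simp add: x_eq)
  then have s: "s * (x j - x i) = Re z - x i" by (simp add: s_def)
  have "(1 - s) * x i + s * x j = x i + s * (x j - x i)" by (simp add: algebra_simps)
  also have "\<dots> = Re z" using s by simp
  finally have re: "(1 - s) * x i + s * x j = Re z" .
  have "(1 - s) * (x i)\<^sup>2 + s * (x j)\<^sup>2 = (x i)\<^sup>2 + (s * (x j - x i)) * (x i + x j)"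
    by (simp add: algebra_simps power2_eq_square)
  also have "\<dots> = Im z" unfolding s assms(2) line_def by (simp add: algebra_simps power2_eq_square)
  finally have "(1 - s) * (x i)\<^sup>2 + s * (x j)\<^sup>2 = Im z" .
  with re have "z = (1 - s) *\<^sub>R Pt i + s *\<^sub>R Pt j" by (simp add: complex_eq_iff Pt_def pt_def)
  then show ?thesis by (simp only: s_def)
qed

lemma polygon_eq: "polygon = (\<Union>i<n. closed_segment (Pt i) (Pt (nxt i)))"
proof
  show "(\<Union>i<n. closed_segment (Pt i) (Pt (nxt i))) \<subseteq> polygon"
  proof clarify
    fix i z assume i: "i < n" and "z \<in> closed_segment (Pt i) (Pt (nxt i))"
    then obtain t where t: "0 \<le> t" "t \<le> 1" "z = (1 - t) *\<^sub>R Pt i + t *\<^sub>R Pt (nxt i)"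
      by (auto simp: in_segment)
    have "0 \<le> side j z" if "j < n" for j
      unfolding t(3) side_affine using side_Pt_nonneg that i nxt_less t(1,2) by simp
    moreover have "side i z = 0"
      unfolding t(3) side_affine using side_Pt_zero[of i i] side_Pt_zero[of i "nxt i"] i nxt_less by simp
    ultimately show "z \<in> polygon" using i polygon_iff by blast
  qed
  show "polygon \<subseteq> (\<Union>i<n. closed_segment (Pt i) (Pt (nxt i)))"
  proof
    fix z assume "z \<in> polygon"
    then obtain i where i: "i < n" "side i z = 0" and nn: "\<And>j. j < n \<Longrightarrow> 0 \<le> side j z"
      using polygon_iff by blast
    have "Im z = line (x i) (x (nxt i)) (Re z)"
    proof (cases "Suc i < n")
      case True then show ?thesis using i by (simp add: side_def below_def nxt_def)
    next
      case False
      then have "i = n - 1" using i by simp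
      then show ?thesis using i False by (simp add: side_def below_def nxt_def line_commute)
    qed
    moreover define s where "s = (Re z - x i) / (x (nxt i) - x i)"
    ultimately have z: "z = (1 - s) *\<^sub>R Pt i + s *\<^sub>R Pt (nxt i)"
      using Pt_combination[of i "nxt i" z] nxt_neq(1)[OF i(1)] by simp
    obtain j where j: "j < n" "nxt j = i" using nxt_surj i(1) by blast
    have "side j z = s * side j (Pt (nxt i))"
      unfolding z side_affine using side_Pt_zero[of j i] i j by simp
    moreover have "0 < side j (Pt (nxt i))"
      using j nxt_less nxt_neq[of j] nxt_neq[OF i(1)] by (intro side_Pt_pos) auto
    ultimately have "0 \<le> s" using nn[OF j(1)] by (simp add: zero_le_mult_iff)
    have "side (nxt i) z = (1 - s) * side (nxt i) (Pt i)"
      unfolding z side_affine using side_Pt_zero[of "nxt i" "nxt i"] nxt_less by simp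
    moreover have "0 < side (nxt i) (Pt i)"
      using i nxt_less nxt_neq[OF i(1)] by (intro side_Pt_pos) auto
    ultimately have "s \<le> 1" using nn[OF nxt_less, of i] by (simp add: zero_le_mult_iff)
    then have "z \<in> closed_segment (Pt i) (Pt (nxt i))"
      using \<open>0 \<le> s\<close> z by (auto simp: in_segment)
    then show "z \<in> (\<Union>i<n. closed_segment (Pt i) (Pt (nxt i)))" using i(1) by blast
  qed
qed

lemma unknotted_polygon: "unknotted (to_S3 ` (polygon \<times> {0}))"
proof -
  have "polygon \<times> {0} = {(z, 0 :: real) | z. gauge_fn (z - centre) = 1}" by (auto simp: polygon_def)
  then show ?thesis using unknotted_unit_level[of centre] by simp
qed

end

section \<open>A drawing with few levels\<close>

definition interleaved :: "nat \<Rightarrow> nat \<Rightarrow> nat \<Rightarrow> nat \<Rightarrow> bool" where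
  "interleaved u v u' v' \<longleftrightarrow> u < u' \<and> u' < v \<and> v < v'"

text \<open>If every fragment above level $1$ crosses over one that lies exactly one level below, and only over lower ones, the level of a fragment is one more than the maximal level
of the fragments that it crosses over, which is the recursive description of the levels.\<close>

lemma level_partitionI:
  assumes rng: "\<And>A. A \<in> \<F> \<Longrightarrow> lv A \<in> {1..m}"
    and irr: "\<And>A. A \<in> \<F> \<Longrightarrow> \<not> crosses_over A A"
    and down: "\<And>A B. A \<in> \<F> \<Longrightarrow> B \<in> \<F> \<Longrightarrow> B \<noteq> A \<Longrightarrow> crosses_over A B \<Longrightarrow> lv B < lv A"
    and next_lower: "\<And>A. A \<in> \<F> \<Longrightarrow> 2 \<le> lv A \<Longrightarrow> \<exists>B\<in>\<F>. crosses_over A B \<and> lv B = lv A - 1"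
    and nonempty: "\<And>i. i \<in> {1..m} \<Longrightarrow> \<exists>A\<in>\<F>. lv A = i"
  shows "level_partition \<F> m (\<lambda>i. {A \<in> \<F>. lv A = i})"
  unfolding level_partition_def
proof (intro conjI impI ballI)
  show "(\<Union>i\<in>{1..m}. {A \<in> \<F>. lv A = i}) = \<F>" using rng by auto
  show "disjoint_family_on (\<lambda>i. {A \<in> \<F>. lv A = i}) {1..m}" by (auto simp: disjoint_family_on_def)
  show "{A \<in> \<F>. lv A = i} \<noteq> {}" if "i \<in> {1..m}" for i using nonempty[OF that] by blast
  have low: "\<exists>B\<in>\<F>. B \<noteq> A \<and> crosses_over A B \<and> lv B = lv A - 1" if "A \<in> \<F>" "2 \<le> lv A" for A
  proof -
    obtain B where "B \<in> \<F>" "crosses_over A B" "lv B = lv A - 1" using next_lower[OF \<open>A \<in> \<F>\<close> \<open>2 \<le> lv A\<close>] by blast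
    moreover have "B \<noteq> A" using calculation that by auto
    ultimately show ?thesis by blast
  qed
  show "{A \<in> \<F>. lv A = 1} = {A \<in> \<F>. \<forall>B\<in>\<F>. B \<noteq> A \<longrightarrow> \<not> crosses_over A B}"
  proof (intro Collect_cong conj_cong refl iffI)
    fix A assume A: "A \<in> \<F>"
    show "\<forall>B\<in>\<F>. B \<noteq> A \<longrightarrow> \<not> crosses_over A B" if "lv A = 1"
      using down[OF A] rng that by fastforce
    show "lv A = 1" if "\<forall>B\<in>\<F>. B \<noteq> A \<longrightarrow> \<not> crosses_over A B"
    proof (rule ccontr)
      assume "lv A \<noteq> 1"
      then have "2 \<le> lv A" using rng[OF A] by simp
      then show False using low[OF A] that by blast
    qed
  qed
  fix i assume i: "i \<in> {2..m}"
  show "{A \<in> \<F>. lv A = i} = {A \<in> \<F>. (\<exists>B\<in>{A \<in> \<F>. lv A = i - 1}. crosses_over A B) \<and>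
        (\<forall>B\<in>\<F>. B \<noteq> A \<and> crosses_over A B \<longrightarrow> (\<exists>k\<in>{1..<i}. B \<in> {A \<in> \<F>. lv A = k}))}"
  proof (intro Collect_cong conj_cong refl iffI)
    fix A assume A: "A \<in> \<F>"
    show "(\<exists>B\<in>{A \<in> \<F>. lv A = i - 1}. crosses_over A B) \<and>
        (\<forall>B\<in>\<F>. B \<noteq> A \<and> crosses_over A B \<longrightarrow> (\<exists>k\<in>{1..<i}. B \<in> {A \<in> \<F>. lv A = k}))"
      if Ai: "lv A = i"
    proof
      show "\<exists>B\<in>{A \<in> \<F>. lv A = i - 1}. crosses_over A B"
        using low[OF A] i Ai by auto
      show "\<forall>B\<in>\<F>. B \<noteq> A \<and> crosses_over A B \<longrightarrow> (\<exists>k\<in>{1..<i}. B \<in> {A \<in> \<F>. lv A = k})"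
        using down[OF A] rng Ai by fastforce
    qed
    show "lv A = i" if h: "(\<exists>B\<in>{A \<in> \<F>. lv A = i - 1}. crosses_over A B) \<and>
        (\<forall>B\<in>\<F>. B \<noteq> A \<and> crosses_over A B \<longrightarrow> (\<exists>k\<in>{1..<i}. B \<in> {A \<in> \<F>. lv A = k}))"
    proof -
      obtain B where B: "B \<in> \<F>" "lv B = i - 1" "crosses_over A B" using h by blast
      have "B \<noteq> A" using irr[OF A] B(3) by auto
      then have "i \<le> lv A" using down[OF A B(1) _ B(3)] B(2) i by auto
      moreover have "lv A \<le> i"
      proof (rule ccontr)
        assume "\<not> lv A \<le> i"
        then obtain B' where B': "B' \<in> \<F>" "B' \<noteq> A" "crosses_over A B'" "lv B' = lv A - 1"
          using low[OF A] i by fastforce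
        then obtain k where "k \<in> {1..<i}" "lv B' = k" using h by blast
        then show False using B'(4) \<open>\<not> lv A \<le> i\<close> by auto
      qed
      ultimately show ?thesis by simp
    qed
  qed
qed

text \<open>The sums of two interleaved pairs differ by at least $2$ and at most $n - 2$, whereas residues with the same half differ by
at most $1$, and the corresponding sums therefore by at most $1$ modulo \<open>n\<close>.\<close>

lemma interleaved_sums_mod:
  assumes "interleaved u v u' v'" "v' < n"
  shows "((u + v) mod n) div 2 \<noteq> ((u' + v') mod n) div 2"
proof -
  define d where "d = (u' + v') - (u + v)"
  have d: "u' + v' = u + v + d" "2 \<le> d" "d + 2 \<le> n" using assms by (auto simp: interleaved_def d_def)
  define r where "r = (u + v) mod n"
  have r: "r < n" using assms by (simp add: r_def)
  have eq: "(u' + v') mod n = (r + d) mod n" unfolding d(1) r_def by presburger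
  show ?thesis
  proof (cases "r + d < n")
    case True
    then have "(u' + v') mod n = r + d" using eq by simp
    then show ?thesis using d(2) by (simp add: r_def[symmetric])
  next
    case False
    then have "(r + d) mod n = r + d - n" using r d by (simp add: mod_if le_mod_geq)
    then have "(u' + v') mod n + 2 \<le> r" using eq d False by simp
    moreover have "q + 2 \<le> r \<Longrightarrow> r div 2 \<noteq> q div 2" for q r :: nat by presburger
    ultimately show ?thesis unfolding r_def[symmetric] by blast
  qed
qed


text \<open>A chord rises from its ends along a horizontal distance of \<open>\<delta>\<close> to its layer and stays there. All crossings are
to lie over the horizontal parts; \<open>crossing_gap\<close> says so for the later of the two starting points and the earlier of the two
end points of an interleaved pair, which implies the same for the other two ends.\<close>

locale convex_drawing = parabola_polygon +
  fixes \<delta> :: real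
  assumes delta_pos: "0 < \<delta>"
    and gap: "\<And>u v. u < v \<Longrightarrow> v < n \<Longrightarrow> 2 * \<delta> < x v - x u"
    and crossing_gap: "\<And>u v u' v' t. interleaved u v u' v' \<Longrightarrow> v' < n \<Longrightarrow>
      line (x u) (x v) t = line (x u') (x v') t \<Longrightarrow> x u' < t \<Longrightarrow> t < x v \<Longrightarrow>
      x u' + \<delta> < t \<and> t < x v - \<delta>"
    and generic: "no_three_concurrent x n"
begin

text \<open>Layer \<open>0\<close> consists of the sides of the polygon.\<close>

definition layer :: "nat \<Rightarrow> nat \<Rightarrow> nat" where
  "layer u v = (if v = Suc u \<or> u = 0 \<and> v = n - 1 then 0 else Suc (((u + v) mod n) div 2))"

definition height :: "nat \<Rightarrow> nat \<Rightarrow> real \<Rightarrow> real" where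
  "height u v t = real (layer u v) * min 1 (min ((t - x u) / \<delta>) ((x v - t) / \<delta>))"

definition strand :: "nat \<Rightarrow> nat \<Rightarrow> real \<Rightarrow> space3" where
  "strand u v t = (Complex t (line (x u) (x v) t), height u v t)"

definition seg :: "nat \<Rightarrow> nat \<Rightarrow> space3 set" where
  "seg u v = strand u v ` {x u..x v}"

definition layered_drawing :: "(nat, space3) drawing" where
  "layered_drawing = \<lparr>vpos = \<lambda>v. (Pt v, 0), earc = \<lambda>e. seg (Min e) (Max e)\<rparr>"

lemma vpos_layered [simp]: "vpos layered_drawing v = (Pt v, 0)"
  by (simp add: layered_drawing_def)

lemma earc_layered [simp]: "u < v \<Longrightarrow> earc layered_drawing {u, v} = seg u v"
  by (simp add: layered_drawing_def)

lemma edgeE: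
  assumes "e \<in> edges (complete_graph n)"
  obtains u v where "e = {u, v}" "u < v" "v < n" "earc layered_drawing e = seg u v"
proof -
  obtain a b where ab: "e = {a, b}" "a < n" "b < n" "a \<noteq> b" using assms complete_graph_edgeE by blast
  show thesis
  proof (cases "a < b")
    case True then show thesis using that[of a b] ab by simp
  next
    case False
    then have "e = {b, a}" "b < a" using ab by auto
    then show thesis using that[of b a] ab by simp
  qed
qed

lemma strand_ends: "u < v \<Longrightarrow> v < n \<Longrightarrow> strand u v (x u) = (Pt u, 0)"
  "u < v \<Longrightarrow> v < n \<Longrightarrow> strand u v (x v) = (Pt v, 0)"
  using gap[of u v] delta_pos by (auto simp: strand_def height_def Pt_def pt_def min_def divide_simps)

lemma height_plateau: "x u + \<delta> \<le> t \<Longrightarrow> t \<le> x v - \<delta> \<Longrightarrow> height u v t = real (layer u v)"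
  using delta_pos by (simp add: height_def min_def divide_simps)

lemma fst_strand_eq: "fst (strand u v t) = fst (strand u' v' t') \<longleftrightarrow> t = t' \<and> line (x u) (x v) t = line (x u') (x v') t'"
  by (auto simp: strand_def)

lemma inj_fst_seg: "inj_on fst (seg u v)"
  by (auto simp: seg_def inj_on_def fst_strand_eq)

lemma continuous_strand: "continuous_on S (strand u v)"
  unfolding strand_def height_def line_def Complex_eq
  using delta_pos by (intro continuous_intros) auto

lemma compact_seg: "compact (seg u v)"
  unfolding seg_def by (intro compact_continuous_image continuous_strand) auto

lemma seg_arc:
  assumes "u < v" "v < n"
  shows "\<exists>\<gamma>. arc \<gamma> \<and> path_image \<gamma> = seg u v \<and> pathstart \<gamma> = (Pt u, 0) \<and> pathfinish \<gamma> = (Pt v, 0)"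
proof -
  define h where "h s = x u + s * (x v - x u)" for s
  have d: "0 < x v - x u" using assms by (simp add: x_less)
  have "h ` {0..1} = {x u..x v}"
  proof
    show "h ` {0..1} \<subseteq> {x u..x v}"
    proof clarify
      fix s :: real assume "s \<in> {0..1}"
      then have "0 \<le> s * (x v - x u)" "s * (x v - x u) \<le> 1 * (x v - x u)"
        using d by (auto intro!: mult_right_mono)
      then show "h s \<in> {x u..x v}" by (simp add: h_def)
    qed
    show "{x u..x v} \<subseteq> h ` {0..1}"
    proof
      fix t assume "t \<in> {x u..x v}"
      then have "t = h ((t - x u) / (x v - x u))" "(t - x u) / (x v - x u) \<in> {0..1}"
        using d by (auto simp: h_def divide_simps)
      then show "t \<in> h ` {0..1}" by (rule image_eqI)
    qed
  qed
  then have "path_image (strand u v \<circ> h) = seg u v"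
    by (simp only: path_image_def seg_def image_comp[symmetric])
  moreover have "continuous_on {0..1} h" unfolding h_def by (intro continuous_intros)
  then have "path (strand u v \<circ> h)" unfolding path_def
    by (intro continuous_on_compose continuous_strand)
  moreover have "inj_on (strand u v \<circ> h) {0..1}"
    using d by (auto simp: inj_on_def strand_def h_def)
  moreover have "h 0 = x u" "h 1 = x v" by (simp_all add: h_def)
  ultimately show ?thesis using strand_ends[OF assms]
    by (intro exI[of _ "strand u v \<circ> h"]) (auto simp: arc_def pathstart_def pathfinish_def)
qed

lemma polygonal_seg:
  assumes "u < v" "v < n"
  shows "polygonal (seg u v)"
proof -
  let ?l = "real (layer u v)" and ?a = "x u" and ?b = "x v"
  have g: "2 * \<delta> < ?b - ?a" using gap[OF assms] .
  have b: "?a + \<delta> \<le> ?b" using g delta_pos by simp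
  let ?base = "Complex 0 (- (?a * ?b))" and ?dir = "Complex 1 (?a + ?b)"
  have 1: "strand u v ` {?a..?a + \<delta>} = closed_segment (strand u v ?a) (strand u v (?a + \<delta>))"
  proof (rule affine_image_segment)
    show "strand u v t = (?base, - (?l * ?a / \<delta>)) + t *\<^sub>R (?dir, ?l / \<delta>)" if "?a \<le> t" "t \<le> ?a + \<delta>" for t
    proof -
      have "height u v t = ?l * ((t - ?a) / \<delta>)"
        unfolding height_def using that g delta_pos by (simp add: min_def divide_simps)
      then show ?thesis by (simp add: strand_def line_def complex_eq_iff algebra_simps diff_divide_distrib)
    qed
  qed (use delta_pos in simp)
  have 2: "strand u v ` {?a + \<delta>..?b - \<delta>} = closed_segment (strand u v (?a + \<delta>)) (strand u v (?b - \<delta>))"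
  proof (rule affine_image_segment)
    show "strand u v t = (?base, ?l) + t *\<^sub>R (?dir, 0)" if "?a + \<delta> \<le> t" "t \<le> ?b - \<delta>" for t
      using height_plateau[OF that] by (simp add: strand_def line_def complex_eq_iff algebra_simps)
  qed (use g in simp)
  have 3: "strand u v ` {?b - \<delta>..?b} = closed_segment (strand u v (?b - \<delta>)) (strand u v ?b)"
  proof (rule affine_image_segment)
    show "strand u v t = (?base, ?l * ?b / \<delta>) + t *\<^sub>R (?dir, - (?l / \<delta>))" if "?b - \<delta> \<le> t" "t \<le> ?b" for t
    proof -
      have "height u v t = ?l * ((?b - t) / \<delta>)"
        unfolding height_def using that g delta_pos by (simp add: min_def divide_simps)
      then show ?thesis by (simp add: strand_def line_def complex_eq_iff algebra_simps diff_divide_distrib)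
    qed
  qed (use delta_pos in simp)
  have "{?a..?b} = {?a..?a + \<delta>} \<union> {?a + \<delta>..?b - \<delta>} \<union> {?b - \<delta>..?b}" using g delta_pos by auto
  then have "seg u v = closed_segment (strand u v ?a) (strand u v (?a + \<delta>)) \<union>
      closed_segment (strand u v (?a + \<delta>)) (strand u v (?b - \<delta>)) \<union>
      closed_segment (strand u v (?b - \<delta>)) (strand u v ?b)"
    unfolding seg_def by (simp only: image_Un 1 2 3)
  then show ?thesis unfolding polygonal_def
    by (intro exI[of _ "{(strand u v ?a, strand u v (?a + \<delta>)), (strand u v (?a + \<delta>), strand u v (?b - \<delta>)),
      (strand u v (?b - \<delta>), strand u v ?b)}"]) auto
qed

lemma interleaved_levels:
  assumes "interleaved u v u' v'" "v' < n"
  shows "0 < layer u v" "0 < layer u' v'" "layer u v \<noteq> layer u' v'"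
  using assms interleaved_sums_mod[OF assms] by (auto simp: interleaved_def layer_def)

text \<open>Chords of a parabola with a common end meet only there, since they have different slopes. Chords with four different ends meet only if these
are interleaved: otherwise their abscissas form disjoint intervals, or one chord lies strictly above the other.\<close>

lemma strands_meet:
  assumes uv: "u < v" "v < n" "u' < v'" "v' < n" "(u, v) \<noteq> (u', v')"
    and t: "t \<in> {x u..x v}" "t \<in> {x u'..x v'}" "line (x u) (x v) t = line (x u') (x v') t"
  shows "(\<exists>w\<in>{u, v} \<inter> {u', v'}. t = x w) \<or>
    {u, v} \<inter> {u', v'} = {} \<and> (interleaved u v u' v' \<or> interleaved u' v' u v) \<and>
    x u + \<delta> < t \<and> t < x v - \<delta> \<and> x u' + \<delta> < t \<and> t < x v' - \<delta>"
proof (cases "{u, v} \<inter> {u', v'} = {}")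
  case False
  then consider "u = u'" "v \<noteq> v'" | "u = v'" | "v = u'" | "v = v'" "u \<noteq> u'"
    using uv by auto
  then show ?thesis
  proof cases
    case 1
    then have "line (x u) (x v) t = line (x u) (x v') t" using t(3) by simp
    then have "t = x u" using 1 lines_through_common_point[of "x u" "x v" t "x v'"] by (simp add: x_eq)
    then show ?thesis using 1 by simp
  next
    case 2
    then have "t = x u" using t(1,2) by simp
    then show ?thesis using 2 by simp
  next
    case 3
    then have "t = x v" using t(1,2) by simp
    then show ?thesis using 3 by simp
  next
    case 4
    then have "line (x v) (x u) t = line (x v) (x u') t" using t(3) line_commute by metis
    then have "t = x v" using 4 lines_through_common_point[of "x v" "x u" t "x u'"] by (simp add: x_eq)
    then show ?thesis using 4(1) by (intro disjI1 bexI[of _ v]) auto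
  qed
next
  case True
  have main: "interleaved u v u' v' \<and> x u + \<delta> < t \<and> t < x v - \<delta> \<and> x u' + \<delta> < t \<and> t < x v' - \<delta>"
    if uv: "u < v" "v < n" "u' < v'" "v' < n" and t: "t \<in> {x u..x v}" "t \<in> {x u'..x v'}"
      "line (x u) (x v) t = line (x u') (x v') t" and True: "{u, v} \<inter> {u', v'} = {}" and "u < u'" for u v u' v'
  proof -
    have "x u' < t \<and> t < x v \<and> x v < x v'"
    proof -
      have o: "x u < x v" "x u' < x v'" "x u \<noteq> x u'" "x u \<noteq> x v'" "x v \<noteq> x u'" "x v \<noteq> x v'" "x u < x u'"
        using uv True \<open>u < u'\<close> by (auto simp: x_less x_eq)
      then show ?thesis using common_point_interleaved[OF o(1,2) _ _ _ _ t(3) o(3-7)] t(1,2) by (simp add: x_less)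
    qed
    moreover from this have "x u' < x v" by simp
    ultimately have il: "interleaved u v u' v'" "x u' < t" "t < x v" "x v < x v'" "x u < x u'"
      using \<open>u < u'\<close> by (auto simp: interleaved_def x_less)
    then show ?thesis using crossing_gap[OF il(1) uv(4) t(3) il(2,3)] by linarith
  qed
  show ?thesis
  proof (cases "u < u'")
    case True': True
    then show ?thesis using main[OF uv(1-4) t True] True by blast
  next
    case False
    then have "u' < u" using True by auto
    moreover have "{u', v'} \<inter> {u, v} = {}" using True by auto
    ultimately show ?thesis using main[OF uv(3,4,1,2) t(2,1) t(3)[symmetric]] True by blast
  qed
qed

lemma seg_meet:
  assumes uv: "u < v" "v < n" "u' < v'" "v' < n" "(u, v) \<noteq> (u', v')"
    and ab: "a \<in> seg u v" "b \<in> seg u' v'" "fst a = fst b"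
  obtains (vertex) w where "w \<in> {u, v} \<inter> {u', v'}" "a = (Pt w, 0)" "b = (Pt w, 0)"
  | (crossing) t where "{u, v} \<inter> {u', v'} = {}" "interleaved u v u' v' \<or> interleaved u' v' u v"
    "x u + \<delta> < t" "t < x v - \<delta>" "x u' + \<delta> < t" "t < x v' - \<delta>"
    "line (x u) (x v) t = line (x u') (x v') t" "a = strand u v t" "b = strand u' v' t"
    "snd a = real (layer u v)" "snd b = real (layer u' v')" "layer u v \<noteq> layer u' v'" "0 < layer u v" "0 < layer u' v'"
proof -
  obtain t t' where p: "t \<in> {x u..x v}" "a = strand u v t" "t' \<in> {x u'..x v'}" "b = strand u' v' t'"
    using ab by (auto simp: seg_def)
  then have "fst (strand u v t) = fst (strand u' v' t')" using ab(3) by simp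
  then have e: "t = t'" "line (x u) (x v) t = line (x u') (x v') t'" unfolding fst_strand_eq by blast+
  with p have t: "t \<in> {x u..x v}" "t \<in> {x u'..x v'}" "line (x u) (x v) t = line (x u') (x v') t"
    and a: "a = strand u v t" and b: "b = strand u' v' t" by simp_all
  from strands_meet[OF uv t] show thesis
  proof
    assume "\<exists>w\<in>{u, v} \<inter> {u', v'}. t = x w"
    then obtain w where w: "w \<in> {u, v} \<inter> {u', v'}" "t = x w" by blast
    then have "a = (Pt w, 0)" "b = (Pt w, 0)"
      unfolding a b using strand_ends[OF uv(1,2)] strand_ends[OF uv(3,4)] by auto
    then show thesis using vertex w(1) by blast
  next
    assume c: "{u, v} \<inter> {u', v'} = {} \<and> (interleaved u v u' v' \<or> interleaved u' v' u v) \<and>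
      x u + \<delta> < t \<and> t < x v - \<delta> \<and> x u' + \<delta> < t \<and> t < x v' - \<delta>"
    have "snd a = real (layer u v)" "snd b = real (layer u' v')"
      unfolding a b strand_def snd_conv using c by (auto intro!: height_plateau)
    moreover have "layer u v \<noteq> layer u' v' \<and> 0 < layer u v \<and> 0 < layer u' v'"
      using c interleaved_levels uv by metis
    ultimately show thesis using crossing[of t] c t(3) a b by blast
  qed
qed

lemma vertex_on_seg:
  assumes "u < v" "v < n" "(Pt w, 0) \<in> seg u v" shows "w \<in> {u, v}"
proof -
  obtain t where "fst (strand u v t) = Pt w" using assms(3) by (auto simp: seg_def) (metis fst_conv)
  then have "t = x w" "line (x u) (x v) t = t\<^sup>2" by (auto simp: strand_def Pt_def pt_def)
  then have "(x w - x u) * (x v - x w) = 0" using line_at[of "x u" "x v" "x w"] by simp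
  then show ?thesis by (auto simp: x_eq)
qed

lemma polygonal_embedding_layered: "polygonal_embedding (complete_graph n) layered_drawing"
  unfolding polygonal_embedding_def embedding_def
proof (intro conjI ballI impI)
  show "inj_on (vpos layered_drawing) (verts (complete_graph n))" by (auto simp: inj_on_def Pt_eq)
  fix e assume e: "e \<in> edges (complete_graph n)"
  obtain u v where uv: "e = {u, v}" "u < v" "v < n" "earc layered_drawing e = seg u v" using edgeE[OF e] .
  show "\<exists>\<gamma>. arc \<gamma> \<and> path_image \<gamma> = earc layered_drawing e \<and> {pathstart \<gamma>, pathfinish \<gamma>} = vpos layered_drawing ` e"
    using seg_arc[OF uv(2,3)] uv by auto
  show "polygonal (earc layered_drawing e)" using polygonal_seg uv by simp
  show "w \<in> e" if "vpos layered_drawing w \<in> earc layered_drawing e" for w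
    using vertex_on_seg[OF uv(2,3), of w] that uv by simp
  fix f assume f: "f \<in> edges (complete_graph n)" "e \<noteq> f"
  obtain u' v' where uv': "f = {u', v'}" "u' < v'" "v' < n" "earc layered_drawing f = seg u' v'" using edgeE[OF f(1)] .
  have ne: "(u, v) \<noteq> (u', v')" using f(2) uv(1) uv'(1) by auto
  show "earc layered_drawing e \<inter> earc layered_drawing f \<subseteq> vpos layered_drawing ` (e \<inter> f)"
  proof
    fix z assume "z \<in> earc layered_drawing e \<inter> earc layered_drawing f"
    then have z: "z \<in> seg u v" "z \<in> seg u' v'" using uv uv' by auto
    from uv(2,3) uv'(2,3) ne z refl show "z \<in> vpos layered_drawing ` (e \<inter> f)"
    proof (cases rule: seg_meet)
      case (vertex w)
      then show ?thesis unfolding uv uv' by auto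
    next
      case (crossing t)
      then show ?thesis by simp
    qed
  qed
qed auto

sublocale spined_drawing n layered_drawing "[0..<n]"
proof
  show "embedding (complete_graph n) layered_drawing UNIV"
    using polygonal_embedding_layered by (simp add: polygonal_embedding_def)
  have "cycle_edges [0..<n] \<subseteq> edges (complete_graph n)"
    unfolding cycle_edges_def
  proof clarify
    fix i assume i: "i < length [0..<n]"
    have "Suc i mod n < n" using n3 by simp
    moreover have "i \<noteq> Suc i mod n" using i n3 by (cases "Suc i = n") auto
    ultimately show "{[0..<n] ! i, [0..<n] ! (Suc i mod length [0..<n])} \<in> edges (complete_graph n)"
      using i by simp
  qed
  then show "is_cycle (complete_graph n) [0..<n]"
    using n3 by (auto simp: is_cycle_def)
qed

lemma cycle_edges_nxt: "cycle_edges [0..<n] = (\<lambda>i. {i, nxt i}) ` {..<n}"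
proof -
  have "{[0..<n] ! i, [0..<n] ! (Suc i mod length [0..<n])} = {i, nxt i}" if "i < n" for i
  proof (cases "Suc i < n")
    case True then show ?thesis by (simp add: nxt_def)
  next
    case False
    then have "Suc i = n" using that by simp
    then show ?thesis using that by (simp add: nxt_def)
  qed
  moreover have "cycle_edges [0..<n] =
      (\<lambda>i. {[0..<n] ! i, [0..<n] ! (Suc i mod length [0..<n])}) ` {..<n}"
  proof -
    have "{g i | i. i < n} = g ` {..<n}" for g :: "nat \<Rightarrow> nat set" by auto
    then show ?thesis unfolding cycle_edges_def by (simp only: length_upt diff_zero)
  qed
  ultimately show ?thesis by (metis (no_types, lifting) image_cong lessThan_iff)
qed

lemma layer_zero_iff:
  assumes "u < v" "v < n" shows "layer u v = 0 \<longleftrightarrow> {u, v} \<in> cycle_edges [0..<n]"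
proof -
  have "{u, v} \<in> cycle_edges [0..<n] \<longleftrightarrow> (\<exists>i<n. {u, v} = {i, nxt i})"
    by (auto simp: cycle_edges_nxt)
  also have "\<dots> \<longleftrightarrow> v = Suc u \<or> u = 0 \<and> v = n - 1"
  proof
    assume "\<exists>i<n. {u, v} = {i, nxt i}"
    then show "v = Suc u \<or> u = 0 \<and> v = n - 1" using assms by (auto simp: nxt_def doubleton_eq_iff split: if_splits)
  next
    assume "v = Suc u \<or> u = 0 \<and> v = n - 1"
    then show "\<exists>i<n. {u, v} = {i, nxt i}"
    proof
      assume "v = Suc u" then show ?thesis using assms by (intro exI[of _ u]) (auto simp: nxt_def)
    next
      assume "u = 0 \<and> v = n - 1" then show ?thesis using assms by (intro exI[of _ v]) (auto simp: nxt_def)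
    qed
  qed
  finally show ?thesis by (simp add: layer_def)
qed

lemma seg_flat:
  assumes "u < v" "v < n" "layer u v = 0"
  shows "seg u v = closed_segment (Pt u) (Pt v) \<times> {0}"
proof -
  have "seg u v = (\<lambda>t. (Complex t (line (x u) (x v) t), 0)) ` {x u..x v}"
    using assms by (simp add: seg_def strand_def height_def)
  moreover have "x u < x v" using assms by (simp add: x_less)
  ultimately show ?thesis unfolding Pt_def chord_as_graph[OF \<open>x u < x v\<close>] by auto
qed

lemma C_polygon: "C = polygon \<times> {0}"
proof -
  have "earc layered_drawing {i, nxt i} = closed_segment (Pt i) (Pt (nxt i)) \<times> {0}" if "i < n" for i
  proof (cases "i < nxt i")
    case True
    have "layer i (nxt i) = 0" using that nxt_less True by (subst layer_zero_iff) (auto simp: cycle_edges_nxt)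
    then show ?thesis using True nxt_less seg_flat by simp
  next
    case False
    then have lt: "nxt i < i" using nxt_neq(1)[OF that] by simp
    have "layer (nxt i) i = 0" using that lt by (subst layer_zero_iff) (auto simp: cycle_edges_nxt insert_commute)
    then show ?thesis using lt that seg_flat[of "nxt i" i]
      by (simp add: insert_commute[of i] closed_segment_commute)
  qed
  then show ?thesis
    unfolding C_def cycle_support_def cycle_edges_nxt polygon_eq image_image by auto
qed

lemma chord_iff: "e \<in> chords \<longleftrightarrow> (\<exists>u v. e = {u, v} \<and> u < v \<and> v < n \<and> 0 < layer u v)"
proof
  assume e: "e \<in> chords"
  then have "e \<in> edges K" "e \<notin> cycle_edges [0..<n]" by (auto simp: chords_def)
  then show "\<exists>u v. e = {u, v} \<and> u < v \<and> v < n \<and> 0 < layer u v"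
    using edgeE layer_zero_iff by (metis gr0I)
next
  assume "\<exists>u v. e = {u, v} \<and> u < v \<and> v < n \<and> 0 < layer u v"
  then obtain u v where "e = {u, v}" "u < v" "v < n" "0 < layer u v" by blast
  then show "e \<in> chords" using layer_zero_iff[of u v] by (auto simp: chords_def)
qed

lemma fragments_layered: "fragments K layered_drawing [0..<n] = {seg u v | u v. u < v \<and> v < n \<and> 0 < layer u v}"
proof -
  have "fragments K layered_drawing [0..<n] = earc layered_drawing ` chords"
    by (subst fragments_eq) auto
  also have "\<dots> = {seg u v | u v. u < v \<and> v < n \<and> 0 < layer u v}"
  proof
    show "earc layered_drawing ` chords \<subseteq> {seg u v | u v. u < v \<and> v < n \<and> 0 < layer u v}"
    proof
      fix A assume "A \<in> earc layered_drawing ` chords"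
      then obtain e where e: "e \<in> chords" "A = earc layered_drawing e" by blast
      then obtain u v where uv: "e = {u, v}" "u < v" "v < n" "0 < layer u v" using chord_iff by metis
      then have "A = seg u v" using e(2) by simp
      then show "A \<in> {seg u v | u v. u < v \<and> v < n \<and> 0 < layer u v}" using uv by blast
    qed
    show "{seg u v | u v. u < v \<and> v < n \<and> 0 < layer u v} \<subseteq> earc layered_drawing ` chords"
    proof clarify
      fix u v assume "u < v" "v < n" "0 < layer u v"
      then show "seg u v \<in> earc layered_drawing ` chords" by (intro image_eqI[of _ _ "{u, v}"]) (auto simp: chord_iff)
    qed
  qed
  finally show ?thesis .
qed

lemma chord_inside:
  assumes "u < v" "v < n" "0 < layer u v"
  shows "fst ` (seg u v - C) \<subseteq> inside polygon"
proof clarify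
  fix z h assume z: "(z, h) \<in> seg u v" "(z, h) \<notin> C"
  obtain t where t: "t \<in> {x u..x v}" "(z, h) = strand u v t" using z(1) by (auto simp: seg_def)
  have "P u \<in> C" "P v \<in> C" using assms by (auto intro!: vertex_in_C simp del: vpos_layered)
  then have "t \<noteq> x u" "t \<noteq> x v" using z(2) t(2) strand_ends[OF assms(1,2)] by auto
  then have t': "x u < t" "t < x v" using t(1) by auto
  define s where "s = (t - x u) / (x v - x u)"
  have s: "0 < s" "s < 1" using t' by (simp_all add: s_def)
  have "Im z = line (x u) (x v) (Re z)" "Re z = t" using t(2) by (auto simp: strand_def)
  then have zs: "z = (1 - s) *\<^sub>R Pt u + s *\<^sub>R Pt v"
    using Pt_combination[of u v z] assms(1) by (simp add: s_def)
  have "0 < side i z" if i: "i < n" for i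
  proof -
    have nn: "0 \<le> side i (Pt u)" "0 \<le> side i (Pt v)" using side_Pt_nonneg assms i by auto
    have "\<not> (side i (Pt u) = 0 \<and> side i (Pt v) = 0)"
    proof
      assume "side i (Pt u) = 0 \<and> side i (Pt v) = 0"
      then have "{u, v} = {i, nxt i}" using side_Pt_zero[OF i, of u] side_Pt_zero[OF i, of v] assms by auto
      then show False using layer_zero_iff[OF assms(1,2)] assms(3) i by (auto simp: cycle_edges_nxt)
    qed
    then have "0 < side i (Pt u) \<or> 0 < side i (Pt v)" using nn by linarith
    then have "0 < (1 - s) * side i (Pt u) + s * side i (Pt v)"
    proof
      assume "0 < side i (Pt u)"
      then show ?thesis using nn s by (intro add_pos_nonneg) simp_all
    next
      assume "0 < side i (Pt v)"
      then show ?thesis using nn s by (intro add_nonneg_pos) simp_all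
    qed
    then show ?thesis unfolding zs side_affine .
  qed
  then show "fst (z, h) \<in> inside polygon" using sides_pos_inside by simp
qed

lemma support_layered: "support K layered_drawing = \<Union> {seg u v | u v. u < v \<and> v < n}"
proof -
  have seg_in: "\<exists>u v. earc layered_drawing e = seg u v \<and> u < v \<and> v < n" if "e \<in> edges K" for e
    using that by (rule edgeE) blast
  have a: "P w \<in> \<Union> {seg u v | u v. u < v \<and> v < n}" if "w < n" for w
  proof -
    define w' :: nat where "w' = (if w = 0 then 1 else 0)"
    have e: "{w, w'} \<in> edges K" using that n3 by (auto simp: w'_def)
    then have "P w \<in> earc layered_drawing {w, w'}" by (intro end_in_edge) auto
    then show ?thesis using seg_in[OF e] by blast
  qed
  have b: "earc layered_drawing e \<subseteq> \<Union> {seg u v | u v. u < v \<and> v < n}" if "e \<in> edges K" for e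
    using seg_in[OF that] by blast
  have c: "seg u v \<subseteq> support K layered_drawing" if "u < v" "v < n" for u v
  proof -
    have "{u, v} \<in> edges K" using that by simp
    then show ?thesis using earc_layered[OF that(1)] unfolding support_def by blast
  qed
  show ?thesis
  proof
    show "support K layered_drawing \<subseteq> \<Union> {seg u v | u v. u < v \<and> v < n}"
      unfolding support_def complete_graph_simps(1) using a b by (intro Un_least image_subsetI UN_least) auto
    show "\<Union> {seg u v | u v. u < v \<and> v < n} \<subseteq> support K layered_drawing"
      using c by (intro Union_least) blast
  qed
qed

text \<open>Transversality requires that the drawing is a straight line near a crossing: there the chord is in its horizontal
part, and the remaining edges form a closed set.\<close>

lemma local_line:
  assumes uv: "u < v" "v < n" and t: "x u + \<delta> < t" "t < x v - \<delta>" and layer: "0 < layer u v"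
  obtains r where "0 < r" "\<And>r'. r' \<le> r \<Longrightarrow> support K layered_drawing \<inter> ball (strand u v t) r' =
    range (\<lambda>s. strand u v t + s *\<^sub>R (Complex 1 (x u + x v), 0)) \<inter> ball (strand u v t) r'"
proof -
  let ?a = "strand u v t" and ?w = "(Complex 1 (x u + x v), 0) :: space3"
  define Others where "Others = \<Union> {seg u' v' | u' v'. u' < v' \<and> v' < n \<and> (u', v') \<noteq> (u, v)}"
  have "{seg u' v' | u' v'. u' < v' \<and> v' < n \<and> (u', v') \<noteq> (u, v)} \<subseteq> (\<Union>u'\<in>{..<n}. seg u' ` {..<n})"
  proof
    fix A assume "A \<in> {seg u' v' | u' v'. u' < v' \<and> v' < n \<and> (u', v') \<noteq> (u, v)}"
    then obtain u' v' where "A = seg u' v'" "u' < v'" "v' < n" by blast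
    then show "A \<in> (\<Union>u'\<in>{..<n}. seg u' ` {..<n})" by (intro UN_I[of u'] image_eqI[of _ _ v']) auto
  qed
  then have "finite {seg u' v' | u' v'. u' < v' \<and> v' < n \<and> (u', v') \<noteq> (u, v)}"
    by (rule finite_subset) simp
  then have "closed Others" unfolding Others_def
    by (intro closed_Union) (auto intro: compact_imp_closed compact_seg)
  have a_in: "?a \<in> seg u v" using t delta_pos by (auto simp: seg_def)
  have h: "snd ?a = real (layer u v)" unfolding strand_def snd_conv using t by (intro height_plateau) auto
  have "?a \<notin> Others"
  proof
    assume "?a \<in> Others"
    then obtain u' v' where uv': "u' < v'" "v' < n" "(u, v) \<noteq> (u', v')" "?a \<in> seg u' v'"
      unfolding Others_def by blast
    from uv uv'(1-3) a_in uv'(4) refl show False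
    proof (cases rule: seg_meet)
      case (vertex w) then show ?thesis using h layer by simp
    next
      case (crossing t') then show ?thesis by simp
    qed
  qed
  then obtain r1 where r1: "0 < r1" "ball ?a r1 \<inter> Others = {}"
  proof -
    have "open (- Others)" "?a \<in> - Others" using \<open>closed Others\<close> \<open>?a \<notin> Others\<close> by auto
    then obtain r1 where "0 < r1" "ball ?a r1 \<subseteq> - Others" by (rule openE)
    then show thesis using that by blast
  qed
  define r where "r = min r1 (min (t - x u - \<delta>) (x v - \<delta> - t))"
  have on: "strand u v (t + s) = ?a + s *\<^sub>R ?w" if "\<bar>s\<bar> < r" for s
  proof -
    have "height u v (t + s) = real (layer u v)" "height u v t = real (layer u v)"
      using that t by (auto intro!: height_plateau simp: r_def)
    then show ?thesis by (simp add: strand_def line_def complex_eq_iff algebra_simps)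
  qed
  have re: "\<bar>Re (fst y) - t\<bar> \<le> dist ?a y" for y
  proof -
    have "\<bar>Re (fst y) - t\<bar> = \<bar>Re (fst (?a - y))\<bar>" by (simp add: strand_def)
    also have "\<dots> \<le> norm (fst (?a - y))" by (rule abs_Re_le_cmod)
    also have "\<dots> \<le> norm (?a - y)" by (metis norm_fst_le prod.collapse)
    finally show ?thesis by (simp add: dist_norm)
  qed
  show thesis
  proof (rule that)
    show "0 < r" using r1 t by (simp add: r_def)
    fix r' assume r': "r' \<le> r"
    show "support K layered_drawing \<inter> ball ?a r' = range (\<lambda>s. ?a + s *\<^sub>R ?w) \<inter> ball ?a r'"
    proof
      show "support K layered_drawing \<inter> ball ?a r' \<subseteq> range (\<lambda>s. ?a + s *\<^sub>R ?w) \<inter> ball ?a r'"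
      proof
        fix y assume y: "y \<in> support K layered_drawing \<inter> ball ?a r'"
        then have "y \<in> ball ?a r1" using r' by (auto simp: r_def)
        then have "y \<notin> Others" using r1(2) by blast
        then have "y \<in> seg u v" using y unfolding support_layered Others_def by blast
        then obtain t' where "y = strand u v t'" by (auto simp: seg_def)
        moreover have "\<bar>t' - t\<bar> < r" using re[of y] y r' calculation by (simp add: strand_def)
        ultimately have "y = ?a + (t' - t) *\<^sub>R ?w" using on[of "t' - t"] by simp
        then show "y \<in> range (\<lambda>s. ?a + s *\<^sub>R ?w) \<inter> ball ?a r'" using y by auto
      qed
      show "range (\<lambda>s. ?a + s *\<^sub>R ?w) \<inter> ball ?a r' \<subseteq> support K layered_drawing \<inter> ball ?a r'"
      proof
        fix y assume y: "y \<in> range (\<lambda>s. ?a + s *\<^sub>R ?w) \<inter> ball ?a r'"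
        then obtain s where s: "y = ?a + s *\<^sub>R ?w" by auto
        have "\<bar>s\<bar> < r" using re[of y] y r' s by (simp add: strand_def)
        then have "y = strand u v (t + s)" using on s by simp
        moreover have "t + s \<in> {x u..x v}" using \<open>\<bar>s\<bar> < r\<close> delta_pos by (auto simp: r_def)
        ultimately have "y \<in> seg u v" by (auto simp: seg_def)
        then show "y \<in> support K layered_drawing \<inter> ball ?a r'" using uv y unfolding support_layered by blast
      qed
    qed
  qed
qed

lemma regular_projection_layered: "regular_projection K layered_drawing"
  unfolding regular_projection_def
proof (intro ballI impI)
  fix a b assume ab: "a \<in> support K layered_drawing" "b \<in> support K layered_drawing" "a \<noteq> b \<and> fst a = fst b"
  obtain u v where uv: "u < v" "v < n" "a \<in> seg u v" using ab(1) support_layered by auto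
  obtain u' v' where uv': "u' < v'" "v' < n" "b \<in> seg u' v'" using ab(2) support_layered by auto
  have ne: "(u, v) \<noteq> (u', v')" using inj_fst_seg[of u v] uv uv' ab(3) by (auto dest: inj_onD)
  have "fst a = fst b" using ab(3) by simp
  from uv(1,2) uv'(1,2) ne uv(3) uv'(3) this obtain t where 
    c: "{u, v} \<inter> {u', v'} = {}" "interleaved u v u' v' \<or> interleaved u' v' u v"
    "x u + \<delta> < t" "t < x v - \<delta>" "x u' + \<delta> < t" "t < x v' - \<delta>"
    "line (x u) (x v) t = line (x u') (x v') t" "a = strand u v t" "b = strand u' v' t"
    "snd a = real (layer u v)" "snd b = real (layer u' v')" "layer u v \<noteq> layer u' v'" "0 < layer u v" "0 < layer u' v'"
  proof (cases rule: seg_meet)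
    case (vertex w) then show ?thesis using ab(3) by simp
  next
    case (crossing t) then show ?thesis using that by blast
  qed
  show "a \<notin> vpos layered_drawing ` verts K \<and> b \<notin> vpos layered_drawing ` verts K \<and>
      (\<forall>c\<in>support K layered_drawing. fst c = fst a \<longrightarrow> c = a \<or> c = b) \<and>
      transversal_at (support K layered_drawing) a b"
  proof (intro conjI ballI impI)
    show "a \<notin> vpos layered_drawing ` verts K" "b \<notin> vpos layered_drawing ` verts K"
      using c(10,11,13,14) by auto
    fix y assume y: "y \<in> support K layered_drawing" "fst y = fst a"
    show "y = a \<or> y = b"
    proof (rule ccontr)
      assume nab: "\<not> (y = a \<or> y = b)"
      obtain u'' v'' where uv'': "u'' < v''" "v'' < n" "y \<in> seg u'' v''" using y(1) support_layered by auto
      have meet: "{p, q} \<inter> {u'', v''} = {} \<and> line (x u'') (x v'') t = line (x p) (x q) t"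
        if pq: "p < q" "q < n" "z \<in> seg p q" "fst z = fst y" "z \<noteq> y" "z = strand p q t" for p q z
      proof -
        have ne: "(p, q) \<noteq> (u'', v'')" using inj_fst_seg[of p q] pq uv'' by (auto dest: inj_onD)
        from pq(1,2) uv''(1,2) ne pq(3) uv''(3) pq(4) show ?thesis
        proof (cases rule: seg_meet)
          case (vertex w) then show ?thesis using pq(5) by simp
        next
          case (crossing s)
          then have "s = t" using pq(6) by (simp add: strand_def)
          then show ?thesis using crossing by simp
        qed
      qed
      \<comment> \<open>A third strand through the crossing would belong to a third chord with different ends.\<close>
      have m1: "{u, v} \<inter> {u'', v''} = {} \<and> line (x u'') (x v'') t = line (x u) (x v) t"
        using meet[of u v a] uv y(2) nab c(8) by auto
      have m2: "{u', v'} \<inter> {u'', v''} = {} \<and> line (x u'') (x v'') t = line (x u') (x v') t"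
        using meet[of u' v' b] uv' y(2) nab c(9) ab(3) by auto
      have "concurrence (x u) (x v) (x u') (x v') (x u'') (x v'') = 0"
        using m1 c(7) by (intro concurrent_lines[of _ _ t]) auto
      moreover have "distinct [u, v, u', v', u'', v''] \<and> {u, v, u', v', u'', v''} \<subseteq> {..<n}"
        using m1 m2 c(1) uv uv' uv'' by auto
      ultimately show False
        using generic[unfolded no_three_concurrent_def, THEN spec, THEN spec, THEN spec, THEN spec, THEN spec, THEN spec,
            of u v u' v' u'' v''] by blast
    qed
  next
    obtain r1 where r1: "0 < r1" "\<And>r'. r' \<le> r1 \<Longrightarrow> support K layered_drawing \<inter> ball a r' =
      range (\<lambda>s. a + s *\<^sub>R (Complex 1 (x u + x v), 0)) \<inter> ball a r'"
      using local_line[OF uv(1,2) c(3,4,13)] c(8) by metis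
    obtain r2 where r2: "0 < r2" "\<And>r'. r' \<le> r2 \<Longrightarrow> support K layered_drawing \<inter> ball b r' =
      range (\<lambda>s. b + s *\<^sub>R (Complex 1 (x u' + x v'), 0)) \<inter> ball b r'"
      using local_line[OF uv'(1,2) c(5,6,14)] c(9) by metis
    have "x u + x v \<noteq> x u' + x v'"
    proof
      assume s: "x u + x v = x u' + x v'"
      then have "x u * x v = x u' * x v'" using c(7) by (simp add: line_def)
      then have "line (x u) (x v) 0 = line (x u') (x v') 0" "line (x u) (x v) 1 = line (x u') (x v') 1"
        using s by (simp_all add: line_def)
      then have "x u = x u'" using same_line[of "x u" "x v" 0 "x u'" "x v'" 1] uv uv' by (simp add: x_less)
      then show False using c(1) by (simp add: x_eq)
    qed
    then have nc: "\<not> collinear {0, Complex 1 (x u + x v), Complex 1 (x u' + x v')}"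
      by (simp add: collinear_lemma complex_eq_iff)
    show "transversal_at (support K layered_drawing) a b"
      unfolding transversal_at_def
    proof (intro exI conjI)
      show "0 < min r1 r2" using r1 r2 by simp
      show "\<not> collinear {0, fst (Complex 1 (x u + x v), 0 :: real), fst (Complex 1 (x u' + x v'), 0 :: real)}"
        using nc by simp
    qed (use r1(2) r2(2) in auto)
  qed
qed

lemma inj_fst_edge: "e \<in> edges K \<Longrightarrow> inj_on fst (earc layered_drawing e)"
  by (erule edgeE) (simp add: inj_fst_seg)

lemma reduced_layered: "reduced K layered_drawing"
  unfolding reduced_def
proof
  show "\<not> reducible_R1 K layered_drawing"
  proof
    assume "reducible_R1 K layered_drawing"
    then obtain e \<gamma> where e: "e \<in> edges K" "arc \<gamma>" "path_image \<gamma> \<subseteq> earc layered_drawing e"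
      "fst (pathstart \<gamma>) = fst (pathfinish \<gamma>)"
      unfolding reducible_R1_def by blast
    then have "pathstart \<gamma> = pathfinish \<gamma>"
      using inj_onD[OF inj_fst_edge[OF e(1)] e(4)] by (meson pathfinish_in_path_image pathstart_in_path_image subsetD)
    then show False using arc_distinct_ends[OF e(2)] by simp
  qed
  show "\<not> reducible_R2 K layered_drawing"
  proof
    assume "reducible_R2 K layered_drawing"
    then obtain e f \<gamma> \<epsilon> where e: "e \<in> edges K" "f \<in> edges K" "arc (fst \<circ> \<gamma>)"
      "path_image \<gamma> \<subseteq> earc layered_drawing e" "path_image \<epsilon> \<subseteq> earc layered_drawing f"
      "fst (pathstart \<gamma>) = fst (pathstart \<epsilon>)" "snd (pathstart \<gamma>) > snd (pathstart \<epsilon>)"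
      "fst (pathfinish \<gamma>) = fst (pathfinish \<epsilon>)"
      unfolding reducible_R2_def by blast
    have ne: "fst (pathstart \<gamma>) \<noteq> fst (pathfinish \<gamma>)"
      using arc_distinct_ends[OF e(3)] by (simp add: pathstart_compose pathfinish_compose)
    have mem: "pathstart \<gamma> \<in> earc layered_drawing e" "pathfinish \<gamma> \<in> earc layered_drawing e" "pathstart \<epsilon> \<in> earc layered_drawing f" "pathfinish \<epsilon> \<in> earc layered_drawing f"
      using e(4,5) by (meson pathfinish_in_path_image pathstart_in_path_image subsetD)+
    obtain u v where uv: "e = {u, v}" "u < v" "v < n" "earc layered_drawing e = seg u v" using edgeE[OF e(1)] .
    obtain u' v' where uv': "f = {u', v'}" "u' < v'" "v' < n" "earc layered_drawing f = seg u' v'" using edgeE[OF e(2)] .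
    obtain s where s: "pathstart \<gamma> = strand u v s" using mem(1) uv(4) by (auto simp: seg_def)
    obtain t where t: "pathfinish \<gamma> = strand u v t" using mem(2) uv(4) by (auto simp: seg_def)
    obtain s' where s': "pathstart \<epsilon> = strand u' v' s'" using mem(3) uv'(4) by (auto simp: seg_def)
    obtain t' where t': "pathfinish \<epsilon> = strand u' v' t'" using mem(4) uv'(4) by (auto simp: seg_def)
    have ls: "line (x u) (x v) s = line (x u') (x v') s" and lt: "line (x u) (x v) t = line (x u') (x v') t"
      using e(6,8) unfolding s t s' t' fst_strand_eq by auto
    have "s \<noteq> t" using ne unfolding s t by auto
    then have "u = u' \<and> v = v'"
      using same_line[OF ls lt] uv uv' by (simp add: x_less x_eq)
    then have "pathstart \<gamma> = pathstart \<epsilon>"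
      using inj_onD[OF inj_fst_seg e(6)] mem uv uv' by metis
    then show False using e(7) by simp
  qed
qed

lemma crosses_over_seg_iff:
  assumes uv: "u < v" "v < n" and uv': "u' < v'" "v' < n"
  shows "crosses_over (seg u v) (seg u' v') \<longleftrightarrow>
    (interleaved u v u' v' \<or> interleaved u' v' u v) \<and> layer u' v' < layer u v"
proof
  assume "crosses_over (seg u v) (seg u' v')"
  then obtain a b where ab: "a \<in> seg u v" "b \<in> seg u' v'" "fst a = fst b" "snd b < snd a"
    unfolding crosses_over_def by blast
  have ne: "(u, v) \<noteq> (u', v')" using inj_onD[OF inj_fst_seg ab(3)] ab by fastforce
  from uv uv' ne ab(1-3) show "(interleaved u v u' v' \<or> interleaved u' v' u v) \<and> layer u' v' < layer u v"
  proof (cases rule: seg_meet)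
    case (vertex w) then show ?thesis using ab(4) by simp
  next
    case (crossing t) then show ?thesis using ab(4) by simp
  qed
next
  assume h: "(interleaved u v u' v' \<or> interleaved u' v' u v) \<and> layer u' v' < layer u v"
  have ex: "\<exists>t. line (x u) (x v) t = line (x u') (x v') t \<and> x u' + \<delta> < t \<and> t < x v - \<delta> \<and> x u < x u' \<and> x v < x v'"
    if il: "interleaved u v u' v'" "v' < n" for u v u' v'
  proof -
    have o: "x u < x u'" "x u' < x v" "x v < x v'" using il by (auto simp: interleaved_def x_less)
    then obtain t where "x u' < t" "t < x v" "line (x u) (x v) t = line (x u') (x v') t" by (rule lines_cross)
    then show ?thesis using crossing_gap[OF il, of t] o by blast
  qed
  obtain t where t: "line (x u) (x v) t = line (x u') (x v') t" "x u + \<delta> < t" "t < x v - \<delta>" "x u' + \<delta> < t" "t < x v' - \<delta>"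
    using h
  proof (elim conjE disjE)
    assume "interleaved u v u' v'"
    then obtain t where "line (x u) (x v) t = line (x u') (x v') t" "x u' + \<delta> < t" "t < x v - \<delta>"
      "x u < x u'" "x v < x v'" using ex[of u v u' v'] uv' by blast
    then show thesis using that[of t] by linarith
  next
    assume "interleaved u' v' u v"
    then obtain t where "line (x u') (x v') t = line (x u) (x v) t" "x u + \<delta> < t" "t < x v' - \<delta>"
      "x u' < x u" "x v' < x v" using ex[of u' v' u v] uv by blast
    then show thesis using that[of t] by linarith
  qed
  have "height u v t = real (layer u v)" "height u' v' t = real (layer u' v')" using t by (auto intro!: height_plateau)
  then have "snd (strand u v t) > snd (strand u' v' t)" using h by (simp add: strand_def)
  moreover have "fst (strand u v t) = fst (strand u' v' t)" using t(1) by (simp add: fst_strand_eq)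
  moreover have "strand u v t \<in> seg u v" "strand u' v' t \<in> seg u' v'" using t delta_pos by (auto simp: seg_def)
  ultimately show "crosses_over (seg u v) (seg u' v')" unfolding crosses_over_def by blast
qed

text \<open>The chord \<open>(u - 1, v - 1)\<close>, with indices modulo \<open>n\<close>, crosses \<open>(u, v)\<close> and has a sum that is smaller by $2$. The sum does not
wrap around, since it is at least $2$ modulo \<open>n\<close> for every chord above the first level.\<close>

lemma next_lower_level:
  assumes uv: "u < v" "v < n" and l: "2 \<le> layer u v"
  shows "\<exists>u' v'. u' < v' \<and> v' < n \<and> (interleaved u v u' v' \<or> interleaved u' v' u v) \<and> layer u' v' = layer u v - 1"
proof -
  let ?s = "(u + v) mod n"
  have l': "layer u v = Suc (?s div 2)" "v \<noteq> Suc u" "\<not> (u = 0 \<and> v = n - 1)" using l by (auto simp: layer_def split: if_splits)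
  then have s2: "2 \<le> ?s" using l by simp
  have dec: "Suc (((?s - 2)) div 2) = layer u v - 1"
  proof -
    have "2 \<le> q \<Longrightarrow> Suc ((q - 2) div 2) = Suc (q div 2) - 1" for q :: nat by presburger
    then show ?thesis unfolding l'(1) using s2 by blast
  qed
  show ?thesis
  proof (cases "u = 0")
    case False
    have il: "interleaved (u - 1) (v - 1) u v" using False uv l' by (auto simp: interleaved_def)
    have "(u - 1) + (v - 1) = u + v - 2" using False uv by simp
    moreover have "(u + v - 2) mod n = ?s - 2"
    proof -
      have "?s < n" using uv by simp
      have "u + v - 2 = (?s - 2) + n * ((u + v) div n)"
        using s2 mult_div_mod_eq[of n "u + v"] by linarith
      then have "(u + v - 2) mod n = (?s - 2) mod n" by simp
      then show ?thesis using \<open>?s < n\<close> by simp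
    qed
    ultimately have "layer (u - 1) (v - 1) = layer u v - 1"
      using interleaved_levels(1)[OF il uv(2)] dec by (simp add: layer_def split: if_splits)
    then show ?thesis using il uv False by (intro exI[of _ "u - 1"] exI[of _ "v - 1"]) auto
  next
    case True
    have il: "interleaved u v (v - 1) (n - 1)" using True uv l' by (auto simp: interleaved_def)
    have "?s = v" using True uv by simp
    have "(v - 1) + (n - 1) = (v - 2) + n" using uv s2 \<open>?s = v\<close> by simp
    then have "((v - 1) + (n - 1)) mod n = ((v - 2) + n) mod n" by (simp only:)
    also have "\<dots> = v - 2" using uv by simp
    finally have "((v - 1) + (n - 1)) mod n = v - 2" .
    then have "layer (v - 1) (n - 1) = layer u v - 1"
      using interleaved_levels(2)[OF il] dec uv \<open>?s = v\<close> by (simp add: layer_def split: if_splits)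
    then show ?thesis using il uv l' True by (intro exI[of _ "v - 1"] exI[of _ "n - 1"]) auto
  qed
qed

lemma layer_le: "0 < n \<Longrightarrow> layer u v \<le> (n + 1) div 2"
proof -
  assume "0 < n"
  then have "(u + v) mod n \<le> n - 1" by (metis Suc_pred' mod_less_divisor less_Suc_eq_le)
  then show ?thesis using \<open>0 < n\<close> unfolding layer_def by (auto; presburger)
qed

text \<open>By \<open>next_lower_level\<close> it suffices to find a chord in the highest level: it is \<open>(0, n - 2)\<close> for even \<open>n\<close> and
\<open>(1, n - 2)\<close> for odd \<open>n\<close>.\<close>

lemma level_nonempty:
  assumes "4 \<le> n" "i \<in> {1..(n + 1) div 2}"
  shows "\<exists>u v. u < v \<and> v < n \<and> layer u v = i"
proof -
  have top: "\<exists>u v. u < v \<and> v < n \<and> layer u v = (n + 1) div 2"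
  proof (cases "even n")
    case True
    then show ?thesis using assms(1) by (intro exI[of _ 0] exI[of _ "n - 2"]) (auto simp: layer_def)
  next
    case False
    then have "5 \<le> n" using assms(1) by presburger
    moreover have "n - 2 = Suc (n - 3)" "1 + (n - 2) = n - 1" using \<open>5 \<le> n\<close> by auto
    ultimately show ?thesis using False
      by (intro exI[of _ 1] exI[of _ "n - 2"]) (auto simp: layer_def elim!: oddE)
  qed
  have "\<exists>u v. u < v \<and> v < n \<and> layer u v = (n + 1) div 2 - j" if "j < (n + 1) div 2" for j
    using that
  proof (induction j)
    case 0 then show ?case using top by simp
  next
    case (Suc j)
    then obtain u v where uv: "u < v" "v < n" "layer u v = (n + 1) div 2 - j" by auto
    then have "2 \<le> layer u v" using Suc.prems by simp
    then obtain u' v' where "u' < v'" "v' < n" "layer u' v' = layer u v - 1"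
      using next_lower_level[OF uv(1,2)] by blast
    then show ?case using uv(3) by (intro exI[of _ u'] exI[of _ v']) simp
  qed
  from this[of "(n + 1) div 2 - i"] assms(2) show ?thesis by auto
qed

lemma seg_inj:
  assumes "u < v" "v < n" "u' < v'" "v' < n" "0 < layer u v" "0 < layer u' v'" "seg u v = seg u' v'"
  shows "u = u' \<and> v = v'"
proof -
  have "{u, v} = {u', v'}"
  proof (rule ccontr)
    assume ne: "{u, v} \<noteq> {u', v'}"
    have "{u, v} \<in> chords" "{u', v'} \<in> edges K" using assms by (auto simp: chord_iff)
    then have "(seg u v - C) \<inter> (seg u' v' - C) = {}" using chord_disjoint[OF _ _ ne] assms(1,3) by simp
    moreover have "seg u v - C \<noteq> {}"
      using edge_minus_C(3)[of "{u, v}"] \<open>{u, v} \<in> chords\<close> assms(1) by (simp add: chords_def)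
    ultimately show False using assms(7) by blast
  qed
  then show ?thesis using assms(1,3) by (auto simp: doubleton_eq_iff)
qed

lemma level_partition_layered:
  assumes "n = 3 \<and> m = 0 \<or> 4 \<le> n \<and> m = (n + 1) div 2"
  shows "\<exists>L. level_partition (fragments K layered_drawing [0..<n]) m L"
proof (cases "n = 3")
  case True
  have "layer u v = 0" if "u < v" "v < n" for u v
  proof -
    have "v = Suc u \<or> u = 0 \<and> v = n - 1" using that True by linarith
    then show ?thesis unfolding layer_def by simp
  qed
  then have "fragments K layered_drawing [0..<n] = {}" unfolding fragments_layered by fastforce
  then show ?thesis using assms True by (auto simp: level_partition_def disjoint_family_on_def)
next
  case False
  then have n4: "4 \<le> n" and m: "m = (n + 1) div 2" using assms by auto
  define F where "F = fragments K layered_drawing [0..<n]"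
  have F: "F = {seg u v | u v. u < v \<and> v < n \<and> 0 < layer u v}" unfolding F_def by (rule fragments_layered)
  define lv where "lv A = (THE i. \<exists>u v. u < v \<and> v < n \<and> 0 < layer u v \<and> A = seg u v \<and> i = layer u v)" for A
  have lv: "lv (seg u v) = layer u v" if "u < v" "v < n" "0 < layer u v" for u v
    unfolding lv_def using that seg_inj[OF that(1,2) _ _ that(3)] by (intro the_equality) blast+
  have "level_partition F m (\<lambda>i. {A \<in> F. lv A = i})"
  proof (rule level_partitionI)
    show "lv A \<in> {1..m}" if "A \<in> F" for A
      using that lv layer_le n4 m unfolding F by fastforce
    show "\<not> crosses_over A A" if "A \<in> F" for A
      using that unfolding F by (auto simp: crosses_over_seg_iff)
    show "lv B < lv A" if "A \<in> F" "B \<in> F" "crosses_over A B" for A B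
      using that lv unfolding F by (auto simp: crosses_over_seg_iff)
    show "\<exists>B\<in>F. crosses_over A B \<and> lv B = lv A - 1" if A: "A \<in> F" "2 \<le> lv A" for A
    proof -
      obtain u v where uv: "u < v" "v < n" "0 < layer u v" "A = seg u v" using A(1) unfolding F by blast
      then have "2 \<le> layer u v" using A(2) lv by simp
      then obtain u' v' where uv': "u' < v'" "v' < n" "interleaved u v u' v' \<or> interleaved u' v' u v" "layer u' v' = layer u v - 1"
        using next_lower_level[OF uv(1,2)] by blast
      then have "0 < layer u' v'" "layer u' v' < layer u v" using \<open>2 \<le> layer u v\<close> by auto
      moreover from this have "seg u' v' \<in> F" unfolding F using uv' by blast
      ultimately have "seg u' v' \<in> F" "crosses_over A (seg u' v')" "lv (seg u' v') = lv A - 1"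
        using uv uv' lv by (auto simp: crosses_over_seg_iff)
      then show ?thesis by blast
    qed
    show "\<exists>A\<in>F. lv A = i" if "i \<in> {1..m}" for i
    proof -
      have "i \<in> {1..(n + 1) div 2}" using that m by simp
      then obtain u v where uv: "u < v" "v < n" "layer u v = i" using level_nonempty[OF n4] by metis
      then have "0 < layer u v" using that by simp
      then show ?thesis using uv lv unfolding F by blast
    qed
  qed
  then show ?thesis unfolding F_def by blast
qed

lemma divided_in_levels_layered:
  assumes "n = 3 \<and> m = 0 \<or> 4 \<le> n \<and> m = (n + 1) div 2"
  shows "divided_in_levels K layered_drawing [0..<n] m"
proof -
  have CP: "cycle_support layered_drawing [0..<n] = polygon \<times> {0}" using C_polygon by (simp add: C_def)
  have fC: "fst ` (polygon \<times> {0 :: real}) = polygon" by force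
  have ends: "a = b" if "u < v" "v < n" "0 < layer u v" "a \<in> seg u v" "b \<in> C" "fst a = fst b" for u v a b
  proof -
    have b: "fst b \<in> polygon" "snd b = 0" using that(5) unfolding C_polygon by auto
    then have "fst a \<notin> inside polygon" using that(6) inside_no_overlap[of polygon] by (metis disjoint_iff)
    then have "a \<in> C" using chord_inside[OF that(1-3)] that(4) by blast
    then have "snd a = 0" unfolding C_polygon by auto
    then show ?thesis using b that(6) by (simp add: prod_eq_iff)
  qed
  have "semi_leveled_diagram K layered_drawing [0..<n]"
    unfolding semi_leveled_diagram_def
  proof (intro conjI ballI impI)
    show "is_cycle K [0..<n]" by (rule cyc)
    show "unknotted (to_S3 ` cycle_support layered_drawing [0..<n])" unfolding CP by (rule unknotted_polygon)
    fix A assume "A \<in> fragments K layered_drawing [0..<n]"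
    then obtain u v where A: "A = seg u v" "u < v" "v < n" "0 < layer u v" unfolding fragments_layered by blast
    show "\<not> crosses_over A A" using A by (simp add: crosses_over_seg_iff)
    show "\<not> crosses_over A (cycle_support layered_drawing [0..<n])" "\<not> crosses_over (cycle_support layered_drawing [0..<n]) A"
      using ends[OF A(2-4)] unfolding A(1) C_def[symmetric] crosses_over_def by (metis less_irrefl)+
    fix B assume "B \<in> fragments K layered_drawing [0..<n]"
    then obtain u' v' where B: "B = seg u' v'" "u' < v'" "v' < n" "0 < layer u' v'" unfolding fragments_layered by blast
    show "\<not> (crosses_over A B \<and> crosses_over B A)" using A B by (simp add: crosses_over_seg_iff)
  qed
  moreover have "fst ` (A - cycle_support layered_drawing [0..<n]) \<subseteq> inside (fst ` cycle_support layered_drawing [0..<n])"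
    if "A \<in> fragments K layered_drawing [0..<n]" for A
    using that chord_inside unfolding fragments_layered CP fC C_polygon by blast
  moreover have "inj_on fst (cycle_support layered_drawing [0..<n])" unfolding CP by (auto simp: inj_on_def)
  ultimately show ?thesis
    unfolding divided_in_levels_def using reduced_layered level_partition_layered[OF assms] by blast
qed

end

section \<open>Level numbers of complete graphs\<close>

text \<open>Only finitely many crossings and ends of edges are involved, so \<open>\<delta>\<close> can be smaller than half of every
positive difference that matters. The value \<open>cr\<close> is the abscissa of the intersection of two lines.\<close>

lemma exists_convex_drawing:
  assumes "3 \<le> n"
  shows "\<exists>x \<delta>. convex_drawing x n \<delta>"
proof -
  obtain x where x: "strict_mono x" "no_three_concurrent x n" using exists_no_three_concurrent by blast
  have xl: "x i < x j \<longleftrightarrow> i < j" for i j using x(1) by (simp add: strict_mono_less)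
  define cr where "cr = (\<lambda>(u, v, u', v'). (x u * x v - x u' * x v') / (x u + x v - x u' - x v'))"
  define I where "I = {..<n} \<times> {..<n} \<times> {..<n} \<times> {..<n}"
  define T where "T = (\<lambda>(u, v, u', v'). cr (u, v, u', v') - x u') ` I \<union>
    (\<lambda>(u, v, u', v'). x v - cr (u, v, u', v')) ` I \<union> (\<lambda>(u, v). x v - x u) ` ({..<n} \<times> {..<n})"
  have "finite T" by (simp add: T_def I_def)
  define M where "M = Min (insert 1 {y \<in> T. 0 < y})"
  define \<delta> where "\<delta> = M / 3"
  have fin: "finite (insert 1 {y \<in> T. 0 < y})" using \<open>finite T\<close> by simp
  have "M \<in> insert 1 {y \<in> T. 0 < y}" unfolding M_def using fin by (intro Min_in) auto
  then have "0 < M" by auto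
  have small: "2 * \<delta> < y" if "y \<in> T" "0 < y" for y
  proof -
    have "M \<le> y" unfolding M_def using fin that by (intro Min_le) auto
    then show ?thesis using \<open>0 < M\<close> by (simp add: \<delta>_def)
  qed
  have d: "0 < \<delta>" using \<open>0 < M\<close> by (simp add: \<delta>_def)
  have "convex_drawing x n \<delta>"
  proof
    show "strict_mono x" "3 \<le> n" "0 < \<delta>" "no_three_concurrent x n" using x assms d by auto
    show "2 * \<delta> < x v - x u" if "u < v" "v < n" for u v
    proof (rule small)
      have "(u, v) \<in> {..<n} \<times> {..<n}" using that by auto
      then show "x v - x u \<in> T" unfolding T_def by (intro UnI2 image_eqI[of _ _ "(u, v)"]) auto
      show "0 < x v - x u" using that xl by simp
    qed
    show "x u' + \<delta> < t \<and> t < x v - \<delta>"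
      if h: "interleaved u v u' v'" "v' < n" "line (x u) (x v) t = line (x u') (x v') t" "x u' < t" "t < x v"
      for u v u' v' t
    proof -
      have o: "u < u'" "u' < v" "v < v'" using h(1) by (auto simp: interleaved_def)
      have ne: "x u + x v - x u' - x v' < 0" using o xl[of u u'] xl[of v v'] by linarith
      have "(x u + x v - x u' - x v') * t = x u * x v - x u' * x v'"
        using line_diff[of "x u" "x v" t "x u'" "x v'"] h(3) by simp
      then have t: "t = cr (u, v, u', v')" using ne by (simp add: cr_def field_simps)
      have I: "(u, v, u', v') \<in> I" using o h(2) by (auto simp: I_def)
      have "t - x u' \<in> T" unfolding T_def t using I by (intro UnI1 image_eqI[of _ _ "(u, v, u', v')"]) auto
      moreover have "x v - t \<in> T" unfolding T_def t
        by (rule UnI1, rule UnI2, rule image_eqI[of _ _ "(u, v, u', v')"]) (use I in auto)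
      ultimately have "2 * \<delta> < t - x u'" "2 * \<delta> < x v - t" using small h(4,5) by auto
      then show ?thesis using d by linarith
    qed
  qed
  then show ?thesis by blast
qed

lemma embedding_map_drawing:
  assumes D: "embedding G D UNIV" and f: "continuous_on UNIV f" "inj f" "range f \<subseteq> S"
  shows "embedding G (map_drawing f D) S"
proof -
  have D': "inj_on (vpos D) (verts G)"
    "\<And>e. e \<in> edges G \<Longrightarrow> \<exists>\<gamma>. arc \<gamma> \<and> path_image \<gamma> = earc D e \<and> {pathstart \<gamma>, pathfinish \<gamma>} = vpos D ` e"
    "\<And>v e. v \<in> verts G \<Longrightarrow> e \<in> edges G \<Longrightarrow> vpos D v \<in> earc D e \<Longrightarrow> v \<in> e"
    "\<And>e e'. e \<in> edges G \<Longrightarrow> e' \<in> edges G \<Longrightarrow> e \<noteq> e' \<Longrightarrow> earc D e \<inter> earc D e' \<subseteq> vpos D ` (e \<inter> e')"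
    using D by (simp_all add: embedding_def)
  show ?thesis
    unfolding embedding_def
  proof (intro conjI ballI impI)
    show "inj_on (vpos (map_drawing f D)) (verts G)"
      using D'(1) f(2) by (auto simp: map_drawing_def intro: comp_inj_on inj_on_subset)
    show "vpos (map_drawing f D) ` verts G \<subseteq> S" using f(3) by (auto simp: map_drawing_def)
    fix e assume e: "e \<in> edges G"
    show "earc (map_drawing f D) e \<subseteq> S" using f(3) by (auto simp: map_drawing_def)
    obtain \<gamma> where \<gamma>: "arc \<gamma>" "path_image \<gamma> = earc D e" "{pathstart \<gamma>, pathfinish \<gamma>} = vpos D ` e"
      using D'(2)[OF e] by blast
    have "arc (f \<circ> \<gamma>)"
      using \<gamma>(1) f by (intro arc_continuous_image) (auto intro: continuous_on_subset inj_on_subset)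
    moreover have "{pathstart (f \<circ> \<gamma>), pathfinish (f \<circ> \<gamma>)} = (f \<circ> vpos D) ` e"
      using \<gamma>(3) by (metis (no_types, lifting) image_comp image_empty image_insert pathfinish_compose pathstart_compose)
    ultimately show "\<exists>\<gamma>. arc \<gamma> \<and> path_image \<gamma> = earc (map_drawing f D) e \<and>
        {pathstart \<gamma>, pathfinish \<gamma>} = vpos (map_drawing f D) ` e"
      using \<gamma>(2) by (intro exI[of _ "f \<circ> \<gamma>"]) (simp add: map_drawing_def path_image_compose)
    show "v \<in> e" if "v \<in> verts G" "vpos (map_drawing f D) v \<in> earc (map_drawing f D) e" for v
      using that D'(3)[OF that(1) e] f(2) by (simp add: map_drawing_def inj_image_mem_iff)
    fix e' assume e': "e' \<in> edges G" "e \<noteq> e'"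
    have "f ` earc D e \<inter> f ` earc D e' = f ` (earc D e \<inter> earc D e')" using f(2) by (simp add: image_Int)
    also have "\<dots> \<subseteq> f ` vpos D ` (e \<inter> e')" using D'(4)[OF e e'] by (rule image_mono)
    finally show "earc (map_drawing f D) e \<inter> earc (map_drawing f D) e' \<subseteq> vpos (map_drawing f D) ` (e \<inter> e')"
      by (simp add: map_drawing_def image_comp)
  qed
qed

text \<open>A drawing in space is a diagram of its own stereographic image.\<close>

lemma leveled_with_to_S3:
  assumes D: "polygonal_embedding G D" "regular_projection G D" "divided_in_levels G D c m"
    and conn: "connected (support G D)"
  shows "tame_embedding G (map_drawing to_S3 D)" "leveled_with G (map_drawing to_S3 D) c m"
proof -
  let ?G = "map_drawing to_S3 D"
  have refl: "ambient_isotopic G ?G ?G"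
    unfolding ambient_isotopic_def
  proof (intro exI conjI)
    have "\<exists>g. homeomorphism S3 S3 id g" by (intro exI[of _ id]) (auto simp: homeomorphism_def)
    then show "homotopic_with_canon (\<lambda>f. \<exists>g. homeomorphism S3 S3 f g) S3 S3 id id" by simp
  qed auto
  have "embedding G D UNIV" using D(1) by (simp add: polygonal_embedding_def)
  then have "embedding G ?G S3"
    using continuous_to_S3 inj_to_S3 to_S3_in_S3 by (intro embedding_map_drawing) auto
  then show "tame_embedding G ?G" using refl D(1) by (auto simp: tame_embedding_def)
  have "support G ?G = to_S3 ` support G D"
    by (simp add: support_def map_drawing_def image_Un image_UN image_comp)
  then have "connected (support G ?G)"
    using conn continuous_to_S3 by (simp add: connected_continuous_image continuous_on_subset)
  then show "leveled_with G ?G c m" using D refl unfolding leveled_with_def is_diagram_def by blast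
qed

lemma level_number_le:
  assumes "polygonal_embedding G D" "regular_projection G D" "divided_in_levels G D c m"
    "connected (support G D)"
  shows "level_number G \<le> enat m"
proof -
  note l = leveled_with_to_S3[OF assms]
  have "level_number G \<le> spatial_level_number G (map_drawing to_S3 D)"
    unfolding level_number_def using l(1) by (intro INF_lower) simp
  also have "\<dots> \<le> enat m"
    unfolding spatial_level_number_def using l(2) by (intro Inf_lower) blast
  finally show ?thesis .
qed

lemma hamiltonian_level_number_le:
  assumes "polygonal_embedding G D" "regular_projection G D" "divided_in_levels G D c m"
    "connected (support G D)" "hamiltonian_cycle G c"
  shows "hamiltonian_level_number G \<le> enat m"
proof -
  note l = leveled_with_to_S3[OF assms(1-4)]
  have "hamiltonian_level_number G \<le> spatial_hamiltonian_level_number G (map_drawing to_S3 D)"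
    unfolding hamiltonian_level_number_def using l(1) by (intro INF_lower) simp
  also have "\<dots> \<le> enat m"
    unfolding spatial_hamiltonian_level_number_def using l(2) assms(5) by (intro Inf_lower) blast
  finally show ?thesis .
qed

lemma level_number_ge:
  assumes "\<And>\<G> c m. leveled_with G \<G> c m \<Longrightarrow> N \<le> enat m"
  shows "N \<le> level_number G"
  unfolding level_number_def spatial_level_number_def
  using assms by (intro INF_greatest Inf_greatest) blast

lemma hamiltonian_level_number_ge:
  assumes "\<And>\<G> c m. leveled_with G \<G> c m \<Longrightarrow> hamiltonian_cycle G c \<Longrightarrow> N \<le> enat m"
  shows "N \<le> hamiltonian_level_number G"
  unfolding hamiltonian_level_number_def spatial_hamiltonian_level_number_def
  using assms by (intro INF_greatest Inf_greatest) blast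

lemma leveled_with_leveled_drawing:
  assumes "leveled_with (complete_graph n) \<G> c m"
  obtains D where "leveled_drawing n D c m"
proof -
  obtain D where D: "is_diagram (complete_graph n) \<G> D" "divided_in_levels (complete_graph n) D c m"
    using assms unfolding leveled_with_def by blast
  have "leveled_drawing n D c m"
  proof
    show "embedding (complete_graph n) D UNIV" using D(1) by (simp add: is_diagram_def polygonal_embedding_def)
    show "is_cycle (complete_graph n) c" using D(2) by (simp add: divided_in_levels_def semi_leveled_diagram_def)
    show "divided_in_levels (complete_graph n) D c m" by (rule D(2))
  qed
  then show thesis using that by blast
qed

lemma leveled_with_hamiltonian_bound:
  assumes "leveled_with (complete_graph n) \<G> c m" "hamiltonian_cycle (complete_graph n) c" "4 \<le> n"
  shows "(n + 1) div 2 \<le> m"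
proof -
  obtain D where "leveled_drawing n D c m" using assms(1) by (rule leveled_with_leveled_drawing)
  then interpret leveled_drawing n D c m .
  have "n \<le> 2 * m" using assms(2,3) by (intro hamiltonian_levels) (auto simp: hamiltonian_cycle_def)
  then show ?thesis by simp
qed

lemma leveled_with_bound:
  assumes "leveled_with (complete_graph n) \<G> c m"
  shows "3 \<le> n" "n = 4 \<Longrightarrow> 1 \<le> m" "5 \<le> n \<Longrightarrow> (n + 1) div 2 \<le> m"
proof -
  obtain D where "leveled_drawing n D c m" using assms by (rule leveled_with_leveled_drawing)
  then interpret leveled_drawing n D c m .
  show "3 \<le> n" using k3 card_set_c card_mono[OF _ set_c_less] by simp
  have "n \<le> 2 * m" if "5 \<le> n \<or> n = 4 \<and> {..<n} \<subseteq> set c"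
    using that hamiltonian_levels non_hamiltonian_levels(2) by fastforce
  then show "n = 4 \<Longrightarrow> 1 \<le> m" "5 \<le> n \<Longrightarrow> (n + 1) div 2 \<le> m"
    using non_hamiltonian_levels(1) by fastforce+
qed

lemma closed_segment_flat: "closed_segment (a, 0) (b, 0) = closed_segment a b \<times> {0 :: real}"
  by (auto simp: in_segment)

text \<open>The planar drawing of $K_4$ as a triangle with a central vertex. With the triangle as spine, the star of the centre is
the only fragment.\<close>

locale triangle_star = convex_drawing x 3 \<delta> for x \<delta>
begin

definition "Q i = (if i < 3 then Pt i else centre)"

definition star :: "(nat, space3) drawing" where
  "star = \<lparr>vpos = \<lambda>v. (Q v, 0), earc = \<lambda>e. closed_segment (Q (Min e), 0) (Q (Max e), 0)\<rparr>"

lemma vpos_star [simp]: "vpos star v = (Q v, 0)"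
  by (simp add: star_def)

lemma earc_star: "u < v \<Longrightarrow> earc star {u, v} = closed_segment (Q u) (Q v) \<times> {0}"
  by (simp add: star_def closed_segment_flat)

lemma gauge_Pt: "i < 3 \<Longrightarrow> gauge_fn (Pt i - centre) = 1"
proof -
  assume i: "i < 3"
  have "Pt i \<in> closed_segment (Pt i) (Pt (nxt i))" by simp
  then have "Pt i \<in> polygon" unfolding polygon_eq using i by blast
  then show ?thesis by (simp add: polygon_def)
qed

text \<open>The gauge is a coordinate along each leg: it is \<open>0\<close> at the centre and \<open>1\<close> on the triangle.\<close>

lemma legE:
  assumes "z \<in> closed_segment (Pt i) centre" "i < 3"
  obtains s where "0 \<le> s" "s \<le> 1" "z = centre + s *\<^sub>R (Pt i - centre)" "gauge_fn (z - centre) = s"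
proof -
  have "z \<in> closed_segment centre (Pt i)" using assms(1) by (simp add: closed_segment_commute)
  then obtain s where s: "0 \<le> s" "s \<le> 1" "z = (1 - s) *\<^sub>R centre + s *\<^sub>R Pt i"
    by (auto simp: in_segment)
  then have z: "z = centre + s *\<^sub>R (Pt i - centre)" by (simp add: algebra_simps)
  then have "gauge_fn (z - centre) = s" using homog[OF s(1)] gauge_Pt[OF assms(2)] by simp
  then show thesis using that s z by blast
qed

lemma Q_eq: "i < 4 \<Longrightarrow> j < 4 \<Longrightarrow> Q i = Q j \<longleftrightarrow> i = j"
proof -
  have "Pt i \<noteq> centre" if "i < 3" for i using gauge_Pt[OF that] zero by auto
  then show "i < 4 \<Longrightarrow> j < 4 \<Longrightarrow> Q i = Q j \<longleftrightarrow> i = j"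
    by (auto simp: Q_def Pt_eq) (metis less_antisym numeral_3_eq_3 eval_nat_numeral(3) less_Suc_eq)+
qed

lemma side_seg: "u < v \<Longrightarrow> v < 3 \<Longrightarrow> seg u v = closed_segment (Pt u) (Pt v) \<times> {0}"
proof (rule seg_flat)
  assume "u < v" "v < 3"
  then have "v = Suc u \<or> u = 0 \<and> v = 3 - 1" by linarith
  then show "layer u v = 0" by (simp add: layer_def)
qed

lemma star_edgeE:
  assumes "e \<in> edges (complete_graph 4)"
  obtains (side) u v where "e = {u, v}" "u < v" "v < 3" "earc star e = seg u v" "earc layered_drawing e = seg u v"
      "e \<in> edges (complete_graph 3)" "earc star e \<subseteq> polygon \<times> {0}"
  | (leg) u where "e = {u, 3}" "u < 3" "earc star e = closed_segment (Pt u) centre \<times> {0}"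
proof -
  obtain a b where ab: "e = {a, b}" "a < 4" "b < 4" "a \<noteq> b" using assms complete_graph_edgeE by blast
  define u where "u = min a b"
  define v where "v = max a b"
  have uv: "e = {u, v}" "u < v" "v < 4" using ab by (auto simp: u_def v_def min_def max_def)
  show thesis
  proof (cases "v < 3")
    case True
    have s: "earc star e = seg u v" "earc layered_drawing e = seg u v" using uv True side_seg by (simp_all add: earc_star Q_def)
    have e3: "e \<in> edges (complete_graph 3)" using uv True by simp
    have "layer u v = 0" using uv(2) True unfolding layer_def by auto
    then have "e \<in> cycle_edges [0..<3]" using layer_zero_iff uv True by auto
    then have "seg u v \<subseteq> C" using s(2) by (auto simp: C_def cycle_support_def)
    then show thesis using side[of u v] uv True s e3 C_polygon by simp
  next
    case False
    then have "v = 3" using uv by simp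
    then show thesis using leg[of u] uv by (simp add: earc_star Q_def)
  qed
qed

lemma star_flat:
  assumes "e \<in> edges (complete_graph 4)" "y \<in> earc star e" shows "snd y = 0"
proof -
  obtain u v where "e = {u, v}" "u < v" using assms(1)
    by (elim complete_graph_edgeE) (metis insert_commute linorder_neqE_nat)
  then show ?thesis using assms(2) earc_star by auto
qed

lemma support_star_flat: "y \<in> support (complete_graph 4) star \<Longrightarrow> snd y = 0"
proof -
  assume "y \<in> support (complete_graph 4) star"
  then consider v where "y = vpos star v" | e where "e \<in> edges (complete_graph 4)" "y \<in> earc star e"
    unfolding support_def by blast
  then show "snd y = 0" by cases (simp, rule star_flat)
qed

lemma polygonal_embedding_star: "polygonal_embedding (complete_graph 4) star"
  unfolding polygonal_embedding_def embedding_def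
proof (intro conjI ballI impI)
  show "inj_on (vpos star) (verts (complete_graph 4))" by (auto simp: inj_on_def Q_eq)
  fix e assume e: "e \<in> edges (complete_graph 4)"
  have "\<exists>u v. e = {u, v} \<and> u < v \<and> v < 4" using e
    by (elim complete_graph_edgeE) (metis insert_commute linorder_neqE_nat)
  then obtain u v where uv: "e = {u, v}" "u < v" "v < 4" by blast
  have ne: "Q u \<noteq> Q v" using uv Q_eq[of u v] by simp
  have es: "earc star e = closed_segment (Q u, 0) (Q v, 0)" using uv by (simp add: earc_star closed_segment_flat)
  then show "\<exists>\<gamma>. arc \<gamma> \<and> path_image \<gamma> = earc star e \<and> {pathstart \<gamma>, pathfinish \<gamma>} = vpos star ` e"
    using uv ne by (intro exI[of _ "linepath (Q u, 0) (Q v, 0)"]) auto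
  show "polygonal (earc star e)" unfolding polygonal_def es
    by (intro exI[of _ "{((Q u, 0), (Q v, 0))}"]) auto
  show "w \<in> e" if w: "w \<in> verts (complete_graph 4)" "vpos star w \<in> earc star e" for w
    using e
  proof (cases rule: star_edgeE)
    case (side a b)
    show ?thesis
    proof (cases "w < 3")
      case True
      then have "P w \<in> earc layered_drawing e" using w(2) side(4,5) by (simp add: Q_def)
      then show ?thesis using vertex_in_edge[OF True side(6)] by simp
    next
      case False
      then have "Q w = centre" by (simp add: Q_def)
      then have "centre \<in> polygon" using w(2) side(7) by auto
      then show ?thesis using zero by (simp add: polygon_def)
    qed
  next
    case (leg a)
    then have "Q w \<in> closed_segment (Pt a) centre" using w(2) by simp
    then obtain s where s: "Q w = centre + s *\<^sub>R (Pt a - centre)" "gauge_fn (Q w - centre) = s"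
      using legE leg(2) by metis
    show ?thesis
    proof (cases "w < 3")
      case True
      then have "s = 1" using s(2) gauge_Pt[OF True] by (simp add: Q_def)
      then have "Pt w = Pt a" using s(1) True by (simp add: Q_def)
      then show ?thesis using leg Pt_eq by simp
    next
      case False
      then show ?thesis using w(1) leg by simp
    qed
  qed
  fix f assume f: "f \<in> edges (complete_graph 4)" "e \<noteq> f"
  show "earc star e \<inter> earc star f \<subseteq> vpos star ` (e \<inter> f)"
  proof
    fix y assume y: "y \<in> earc star e \<inter> earc star f"
    have y0: "snd y = 0" using star_flat[OF e] y by blast
    have mixed: "y \<in> vpos star ` (e \<inter> f)"
      if h: "e = {u, v}" "u < v" "v < 3" "e \<in> edges (complete_graph 3)" "earc star e = earc layered_drawing e"
        "earc star e \<subseteq> polygon \<times> {0}" "f = {a, 3}" "a < 3" "earc star f = closed_segment (Pt a) centre \<times> {0}"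
        "y \<in> earc star e" "y \<in> earc star f" for e f u v a
    proof -
      have "fst y \<in> closed_segment (Pt a) centre" using h by auto
      then obtain s where s: "fst y = centre + s *\<^sub>R (Pt a - centre)" "gauge_fn (fst y - centre) = s"
        using legE h(8) by metis
      have "fst y \<in> polygon" using h by auto
      then have "s = 1" using s(2) by (simp add: polygon_def)
      then have ya: "y = (Pt a, 0)" using s(1) y0 by (simp add: prod_eq_iff)
      then have "P a \<in> earc layered_drawing e" using h by simp
      then have "a \<in> e" using vertex_in_edge[OF h(8) h(4)] by simp
      then show ?thesis using ya h(7,8) by (intro image_eqI[of _ _ a]) (auto simp: Q_def)
    qed
    show "y \<in> vpos star ` (e \<inter> f)"
      using e
    proof (cases rule: star_edgeE)
      case e_side: (side u v)
      show ?thesis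
        using f(1)
      proof (cases rule: star_edgeE)
        case (side a b)
        have "y \<in> P ` (e \<inter> f)"
          using edges_Int[OF e_side(6) side(6) f(2)] y e_side(4,5) side(4,5) by auto
        moreover have "w < 3" if "w \<in> e" for w using that e_side by auto
        ultimately show ?thesis by (auto simp: Q_def)
      next
        case (leg a)
        then show ?thesis using mixed[of e u v f a] e_side y by auto
      qed
    next
      case e_leg: (leg a)
      show ?thesis
        using f(1)
      proof (cases rule: star_edgeE)
        case (side u v)
        then show ?thesis using mixed[of f u v e a] e_leg y by (auto simp: Int_commute)
      next
        case (leg b)
        have ab: "a \<noteq> b" using f(2) e_leg(1) leg(1) by auto
        have "fst y \<in> closed_segment (Pt a) centre" "fst y \<in> closed_segment (Pt b) centre"
          using y unfolding e_leg(3) leg(3) by (simp_all add: mem_Times_iff)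
        then obtain s t where st: "fst y = centre + s *\<^sub>R (Pt a - centre)" "gauge_fn (fst y - centre) = s"
          "fst y = centre + t *\<^sub>R (Pt b - centre)" "gauge_fn (fst y - centre) = t"
          using legE e_leg(2) leg(2) by metis
        have "s = 0"
        proof (rule ccontr)
          assume "s \<noteq> 0"
          have "s = t" using st(2,4) by simp
          then have "s *\<^sub>R (Pt a - centre) = s *\<^sub>R (Pt b - centre)" using st(1,3) by (metis add_left_imp_eq)
          then have "Pt a = Pt b" using \<open>s \<noteq> 0\<close> by simp
          then show False using ab Pt_eq by simp
        qed
        then have "y = (Q 3, 0)" using st(1) y0 by (simp add: prod_eq_iff Q_def)
        then show ?thesis using e_leg(1) leg(1) by auto
      qed
    qed
  qed
qed auto

lemma flat_over: "y \<in> support (complete_graph 4) star \<Longrightarrow> y' \<in> support (complete_graph 4) star \<Longrightarrow>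
    fst y = fst y' \<Longrightarrow> y = y'"
  using support_star_flat by (simp add: prod_eq_iff)

lemma regular_projection_star: "regular_projection (complete_graph 4) star"
  unfolding regular_projection_def using flat_over by blast

lemma earc_star_support: "e \<in> edges (complete_graph 4) \<Longrightarrow> earc star e \<subseteq> support (complete_graph 4) star"
  unfolding support_def by blast

lemma reduced_star: "reduced (complete_graph 4) star"
  unfolding reduced_def
proof
  show "\<not> reducible_R1 (complete_graph 4) star"
  proof
    assume "reducible_R1 (complete_graph 4) star"
    then obtain e \<gamma> where e: "e \<in> edges (complete_graph 4)" "arc \<gamma>" "path_image \<gamma> \<subseteq> earc star e"
      "fst (pathstart \<gamma>) = fst (pathfinish \<gamma>)"
      unfolding reducible_R1_def by blast
    then have "pathstart \<gamma> = pathfinish \<gamma>"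
      by (meson earc_star_support flat_over pathfinish_in_path_image pathstart_in_path_image subsetD)
    then show False using arc_distinct_ends[OF e(2)] by simp
  qed
  show "\<not> reducible_R2 (complete_graph 4) star"
  proof
    assume "reducible_R2 (complete_graph 4) star"
    then obtain e f \<gamma> \<epsilon> where e: "e \<in> edges (complete_graph 4)" "f \<in> edges (complete_graph 4)"
      "path_image \<gamma> \<subseteq> earc star e" "path_image \<epsilon> \<subseteq> earc star f" "snd (pathstart \<gamma>) > snd (pathstart \<epsilon>)"
      unfolding reducible_R2_def by blast
    then have "snd (pathstart \<gamma>) = 0" "snd (pathstart \<epsilon>) = 0"
      by (meson star_flat pathstart_in_path_image subsetD)+
    then show False using e(5) by simp
  qed
qed

lemma star_spined: "spined_drawing 4 star [0..<3]"
proof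
  show "embedding (complete_graph 4) star UNIV"
    using polygonal_embedding_star by (simp add: polygonal_embedding_def)
  have "e \<in> edges (complete_graph 4)" if "e \<in> edges (complete_graph 3)" for e :: "nat set"
    using that by (elim complete_graph_edgeE) simp
  then have "edges (complete_graph 3) \<subseteq> edges (complete_graph 4)" by blast
  then show "is_cycle (complete_graph 4) [0..<3]" using cyc by (auto simp: is_cycle_def)
qed

lemma divided_in_levels_star: "divided_in_levels (complete_graph 4) star [0..<3] 1"
proof -
  interpret S: spined_drawing 4 star "[0..<3]" by (rule star_spined)
  have cyc3: "cycle_edges [0..<3] \<subseteq> edges (complete_graph 3)" using cyc by (simp add: is_cycle_def)
  have "earc star e = earc layered_drawing e" if "e \<in> cycle_edges [0..<3]" for e
  proof -
    have e3: "e \<in> edges (complete_graph 3)" using cyc3 that by blast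
    then obtain u v where "e = {u, v}" "u < v" "v < 3" "earc layered_drawing e = seg u v" by (rule edgeE)
    then show ?thesis using side_seg by (simp add: earc_star Q_def)
  qed
  then have CC: "cycle_support star [0..<3] = polygon \<times> {0}"
    using C_polygon unfolding C_def cycle_support_def by simp
  have "S.chords = {}"
  proof -
    have "e \<in> cycle_edges [0..<3]" if "e \<in> edges (complete_graph 4)" "e \<subseteq> set [0..<3]" for e
    proof -
      have "e \<in> edges (complete_graph 3)" using that by (elim complete_graph_edgeE) auto
      then obtain u v where uv: "e = {u, v}" "u < v" "v < 3" by (rule edgeE)
      then have "layer u v = 0" unfolding layer_def by auto
      then show ?thesis using layer_zero_iff uv by auto
    qed
    then show ?thesis unfolding S.chords_def by blast
  qed
  then have fr: "fragments (complete_graph 4) star [0..<3] = {closure S.R}"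
  proof -
    have "3 \<in> {..<4 :: nat}" "3 \<notin> set [0..<3]" by simp_all
    then have "\<not> {..<4} \<subseteq> set [0..<3]" by blast
    then show ?thesis using S.fragments_eq \<open>S.chords = {}\<close> by simp
  qed
  define legs where "legs = (\<Union>i<3. closed_segment (Pt i) centre) \<times> {0 :: real}"
  have "S.R \<subseteq> legs"
  proof
    fix y assume "y \<in> S.R"
    then obtain e where e: "e \<in> edges (complete_graph 4)" "\<not> e \<subseteq> set [0..<3]" "y \<in> earc star e"
      unfolding S.R_def by blast
    from e(1) show "y \<in> legs"
    proof (cases rule: star_edgeE)
      case (side u v) then show ?thesis using e(2) by auto
    next
      case (leg u) then show ?thesis using e(3) by (auto simp: legs_def)
    qed
  qed
  moreover have "closed legs" unfolding legs_def by (intro closed_Times closed_UN) auto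
  ultimately have R: "closure S.R \<subseteq> legs" by (rule closure_minimal)
  have flat: "snd y = 0" if "y \<in> closure S.R" for y using that R by (auto simp: legs_def)
  have nocross: "\<not> crosses_over A B" if "\<And>y. y \<in> A \<Longrightarrow> snd y = 0" "\<And>y. y \<in> B \<Longrightarrow> snd y = 0" for A B
    using that by (fastforce simp: crosses_over_def)
  have "semi_leveled_diagram (complete_graph 4) star [0..<3]"
    unfolding semi_leveled_diagram_def fr
  proof (intro conjI ballI impI)
    show "is_cycle (complete_graph 4) [0..<3]" by (rule S.cyc)
    show "unknotted (to_S3 ` cycle_support star [0..<3])" unfolding CC by (rule unknotted_polygon)
    fix A assume "A \<in> {closure S.R}"
    then have A: "\<And>y. y \<in> A \<Longrightarrow> snd y = 0" using flat by simp
    show "\<not> crosses_over A A" "\<not> crosses_over A (cycle_support star [0..<3])"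
      "\<not> crosses_over (cycle_support star [0..<3]) A"
      unfolding CC using nocross[of A A] nocross[of A "polygon \<times> {0}"] nocross[of "polygon \<times> {0}" A] A
      by (simp_all add: mem_Times_iff)
    fix B assume "B \<in> {closure S.R}" "B \<noteq> A"
    then show "\<not> (crosses_over A B \<and> crosses_over B A)" using \<open>A \<in> {closure S.R}\<close> by simp
  qed
  moreover have "fst ` (closure S.R - cycle_support star [0..<3]) \<subseteq> inside (fst ` cycle_support star [0..<3])"
  proof -
    have fC: "fst ` (polygon \<times> {0 :: real}) = polygon" by force
    have "fst y \<in> inside polygon" if y: "y \<in> closure S.R" "y \<notin> polygon \<times> {0}" for y
    proof -
      obtain i where i: "i < 3" "fst y \<in> closed_segment (Pt i) centre" using R y(1) by (auto simp: legs_def)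
      obtain s where s: "s \<le> 1" "gauge_fn (fst y - centre) = s" using legE[OF i(2,1)] by metis
      have "fst y \<notin> polygon" using y flat by (metis mem_Times_iff singletonI)
      then have "gauge_fn (fst y - centre) < 1" using s by (simp add: polygon_def)
      then show ?thesis using sublevel_subset_inside unfolding polygon_def by blast
    qed
    then show ?thesis unfolding CC fC by blast
  qed
  moreover have "inj_on fst (cycle_support star [0..<3])" unfolding CC by (auto simp: inj_on_def)
  moreover have "level_partition {closure S.R} 1 (\<lambda>i. {closure S.R})"
    by (auto simp: level_partition_def disjoint_family_on_def)
  ultimately show ?thesis unfolding divided_in_levels_def fr using reduced_star by blast
qed

end

lemma level_number_K4_le: "level_number (complete_graph 4) \<le> 1"
proof -
  obtain x \<delta> where "convex_drawing x 3 \<delta>" using exists_convex_drawing by blast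
  then interpret triangle_star x \<delta> by (simp add: triangle_star_def)
  interpret S: spined_drawing 4 star "[0..<3]" by (rule star_spined)
  have "level_number (complete_graph 4) \<le> enat 1"
    by (rule level_number_le[OF polygonal_embedding_star regular_projection_star divided_in_levels_star S.connected_support])
  then show ?thesis by (simp add: one_enat_def)
qed

lemma convex_drawing_bounds:
  assumes "n = 3 \<and> m = 0 \<or> 4 \<le> n \<and> m = (n + 1) div 2"
  shows "hamiltonian_level_number (complete_graph n) \<le> enat m" "level_number (complete_graph n) \<le> enat m"
proof -
  have "3 \<le> n" using assms by auto
  then obtain x \<delta> where "convex_drawing x n \<delta>" using exists_convex_drawing by blast
  then interpret convex_drawing x n \<delta> .
  note d = polygonal_embedding_layered regular_projection_layered divided_in_levels_layered[OF assms] connected_support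
  show "level_number (complete_graph n) \<le> enat m" by (rule level_number_le[OF d])
  have "hamiltonian_cycle (complete_graph n) [0..<n]" using cyc by (auto simp: hamiltonian_cycle_def)
  then show "hamiltonian_level_number (complete_graph n) \<le> enat m" by (rule hamiltonian_level_number_le[OF d])
qed

theorem corollary3:
  fixes n :: nat
  shows "(n \<ge> 3 \<longrightarrow>
           hamiltonian_level_number (complete_graph n) =
             (if n = 3 then 0 else enat (nat \<lceil>real n / 2\<rceil>))) \<and>
         level_number (complete_graph n) =
           (if n < 3 then \<infinity> else if n = 3 then 0 else if n = 4 then 1
            else enat (nat \<lceil>real n / 2\<rceil>))"
proof (intro conjI impI)
  have half: "nat \<lceil>real n / 2\<rceil> = (n + 1) div 2"
  proof -
    have "\<lceil>real n / 2\<rceil> = int ((n + 1) div 2)"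
      by (rule ceiling_unique) (auto simp: field_simps; linarith)+
    then show ?thesis by simp
  qed
  show "hamiltonian_level_number (complete_graph n) = (if n = 3 then 0 else enat (nat \<lceil>real n / 2\<rceil>))"
    if n: "3 \<le> n"
  proof (cases "n = 3")
    case True
    then show ?thesis using convex_drawing_bounds(1)[of n 0] by (simp add: zero_enat_def[symmetric])
  next
    case False
    then have n4: "4 \<le> n" using n by simp
    have "enat ((n + 1) div 2) \<le> hamiltonian_level_number (complete_graph n)"
      using leveled_with_hamiltonian_bound[OF _ _ n4] by (intro hamiltonian_level_number_ge) auto
    moreover have "hamiltonian_level_number (complete_graph n) \<le> enat ((n + 1) div 2)"
      using convex_drawing_bounds(1)[of n "(n + 1) div 2"] n4 by simp
    ultimately have "hamiltonian_level_number (complete_graph n) = enat ((n + 1) div 2)" by (rule antisym[rotated])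
    then show ?thesis using False half by simp
  qed
  consider "n < 3" | "n = 3" | "n = 4" | "5 \<le> n" by linarith
  then show "level_number (complete_graph n) = (if n < 3 then \<infinity> else if n = 3 then 0 else if n = 4 then 1
            else enat (nat \<lceil>real n / 2\<rceil>))"
  proof cases
    case 1
    then have "\<infinity> \<le> level_number (complete_graph n)"
      using leveled_with_bound(1)[of n] by (intro level_number_ge) fastforce
    then show ?thesis using 1 by simp
  next
    case 2
    then show ?thesis using convex_drawing_bounds(2)[of n 0] by (simp add: zero_enat_def[symmetric])
  next
    case 3
    have "enat 1 \<le> level_number (complete_graph n)"
      using leveled_with_bound(2)[of n] 3 by (intro level_number_ge) auto
    then show ?thesis using level_number_K4_le 3 by (simp add: one_enat_def antisym)
  next
    case 4
    have "enat ((n + 1) div 2) \<le> level_number (complete_graph n)"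
      using leveled_with_bound(3)[of n] 4 by (intro level_number_ge) auto
    moreover have "level_number (complete_graph n) \<le> enat ((n + 1) div 2)"
      using convex_drawing_bounds(2)[of n "(n + 1) div 2"] 4 by simp
    ultimately have "level_number (complete_graph n) = enat ((n + 1) div 2)" by (rule antisym[rotated])
    then show ?thesis using 4 half by simp
  qed
qed

end
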